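(* Let $f$ denote the second-order correlation function of the characteristic polynomial of an unrescaled complex sample covariance matrix, and let $b^*:=2\left(b-\tfrac34\right)$. For any $\alpha\in\mathbb{N}$, $\xi\in(0,4)$, $\mu,\nu\in\mathbb{R}$, put $n:=N$, $m:=N-\alpha$, and $$ Z_N(\xi,\mu,\nu):=\left(N^2\xi^2+N\xi(\mu+\nu)+\mu\nu\right)^{\alpha/2}\exp\left(-N\xi-\tfrac12(\mu+\nu)\right). $$ Then $$ \lim_{N\to\infty}\left(g(\xi)^{-1}\,Z_N\big(\xi,\mu/g(\xi),\nu/g(\xi)\big)\cdot\frac{f\big(n,m;N\xi+\mu/g(\xi),N\xi+\nu/g(\xi)\big)}{n!\,m!}\right)=\exp(b^* )\,\mathbb{S}(\mu,\nu). $$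
   Context: Here $\mathbb{N}=\{0,1,2,\dots\}$ and $\alpha$ is fixed as $N\to\infty$ ($N\ge\alpha$). Let $Q$ be a probability distribution on the real line with expectation $0$, variance $1/2$ and finite fourth moment $b$ (i.e. $b=\int x^4\,dQ(x)<\infty$). For $n\ge m$, let $X=X(n,m)$ be the $n\times m$ random matrix whose entries are i.i.d. complex random variables whose real and imaginary parts are independent, each with distribution $Q$, and let $X^*$ be its conjugate transpose. The $m\times m$ matrix $X(n,m)^*X(n,m)$ is the unrescaled complex sample covariance matrix. For $\mu,\nu\in\mathbb{C}$, $$ f(n,m;\mu,\nu):=\mathbb{E}\big(\det(X(n,m)^*X(n,m)-\mu)\,\det(X(n,m)^*X(n,m)-\nu)\big), $$ where $\mu,\nu$ inside the determinants stand for $\mu I_m,\nu I_m$. The Marčenko–Pastur density is $$ g(\xi)=\frac{1}{2\pi\xi}\sqrt{\xi(4-\xi)}\qquad(\xi\in(0,4)). $$ The sine kernel is $\mathbb{S}(x,y):=\dfrac{\sin\pi(x-y)}{\pi(x-y)}$, understood for $x=y$ as its continuous extension. The base of the power $\alpha/2$ in $Z_N$ is positive for all sufficiently large $N$. *)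

theory Defs
  imports "HOL-Probability.Probability" "Jordan_Normal_Form.Schur_Decomposition"
begin

text \<open>
  \<open>X\<close> is an \<open>n \<times> m\<close> random matrix with i.i.d. complex entries, the real and imaginary parts of
  each entry being independent with common distribution \<open>Q\<close>. The entries are identically distributed
  because the joint law of (Re, Im) of every entry is the product of \<open>Q\<close> with itself.
\<close>

locale iid_complex_matrix = prob_space M
  for M :: "'a measure" and Q :: "real measure" and n m :: nat and X :: "'a \<Rightarrow> complex mat" +
  assumes X_carrier: "\<And>\<omega>. \<omega> \<in> space M \<Longrightarrow> X \<omega> \<in> carrier_mat n m"
    and X_indep: "indep_vars (\<lambda>_. borel) (\<lambda>(i, j) \<omega>. X \<omega> $$ (i, j)) ({..<n} \<times> {..<m})"
    and X_Re_Im_indep: "\<And>i j. i < n \<Longrightarrow> j < m \<Longrightarrow>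
          indep_var borel (\<lambda>\<omega>. Re (X \<omega> $$ (i, j))) borel (\<lambda>\<omega>. Im (X \<omega> $$ (i, j)))"
    and X_Re_distr: "\<And>i j. i < n \<Longrightarrow> j < m \<Longrightarrow> distr M borel (\<lambda>\<omega>. Re (X \<omega> $$ (i, j))) = Q"
    and X_Im_distr: "\<And>i j. i < n \<Longrightarrow> j < m \<Longrightarrow> distr M borel (\<lambda>\<omega>. Im (X \<omega> $$ (i, j))) = Q"

definition sample_covariance :: "complex mat \<Rightarrow> complex mat" where
  "sample_covariance A = mat_adjoint A * A"

text \<open>
  The second-order correlation function \<open>f(n,m;\<mu>,\<nu>)\<close> of the characteristic polynomial, for an
  \<open>n \<times> m\<close> random matrix \<open>X\<close> on \<open>M\<close>. The determinant is written qualified since HOL-Analysis has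
  another one, for type-indexed matrices.
\<close>

definition charpoly_correlation ::
    "'a measure \<Rightarrow> ('a \<Rightarrow> complex mat) \<Rightarrow> nat \<Rightarrow> complex \<Rightarrow> complex \<Rightarrow> complex" where
  "charpoly_correlation M X m \<mu> \<nu> =
     (\<integral>\<omega>. Determinant.det (sample_covariance (X \<omega>) - \<mu> \<cdot>\<^sub>m 1\<^sub>m m) *
          Determinant.det (sample_covariance (X \<omega>) - \<nu> \<cdot>\<^sub>m 1\<^sub>m m) \<partial>M)"

definition marchenko_pastur_density :: "real \<Rightarrow> real" where
  "marchenko_pastur_density \<xi> = 1 / (2 * pi * \<xi>) * sqrt (\<xi> * (4 - \<xi>))"

definition sine_kernel :: "real \<Rightarrow> real \<Rightarrow> real" where
  "sine_kernel x y = (if x = y then 1 else sin (pi * (x - y)) / (pi * (x - y)))"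

definition Z_factor :: "nat \<Rightarrow> nat \<Rightarrow> real \<Rightarrow> real \<Rightarrow> real \<Rightarrow> real" where
  "Z_factor \<alpha> N \<xi> \<mu> \<nu> =
     ((real N)\<^sup>2 * \<xi>\<^sup>2 + real N * \<xi> * (\<mu> + \<nu>) + \<mu> * \<nu>) powr (real \<alpha> / 2) *
     exp (- real N * \<xi> - (\<mu> + \<nu>) / 2)"

end

theory Submission
  imports Defs "HOL-Real_Asymp.Real_Asymp"
begin

text \<open>
  Adding a row \<open>r\<close> to the matrix changes \<open>X\<^sup>* X\<close> by a term of rank one, so averaging over \<open>r\<close> turns the
  product of the two determinants into a differential expression in \<open>\<mu>\<close> and \<open>\<nu>\<close>, plus \<open>b\<^sup>*\<close> times the same
  quantity with one column deleted. After multiplication by \<open>\<mu> - \<nu>\<close> the differential operator becomes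
  \<open>(1 - D\<^sub>\<mu>) (1 - D\<^sub>\<nu>)\<close>, and the recursion is solved by
  \<open>f(n,m;\<mu>,\<nu>) / (n! m!) = \<Sum>\<^sub>i (b\<^sup>*)\<^sup>i / i! K\<^sub>m\<^sub>-\<^sub>i(\<mu>,\<nu>)\<close>, where \<open>K\<close> is the Christoffel--Darboux kernel of the
  Laguerre polynomials with parameter \<open>\<alpha>\<close>.

  The kernel is a Wronskian-like expression in one weighted Laguerre function \<open>w\<close>, which satisfies
  \<open>w'' = - (k / x - 1 / 4 + O(1 / x\<^sup>2)) w\<close>. In the bulk \<open>w\<close> is locally a sine wave of frequency \<open>\<pi> g(\<xi>)\<close>; its amplitude
  is an adiabatic invariant, and it is determined by the total mass of \<open>w\<^sup>2 / x\<close>, because the virial identity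
  shows that little mass lies near \<open>0\<close> or beyond the turning point \<open>4 k\<close>. No asymptotics near these two points is
  needed, and the phase of \<open>w\<close> cancels in the kernel. Finally the sum over \<open>i\<close> is dominated by means of
  \<open>2 K\<^sub>m\<^sub>-\<^sub>i(x,y) \<le> K\<^sub>m(x,x) + K\<^sub>m(y,y)\<close>, valid for suitably weighted kernels, and produces the factor \<open>exp b\<^sup>*\<close>.
\<close>

section \<open>Laguerre polynomials and their kernel\<close>

text \<open>The average over a new row contains the trace of a product of two adjugates at different
  spectral parameters. Derivatives of the determinants express it only after multiplication by \<mu>
  - \<nu>, through the resolvent identity, and then it is exactly the commutator term that (1 - D)(1
  - D) produces with the factor \<mu> - \<nu>. This is why the recursion is run for the
  antisymmetric polynomial (\<mu> - \<nu>) times the correlation. It is kept as an array of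
  coefficients, so that differentiation is never exchanged with the expectation. The constant b* is
  the excess of the fourth absolute moment 2b + 1/2 of an entry over 2, the value for a complex
  Gaussian. The limit 1 / pi of the amplitude comes from counting mass: between two points of (0,4)
  the mass is the amplitude times the increment of arccos (1 - \<tau> / 2), up to O(1/k). This
  function grows by pi between 0 and 4, while the total mass is 1.\<close>

text \<open>\<open>lag n m\<close> is \<open>(- 1) ^ m * m!\<close> times the Laguerre polynomial of degree \<open>m\<close> with parameter \<open>n - m\<close>.\<close>

definition lag :: "nat \<Rightarrow> nat \<Rightarrow> real poly" where
  "lag n m = ((\<lambda>p. p - pderiv p) ^^ n) (monom 1 m)"

lemma lag_0: "lag 0 m = monom 1 m"
  by (simp add: lag_def)

lemma lag_Suc_left: "lag (Suc n) m = lag n m - pderiv (lag n m)"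
  by (simp add: lag_def)

lemma lag_0_right: "lag n 0 = 1"
  by (induction n) (simp_all add: lag_0 lag_Suc_left one_pCons[symmetric])

text \<open>Appell property: \<open>1 - pderiv\<close> commutes with \<open>pderiv\<close>, so the
  rule for derivatives of monomials survives every application.\<close>

lemma pderiv_lag_Suc: "pderiv (lag n (Suc m)) = Polynomial.smult (of_nat (Suc m)) (lag n m)"
proof (induction n)
  case 0
  then show ?case by (simp add: lag_0 pderiv_monom smult_monom)
next
  case (Suc n)
  then show ?case
    by (simp add: lag_Suc_left pderiv_diff pderiv_smult smult_diff_right)
qed

lemma pderiv_x_times: "pderiv (monom 1 (Suc 0) * p) = p + monom 1 (Suc 0) * pderiv (p::real poly)"
  by (simp add: pderiv_mult pderiv_monom monom_0 one_pCons[symmetric] algebra_simps)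

text \<open>The commutator of \<open>1 - pderiv\<close> with multiplication by the variable is -1,
  so moving the variable out of n applications leaves n terms with one application fewer. For n = 0
  the truncated \<open>n - 1\<close> stands next to the coefficient 0.\<close>

lemma lag_Suc_right:
  "lag n (Suc m) = monom 1 1 * lag n m - Polynomial.smult (of_nat n) (lag (n - 1) m)"
proof (induction n)
  case 0
  then show ?case by (simp add: lag_0 mult_monom)
next
  case (Suc n)
  have "lag (Suc n) (Suc m) =
      monom 1 1 * lag n m - Polynomial.smult (of_nat n) (lag (n - 1) m)
      - pderiv (monom 1 1 * lag n m - Polynomial.smult (of_nat n) (lag (n - 1) m))"
    using Suc by (simp add: lag_Suc_left)
  also have "\<dots> = monom 1 1 * lag (Suc n) m - lag n m
      - Polynomial.smult (of_nat n) (lag (n - 1) m - pderiv (lag (n - 1) m))"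
    by (simp add: lag_Suc_left pderiv_diff pderiv_smult pderiv_x_times smult_diff_right right_diff_distrib)
  also have "\<dots> = monom 1 1 * lag (Suc n) m - Polynomial.smult (of_nat (Suc n)) (lag n m)"
  proof -
    have "Polynomial.smult (of_nat (Suc n)) (lag n m) = lag n m + Polynomial.smult (of_nat n) (lag n m)"
      by (simp only: of_nat_Suc smult_add_left smult_1_left)
    moreover have "Polynomial.smult (of_nat n) (lag (n - 1) m - pderiv (lag (n - 1) m))
        = Polynomial.smult (of_nat n) (lag n m)"
      by (cases n) (simp_all add: lag_Suc_left[symmetric] del: of_nat_Suc)
    ultimately show ?thesis by simp
  qed
  finally show ?case by simp
qed

lemma degree_lag: "degree (lag n m) \<le> m"
proof (induction n)
  case 0
  then show ?case by (simp add: lag_0 degree_monom_le)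
next
  case (Suc n)
  then show ?case
    unfolding lag_Suc_left by (intro degree_diff_le) (simp_all add: degree_pderiv)
qed

text \<open>Exchanges the parameter a - b with its negative at the price of a power of the variable.
  It serves to absorb the weight x^\<alpha> into a polynomial and to find the zero of
  \<open>lag j n\<close> at 0 for j < n. The lowered index in \<open>lag_Suc_right\<close> is why
  \<open>a\<close> stays arbitrary in the induction on \<open>b\<close>.\<close>

lemma lag_symmetry: "monom 1 a * lag a b = monom 1 b * lag b a"
proof (induction b arbitrary: a)
  case 0
  then show ?case by (simp add: lag_0 lag_0_right monom_0)
next
  case (Suc b)
  have low: "Polynomial.smult (of_nat a) (monom 1 a * lag (a - 1) b)
      = Polynomial.smult (of_nat a) (monom 1 1 * (monom 1 b * lag b (a - 1)))"
  proof (cases a)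
    case (Suc a')
    have "monom 1 a * lag (a - 1) b = monom 1 1 * (monom 1 a' * lag a' b)"
      by (simp add: Suc mult.assoc[symmetric] mult_monom)
    then show ?thesis
      using Suc.IH[of a'] Suc by simp
  qed simp
  have "monom 1 a * lag a (Suc b)
      = monom 1 1 * (monom 1 a * lag a b) - Polynomial.smult (of_nat a) (monom 1 a * lag (a - 1) b)"
    by (simp add: lag_Suc_right algebra_simps)
  also have "\<dots> = monom 1 1 * (monom 1 b * (lag b a - pderiv (lag b a)))"
  proof (cases a)
    case 0
    then show ?thesis using low Suc.IH[of a]
      by (simp add: lag_0_right pderiv_1)
  next
    case (Suc a')
    show ?thesis unfolding low Suc.IH[of a] unfolding Suc pderiv_lag_Suc
      by (simp add: algebra_simps)
  qed
  also have "\<dots> = monom 1 (Suc b) * lag (Suc b) a"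
    by (simp add: lag_Suc_left mult.assoc[symmetric] mult_monom)
  finally show ?case .
qed

text \<open>The auxiliary \<open>q\<close>, with both indices lowered, satisfies two first-order
  relations with \<open>lag n m\<close>. Eliminating \<open>q\<close> and its derivative leaves the
  Laguerre equation with parameter n - m.\<close>

lemma lag_ode:
  assumes "0 < n" "0 < m"
  shows "x * poly (pderiv (pderiv (lag n m))) x + (real n - real m + 1 - x) * poly (pderiv (lag n m)) x
    + real m * poly (lag n m) x = 0"
proof -
  obtain n' m' where nm: "n = Suc n'" "m = Suc m'"
    using assms by (auto dest!: gr0_implies_Suc)
  define y q where "y = lag n m" and "q = lag n' m'"
  have 1: "Polynomial.smult (real m) (q - pderiv q) = pderiv y"
    by (simp add: y_def q_def nm lag_Suc_left[symmetric] pderiv_lag_Suc del: of_nat_Suc)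
  have "Polynomial.smult (real m) (Polynomial.smult (real n) q) = monom 1 1 * pderiv y - Polynomial.smult (real m) y"
    unfolding y_def q_def nm pderiv_lag_Suc unfolding lag_Suc_right
    by (simp add: algebra_simps smult_diff_right smult_add_left mult_smult_right)
  moreover from this have "Polynomial.smult (real m) (Polynomial.smult (real n) (pderiv q))
      = pderiv (monom 1 1 * pderiv y - Polynomial.smult (real m) y)"
    by (simp only: pderiv_smult[symmetric])
  ultimately have "poly (Polynomial.smult (real m) (Polynomial.smult (real n) q)) x = poly (monom 1 1 * pderiv y - Polynomial.smult (real m) y) x"
      "poly (Polynomial.smult (real m) (Polynomial.smult (real n) (pderiv q))) x = poly (pderiv (monom 1 1 * pderiv y - Polynomial.smult (real m) y)) x"
    by simp_all
  moreover have "poly (Polynomial.smult (real m) (q - pderiv q)) x = poly (pderiv y) x"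
    by (simp only: 1)
  ultimately have e: "real m * (real n * poly q x) = x * poly (pderiv y) x - real m * poly y x"
    "real m * (real n * poly (pderiv q) x) = poly (pderiv y) x + x * poly (pderiv (pderiv y)) x - real m * poly (pderiv y) x"
    "real m * (poly q x - poly (pderiv q) x) = poly (pderiv y) x"
    by (simp_all add: poly_monom pderiv_x_times pderiv_diff pderiv_smult del: of_nat_Suc)
  have "real n * poly (pderiv y) x = real m * (real n * poly q x) - real m * (real n * poly (pderiv q) x)"
    unfolding e(3)[symmetric] by (simp add: algebra_simps)
  then show ?thesis unfolding e(1,2) y_def[symmetric] by (simp add: algebra_simps)
qed

text \<open>The denominators are the squared norms for the weight x^\<alpha> exp (- x), so this is
  the reproducing kernel of the polynomials of degree at most m.\<close>

definition lag_kernel :: "nat \<Rightarrow> nat \<Rightarrow> real \<Rightarrow> real \<Rightarrow> real" where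
  "lag_kernel \<alpha> m x y =
     (\<Sum>j\<le>m. poly (lag (j + \<alpha>) j) x * poly (lag (j + \<alpha>) j) y / (fact (j + \<alpha>) * fact j))"

text \<open>The two polynomials share \<open>n\<close>, so their parameters differ by one: n - m - 1
  and n - m. This makes the second a multiple of the derivative of the first.\<close>

definition wronski :: "nat \<Rightarrow> nat \<Rightarrow> real \<Rightarrow> real \<Rightarrow> real" where
  "wronski n m x y = poly (lag n (Suc m)) x * poly (lag n m) y - poly (lag n m) x * poly (lag n (Suc m)) y"

lemma lag_Suc_right_poly:
  "poly (lag n (Suc m)) x = x * poly (lag n m) x - real n * poly (lag (n - 1) m) x"
  by (simp add: lag_Suc_right poly_monom)

lemma lag_Suc_left_poly:
  "poly (lag (Suc n) (Suc m)) x = poly (lag n (Suc m)) x - real (Suc m) * poly (lag n m) x"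
  by (simp add: lag_Suc_left pderiv_lag_Suc del: of_nat_Suc)

text \<open>Both indices rise together, so that n - m and with it the weight is unchanged: one step
  of the Christoffel--Darboux telescoping.\<close>

lemma wronski_Suc:
  "wronski (Suc n) (Suc m) x y = (x - y) * poly (lag (Suc n) (Suc m)) x * poly (lag (Suc n) (Suc m)) y
     + real (Suc n) * real (Suc m) * wronski n m x y"
proof -
  let ?q = "\<lambda>x. poly (lag (Suc n) (Suc m)) x"
  have 1: "poly (lag (Suc n) (Suc (Suc m))) z = z * ?q z - real (Suc n) * poly (lag n (Suc m)) z" for z
    by (simp only: lag_Suc_right_poly diff_Suc_1)
  have 2: "poly (lag n (Suc m)) z = ?q z + real (Suc m) * poly (lag n m) z" for z
    by (simp only: lag_Suc_left_poly)
  show ?thesis unfolding wronski_def 1 unfolding 2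
    by (simp add: algebra_simps del: of_nat_Suc)
qed

lemma christoffel_darboux:
  "(x - y) * lag_kernel \<alpha> m x y = wronski (m + \<alpha>) m x y / (fact (m + \<alpha>) * fact m)"
proof (induction m)
  case 0
  have "lag \<alpha> (Suc 0) = monom 1 1 - Polynomial.smult (real \<alpha>) 1"
    by (simp add: lag_Suc_right lag_0_right)
  then show ?case
    by (simp add: lag_kernel_def wronski_def lag_0_right poly_monom)
next
  case (Suc m)
  have "(x - y) * lag_kernel \<alpha> (Suc m) x y = (x - y) * lag_kernel \<alpha> m x y +
     (x - y) * poly (lag (Suc m + \<alpha>) (Suc m)) x * poly (lag (Suc m + \<alpha>) (Suc m)) y
       / (fact (Suc m + \<alpha>) * fact (Suc m))"
    by (simp add: lag_kernel_def algebra_simps)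
  also have "(x - y) * lag_kernel \<alpha> m x y =
      real (Suc (m + \<alpha>)) * real (Suc m) * wronski (m + \<alpha>) m x y / (fact (Suc m + \<alpha>) * fact (Suc m))"
    unfolding Suc.IH by (simp add: divide_simps del: of_nat_Suc)
  also have "\<dots> + (x - y) * poly (lag (Suc m + \<alpha>) (Suc m)) x * poly (lag (Suc m + \<alpha>) (Suc m)) y
       / (fact (Suc m + \<alpha>) * fact (Suc m)) = wronski (Suc m + \<alpha>) (Suc m) x y / (fact (Suc m + \<alpha>) * fact (Suc m))"
    unfolding add_Suc wronski_Suc by (simp only: add_divide_distrib[symmetric] add.commute)
  finally show ?case .
qed

text \<open>Turns the expression in two polynomials into a Wronskian of one polynomial at two
  points, the form to which a differential equation applies.\<close>

lemma wronski_pderiv: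
  "real (Suc m) * wronski n m x y =
     poly (lag n (Suc m)) x * poly (pderiv (lag n (Suc m))) y
     - poly (pderiv (lag n (Suc m))) x * poly (lag n (Suc m)) y"
  by (simp add: wronski_def pderiv_lag_Suc algebra_simps del: of_nat_Suc)

lemma lag_kernel_off_diag:
  "(x - y) * lag_kernel \<alpha> m x y * (fact (m + \<alpha>) * fact (Suc m)) =
     poly (lag (m + \<alpha>) (Suc m)) x * poly (pderiv (lag (m + \<alpha>) (Suc m))) y
     - poly (pderiv (lag (m + \<alpha>) (Suc m))) x * poly (lag (m + \<alpha>) (Suc m)) y"
  unfolding wronski_pderiv[symmetric] christoffel_darboux by simp

text \<open>Differentiating the off-diagonal identity in y at y = x avoids dividing by x - y. The
  polynomial \<open>?K\<close> is the kernel with its first argument frozen.\<close>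

lemma lag_kernel_diag:
  "lag_kernel \<alpha> m x x * (fact (m + \<alpha>) * fact (Suc m)) =
     (poly (pderiv (lag (m + \<alpha>) (Suc m))) x)\<^sup>2
     - poly (lag (m + \<alpha>) (Suc m)) x * poly (pderiv (pderiv (lag (m + \<alpha>) (Suc m)))) x"
proof -
  let ?Y = "lag (m + \<alpha>) (Suc m)"
  let ?T = "fact (m + \<alpha>) * fact (Suc m) :: real"
  let ?K = "\<Sum>j\<le>m. Polynomial.smult (poly (lag (j + \<alpha>) j) x / (fact (j + \<alpha>) * fact j)) (lag (j + \<alpha>) j)"
  have K: "lag_kernel \<alpha> m x y = poly ?K y" for y
    by (simp add: lag_kernel_def poly_sum mult.commute)
  have K': "(x - y) * poly ?K y * ?T = poly ?Y x * poly (pderiv ?Y) y - poly (pderiv ?Y) x * poly ?Y y" for y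
    using lag_kernel_off_diag[of x y \<alpha> m] by (simp only: K)
  have "((\<lambda>y. (x - y) * poly ?K y * ?T) has_real_derivative - poly ?K x * ?T) (at x)"
    by (auto intro!: derivative_eq_intros)
  moreover have "((\<lambda>y. (x - y) * poly ?K y * ?T) has_real_derivative
      poly ?Y x * poly (pderiv (pderiv ?Y)) x - (poly (pderiv ?Y) x)\<^sup>2) (at x)"
    unfolding K' by (auto intro!: derivative_eq_intros simp: power2_eq_square)
  ultimately have "- poly ?K x * ?T = poly ?Y x * poly (pderiv (pderiv ?Y)) x - (poly (pderiv ?Y) x)\<^sup>2"
    by (rule DERIV_unique)
  then show ?thesis unfolding K by linarith
qed

text \<open>\<open>- exp (- x) * resolv p\<close> is an antiderivative of \<open>exp (- x) * p\<close>, so the value of \<open>resolv p\<close> at \<open>0\<close>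
  is the integral of \<open>exp (- x) * p\<close> over the positive half-line.\<close>

definition resolv :: "real poly \<Rightarrow> real poly" where
  "resolv p = (\<Sum>j\<le>degree p. (pderiv ^^ j) p)"

lemma resolv_diff_pderiv: "resolv p - pderiv (resolv p) = p"
proof -
  have "pderiv (resolv p) = (\<Sum>j\<le>degree p. (pderiv ^^ Suc j) p)"
    by (simp add: resolv_def pderiv_sum)
  then have "resolv p - pderiv (resolv p) = (\<Sum>j\<le>degree p. (pderiv ^^ j) p - (pderiv ^^ Suc j) p)"
    by (simp add: resolv_def sum_subtractf)
  also have "\<dots> = (pderiv ^^ 0) p - (pderiv ^^ Suc (degree p)) p"
    by (rule sum_telescope)
  also have "(pderiv ^^ Suc (degree p)) p = 0"
    by (simp add: pderiv_eq_0_iff degree_higher_pderiv)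
  finally show ?thesis by simp
qed

lemma poly_eq_pderiv_imp_0:
  fixes p :: "real poly"
  assumes "p - pderiv p = 0"
  shows "p = 0"
proof (rule ccontr)
  assume "p \<noteq> 0"
  moreover have "p = pderiv p" using assms by simp
  ultimately have "degree p = degree p - 1" "degree p > 0"
    using degree_pderiv[of p] pderiv_eq_0_iff[of p] by auto
  then show False by simp
qed

lemma resolv_eqI: "q - pderiv q = p \<Longrightarrow> resolv p = q"
  using poly_eq_pderiv_imp_0[of "resolv p - q"] resolv_diff_pderiv[of p]
  by (simp add: pderiv_diff algebra_simps)

lemma resolv_add: "resolv (p + q) = resolv p + resolv q"
proof (rule resolv_eqI)
  show "resolv p + resolv q - pderiv (resolv p + resolv q) = p + q"
    using resolv_diff_pderiv[of p] resolv_diff_pderiv[of q] by (simp add: pderiv_add algebra_simps)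
qed

lemma resolv_smult: "resolv (Polynomial.smult c p) = Polynomial.smult c (resolv p)"
proof (rule resolv_eqI)
  show "Polynomial.smult c (resolv p) - pderiv (Polynomial.smult c (resolv p)) = Polynomial.smult c p"
    unfolding pderiv_smult smult_diff_right[symmetric] resolv_diff_pderiv ..
qed

text \<open>Integration by parts in algebraic form: the derivative of exp (- x) p is - exp (- x) (p
  - p'), and p q is the boundary term.\<close>

lemma resolv_by_parts: "resolv ((p - pderiv p) * q) = p * q + resolv (p * pderiv q)"
proof -
  have "(p - pderiv p) * q = (p * q - pderiv (p * q)) + p * pderiv q"
    by (simp add: pderiv_mult algebra_simps)
  then show ?thesis
    by (simp only: resolv_add resolv_eqI[OF refl])
qed

lemma lag_at_0:
  assumes "j < n"
  shows "poly (lag j n) 0 = 0"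
proof -
  have "monom 1 j * lag j n = monom 1 j * (monom 1 (n - j) * lag n j)"
    using assms by (simp add: lag_symmetry[of j n] mult.assoc[symmetric] mult_monom)
  then have "lag j n = monom 1 (n - j) * lag n j"
    by (simp add: monom_eq_0_iff)
  then show ?thesis using assms by (simp add: poly_monom)
qed

text \<open>Integration by parts takes one operator 1 - D off the first factor, until the Gamma
  integral of x^n remains. The boundary value vanishes because one of its two factors has a zero at
  0. The case j = n + 1 is the one needed later for \<alpha> = 0.\<close>

lemma resolv_lag_mult_lag:
  assumes "j \<le> Suc n"
  shows "poly (resolv (lag j n * lag n j)) 0 = fact j * fact n"
  using assms
proof (induction j)
  case 0
  have "poly (resolv (monom 1 n)) 0 = fact n"
  proof (induction n)
    case 0
    have "resolv 1 = 1" by (rule resolv_eqI) (simp add: pderiv_1)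
    then show ?case by (simp add: monom_0 one_pCons[symmetric])
  next
    case (Suc n)
    have "resolv (monom 1 (Suc n)) = resolv ((1 - pderiv 1) * monom 1 (Suc n))"
      by (simp add: pderiv_1)
    also have "\<dots> = monom 1 (Suc n) + resolv (Polynomial.smult (of_nat (Suc n)) (monom 1 n))"
      unfolding resolv_by_parts by (simp add: pderiv_monom smult_monom)
    finally show ?case
      by (simp add: resolv_smult poly_monom Suc del: of_nat_Suc)
  qed
  then show ?case by (simp add: lag_0 lag_0_right)
next
  case (Suc j)
  have boundary: "poly (lag j n) 0 * poly (lag n (Suc j)) 0 = 0"
  proof (cases "j < n")
    case False
    then have "n < Suc j" by simp
    then show ?thesis by (simp add: lag_at_0)
  qed (simp add: lag_at_0)
  have "resolv (lag (Suc j) n * lag n (Suc j)) =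
      lag j n * lag n (Suc j) + resolv (Polynomial.smult (of_nat (Suc j)) (lag j n * lag n j))"
    unfolding lag_Suc_left resolv_by_parts pderiv_lag_Suc by (simp add: mult.commute)
  then have "poly (resolv (lag (Suc j) n * lag n (Suc j))) 0
     = real (Suc j) * poly (resolv (lag j n * lag n j)) 0"
    by (simp add: resolv_smult boundary del: of_nat_Suc)
  then show ?case using Suc by simp
qed

section \<open>WKB analysis in the oscillatory region\<close>

lemma DERIV_abs_le_imp_diff_le:
  fixes F G :: "real \<Rightarrow> real"
  assumes "a \<le> b"
    and F: "\<And>x. a \<le> x \<Longrightarrow> x \<le> b \<Longrightarrow> (F has_real_derivative F' x) (at x)"
    and G: "\<And>x. a \<le> x \<Longrightarrow> x \<le> b \<Longrightarrow> (G has_real_derivative G' x) (at x)"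
    and le: "\<And>x. a \<le> x \<Longrightarrow> x \<le> b \<Longrightarrow> \<bar>F' x\<bar> \<le> G' x"
  shows "\<bar>F b - F a\<bar> \<le> G b - G a"
proof -
  have "G a - F a \<le> G b - F b"
    using F G le by (intro DERIV_nonneg_imp_nondecreasing[OF \<open>a \<le> b\<close>])
      (force intro!: exI derivative_eq_intros)
  moreover have "G a + F a \<le> G b + F b"
  proof (intro DERIV_nonneg_imp_nondecreasing[OF \<open>a \<le> b\<close>] exI conjI)
    fix x assume "a \<le> x" "x \<le> b"
    then show "((\<lambda>x. G x + F x) has_real_derivative G' x + F' x) (at x)" "0 \<le> G' x + F' x"
      using F G le[of x] by (auto intro!: derivative_eq_intros)
  qed
  ultimately show ?thesis by linarith
qed

text \<open>Reciprocal of the local frequency sqrt (1 / \<tau> - 1 / 4) of the solution in the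
  unscaled variable; in the WKB approximation the squared amplitude is proportional to it.\<close>

definition wkb_g :: "real \<Rightarrow> real" where "wkb_g \<tau> = 1 / sqrt (1 / \<tau> - 1 / 4)"

lemma wkb_U_pos: "0 < \<tau> \<Longrightarrow> \<tau> < 4 \<Longrightarrow> 1 / \<tau> - 1 / 4 > (0::real)"
  by (simp add: field_simps)

lemma wkb_g_pos: "0 < \<tau> \<Longrightarrow> \<tau> < 4 \<Longrightarrow> wkb_g \<tau> > 0"
  using wkb_U_pos[of \<tau>] by (simp add: wkb_g_def)

lemma wkb_g_square: "0 < \<tau> \<Longrightarrow> \<tau> < 4 \<Longrightarrow> (1 / \<tau> - 1 / 4) * (wkb_g \<tau>)\<^sup>2 = 1"
  using wkb_U_pos[of \<tau>] by (simp add: wkb_g_def power_divide)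

lemma wkb_g_deriv:
  assumes "0 < \<tau>" "\<tau> < 4"
  shows "(wkb_g has_real_derivative wkb_g \<tau> ^ 3 / (2 * \<tau>\<^sup>2)) (at \<tau>)"
proof -
  let ?U = "1 / \<tau> - 1 / 4"
  have U: "?U > 0" using wkb_U_pos assms .
  have "((\<lambda>\<tau>. 1 / sqrt (1 / \<tau> - 1 / 4)) has_real_derivative
      - ((- 1 / \<tau>\<^sup>2) * (inverse (sqrt ?U) / 2)) / (sqrt ?U)\<^sup>2) (at \<tau>)"
  proof (rule DERIV_cong)
    show "((\<lambda>\<tau>. 1 / sqrt (1 / \<tau> - 1 / 4)) has_real_derivative
      (0 * sqrt ?U - 1 * ((0 * \<tau> - 1 * 1) / (\<tau> * \<tau>) - 0) * (inverse (sqrt ?U) / 2)) / (sqrt ?U * sqrt ?U)) (at \<tau>)"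
      using U assms by (auto intro!: derivative_eq_intros DERIV_real_sqrt)
  qed (simp add: power2_eq_square)
  also have "- ((- 1 / \<tau>\<^sup>2) * (inverse (sqrt ?U) / 2)) / (sqrt ?U)\<^sup>2 = wkb_g \<tau> ^ 3 / (2 * \<tau>\<^sup>2)"
    by (simp add: wkb_g_def power_divide power3_eq_cube power2_eq_square divide_simps)
  finally show ?thesis by (simp add: wkb_g_def[abs_def])
qed

text \<open>Its derivative g / (2 \<tau>) equals 1 / sqrt (\<tau> (4 - \<tau>)), so this is pi times
  the distribution function of the arcsine law on (0,4), the law to which the mass
  converges.\<close>

definition wkb_\<theta> :: "real \<Rightarrow> real" where "wkb_\<theta> \<tau> = arccos (1 - \<tau> / 2)"

lemma wkb_\<theta>_deriv:
  assumes "0 < \<tau>" "\<tau> < 4"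
  shows "(wkb_\<theta> has_real_derivative wkb_g \<tau> / (2 * \<tau>)) (at \<tau>)"
proof -
  have "(wkb_\<theta> has_real_derivative (inverse (- sqrt (1 - (1 - \<tau> / 2)\<^sup>2)) * (- 1 / 2))) (at \<tau>)"
    unfolding wkb_\<theta>_def[abs_def] using assms
    by (auto intro!: derivative_eq_intros DERIV_arccos)
  also have "1 - (1 - \<tau> / 2)\<^sup>2 = \<tau>\<^sup>2 * (1 / \<tau> - 1 / 4)"
    using assms by (simp add: power2_eq_square field_simps)
  also have "inverse (- sqrt (\<tau>\<^sup>2 * (1 / \<tau> - 1 / 4))) * (- 1 / 2) = wkb_g \<tau> / (2 * \<tau>)"
    using assms by (simp add: real_sqrt_mult wkb_g_def inverse_eq_divide mult.commute)
  finally show ?thesis .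
qed

text \<open>The span of these monomials is closed under differentiation, because the derivative of
  \<open>wkb_g\<close> is g^3 / (2 \<tau>^2). So all derivatives of \<open>wkb_g\<close> stay
  explicit and are bounded on compact subintervals of (0,4).\<close>

definition "wkb_mono p q \<tau> = wkb_g \<tau> ^ p / \<tau> ^ q"

lemma wkb_mono_deriv:
  assumes "0 < \<tau>" "\<tau> < 4" "0 < p"
  shows "(wkb_mono p q has_real_derivative
    real p / 2 * wkb_mono (p + 2) (q + 2) \<tau> - real q * wkb_mono p (q + 1) \<tau>) (at \<tau>)"
proof -
  obtain p' where p: "p = Suc p'" using assms(3) by (auto dest: gr0_implies_Suc)
  show ?thesis
  proof (rule DERIV_cong)
    show "(wkb_mono p q has_real_derivative
      (real p * (wkb_g \<tau> ^ 3 / (2 * \<tau>\<^sup>2)) * wkb_g \<tau> ^ (p - 1) * \<tau> ^ q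
        - wkb_g \<tau> ^ p * (real q * \<tau> ^ (q - 1))) / (\<tau> ^ q * \<tau> ^ q)) (at \<tau>)"
      unfolding wkb_mono_def[abs_def] using assms by (auto intro!: derivative_eq_intros wkb_g_deriv)
  qed (cases q; use assms in \<open>simp_all add: p wkb_mono_def field_simps power_add eval_nat_numeral\<close>)
qed

text \<open>The functions \<open>wkb_h1\<close> to \<open>wkb_h3\<close> are the derivatives of
  \<open>wkb_g\<close>, and \<open>wkb_H1\<close> to \<open>wkb_H3\<close> those of
  \<open>wkb_H\<close>. The third ones enter only errors of order 1/k^2.\<close>

definition "wkb_h1 \<tau> = 1 / 2 * (wkb_mono 3 2 \<tau>)"
definition "wkb_h2 \<tau> = 3 / 4 * (wkb_mono 5 4 \<tau>) - wkb_mono 3 3 \<tau>"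
definition "wkb_h3 \<tau> = 15 / 8 * (wkb_mono 7 6 \<tau>) - 9 / 2 * (wkb_mono 5 5 \<tau>) + 3 * (wkb_mono 3 4 \<tau>)"

definition "wkb_H \<tau> = wkb_\<theta> \<tau> * wkb_g \<tau>"
definition "wkb_H1 \<tau> = 1 / 2 * (wkb_mono 2 1 \<tau>) + wkb_\<theta> \<tau> * wkb_h1 \<tau>"
definition "wkb_H2 \<tau> = 3 / 4 * (wkb_mono 4 3 \<tau>) - 1 / 2 * (wkb_mono 2 2 \<tau>) + wkb_\<theta> \<tau> * wkb_h2 \<tau>"
definition "wkb_H3 \<tau> = 3 / 2 * (wkb_mono 6 5 \<tau>) - 11 / 4 * (wkb_mono 4 4 \<tau>)
   + wkb_mono 2 3 \<tau> + wkb_g \<tau> / (2 * \<tau>) * wkb_h2 \<tau> + wkb_\<theta> \<tau> * wkb_h3 \<tau>"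

lemma wkb_h_deriv: "0 < \<tau> \<Longrightarrow> \<tau> < 4 \<Longrightarrow> (wkb_g has_real_derivative wkb_h1 \<tau>) (at \<tau>)"
  using wkb_g_deriv[of \<tau>] by (simp add: wkb_h1_def wkb_mono_def)

lemma wkb_h1_deriv:
  assumes "0 < \<tau>" "\<tau> < 4"
  shows "(wkb_h1 has_real_derivative wkb_h2 \<tau>) (at \<tau>)"
  unfolding wkb_h1_def[abs_def] wkb_h2_def using assms
  by (auto intro!: derivative_eq_intros wkb_mono_deriv) (simp add: field_simps)?

lemma wkb_h2_deriv:
  assumes "0 < \<tau>" "\<tau> < 4"
  shows "(wkb_h2 has_real_derivative wkb_h3 \<tau>) (at \<tau>)"
  unfolding wkb_h2_def[abs_def] wkb_h3_def using assms
  by (auto intro!: derivative_eq_intros wkb_mono_deriv) (simp add: field_simps)?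

lemma wkb_H_deriv:
  assumes "0 < \<tau>" "\<tau> < 4"
  shows "(wkb_H has_real_derivative wkb_H1 \<tau>) (at \<tau>)"
  unfolding wkb_H_def[abs_def] wkb_H1_def using assms
  by (auto intro!: derivative_eq_intros wkb_h_deriv wkb_\<theta>_deriv simp: wkb_mono_def power2_eq_square)

lemma wkb_H1_deriv:
  assumes "0 < \<tau>" "\<tau> < 4"
  shows "(wkb_H1 has_real_derivative wkb_H2 \<tau>) (at \<tau>)"
proof -
  have "wkb_g \<tau> / (2 * \<tau>) * wkb_h1 \<tau> = 1 / 4 * (wkb_mono 4 3 \<tau>)"
    by (simp add: wkb_h1_def wkb_mono_def eval_nat_numeral)
  then show ?thesis
    unfolding wkb_H1_def[abs_def] wkb_H2_def using assms
    by (auto intro!: derivative_eq_intros wkb_mono_deriv wkb_h1_deriv wkb_\<theta>_deriv)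
       (simp add: field_simps numeral_2_eq_2 numeral_3_eq_3)
qed

lemma wkb_H2_deriv:
  assumes "0 < \<tau>" "\<tau> < 4"
  shows "(wkb_H2 has_real_derivative wkb_H3 \<tau>) (at \<tau>)"
  unfolding wkb_H2_def[abs_def] wkb_H3_def using assms
  by (auto intro!: derivative_eq_intros wkb_mono_deriv wkb_h2_deriv wkb_\<theta>_deriv)
     (simp add: field_simps)

lemma continuous_on_wkb_g: "continuous_on {0<..<4} wkb_g"
  by (intro continuous_at_imp_continuous_on) (auto intro!: DERIV_isCont[OF wkb_g_deriv])

lemma continuous_on_wkb_\<theta>: "continuous_on {0<..<4} wkb_\<theta>"
  by (intro continuous_at_imp_continuous_on) (auto intro!: DERIV_isCont[OF wkb_\<theta>_deriv])

lemma continuous_on_wkb_h3: "continuous_on {0<..<4} wkb_h3"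
  unfolding wkb_h3_def[abs_def] wkb_mono_def by (intro continuous_intros continuous_on_wkb_g) auto

lemma continuous_on_wkb_H3: "continuous_on {0<..<4} wkb_H3"
  unfolding wkb_H3_def[abs_def] wkb_h2_def[abs_def] wkb_mono_def
  by (intro continuous_intros continuous_on_wkb_g continuous_on_wkb_\<theta> continuous_on_wkb_h3) auto

lemma bounded_on_inner_interval:
  fixes f :: "real \<Rightarrow> real"
  assumes "continuous_on {0<..<4} f" "0 < \<delta>"
  obtains C where "C \<ge> 0" "\<And>\<tau>. \<delta> \<le> \<tau> \<Longrightarrow> \<tau> \<le> 4 - \<delta> \<Longrightarrow> \<bar>f \<tau>\<bar> \<le> C"
proof -
  have "compact (f ` {\<delta>..4 - \<delta>})"
    using assms by (intro compact_continuous_image continuous_on_subset[OF assms(1)]) auto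
  then have "bounded (f ` {\<delta>..4 - \<delta>})"
    by (rule compact_imp_bounded)
  then obtain C where C: "\<forall>\<tau>\<in>{\<delta>..4 - \<delta>}. \<bar>f \<tau>\<bar> \<le> C"
    by (auto simp: bounded_iff)
  show ?thesis by (rule that[of "\<bar>C\<bar>"]) (use C in \<open>auto intro: order_trans[OF _ abs_ge_self]\<close>)
qed

text \<open>\<open>u\<close> is a solution in the scaled variable \<open>\<tau> = x / k\<close> and \<open>ud\<close> its derivative in the unscaled variable \<open>x\<close>;
  \<open>M\<close> is the distribution function of the mass \<open>u\<^sup>2 / \<tau>\<close>, and \<open>b\<close> is the virial, whose growth is \<open>1 - \<tau> / 2\<close> times
  that of \<open>M\<close>: since it vanishes at \<open>0\<close> and at infinity, it controls the mass near \<open>0\<close> and beyond the turning point \<open>4\<close>.\<close>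

locale wkb =
  fixes k :: "nat \<Rightarrow> real" and c :: real and u ud M b :: "nat \<Rightarrow> real \<Rightarrow> real"
  assumes k_ge_1: "\<And>n. k n \<ge> 1"
    and k_lim: "filterlim k at_top sequentially"
    and u_deriv: "\<And>n \<tau>. 0 < \<tau> \<Longrightarrow> (u n has_real_derivative k n * ud n \<tau>) (at \<tau>)"
    and ud_deriv: "\<And>n \<tau>. 0 < \<tau> \<Longrightarrow>
      (ud n has_real_derivative - k n * (1 / \<tau> - 1 / 4 + c / ((k n)\<^sup>2 * \<tau>\<^sup>2)) * u n \<tau>) (at \<tau>)"
    and M_deriv: "\<And>n \<tau>. 0 < \<tau> \<Longrightarrow> (M n has_real_derivative (u n \<tau>)\<^sup>2 / \<tau>) (at \<tau>)"
    and M_cont: "\<And>n. continuous_on {0..} (M n)"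
    and M_0: "\<And>n. M n 0 = 0"
    and M_lim: "\<And>n. (M n \<longlongrightarrow> 1) at_top"
    and b_eq: "\<And>n \<tau>. 0 < \<tau> \<Longrightarrow> b n \<tau> =
      \<tau> * ((ud n \<tau>)\<^sup>2 + (1 / \<tau> - 1 / 4 + c / ((k n)\<^sup>2 * \<tau>\<^sup>2)) * (u n \<tau>)\<^sup>2) - u n \<tau> * ud n \<tau> / k n"
    and b_cont: "\<And>n. continuous_on {0..} (b n)"
    and b_0: "\<And>n. b n 0 = 0"
    and b_lim: "\<And>n. (b n \<longlongrightarrow> 0) at_top"
begin

text \<open>The potential is taken without its term in \<open>c\<close>, which away from 0 is a
  correction of order 1/k^2.\<close>

definition energy :: "nat \<Rightarrow> real \<Rightarrow> real" where
  "energy n \<tau> = (ud n \<tau>)\<^sup>2 + (1 / \<tau> - 1 / 4) * (u n \<tau>)\<^sup>2"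

text \<open>For \<open>h = wkb_g\<close> this is the adiabatic invariant, for \<open>h = wkb_\<theta> * wkb_g\<close> its increments are those of the mass \<open>M\<close>
  up to \<open>O(1/k)\<close>, and for \<open>h = id\<close> it is the virial \<open>b\<close>. The terms with \<open>h1 = h'\<close> and \<open>h2 = h''\<close> remove the oscillating
  part of the derivative.\<close>

definition invariant :: "(real \<Rightarrow> real) \<Rightarrow> (real \<Rightarrow> real) \<Rightarrow> (real \<Rightarrow> real) \<Rightarrow> nat \<Rightarrow> real \<Rightarrow> real" where
  "invariant h h1 h2 n \<tau> =
     h \<tau> * ((ud n \<tau>)\<^sup>2 + (1 / \<tau> - 1 / 4 + c / ((k n)\<^sup>2 * \<tau>\<^sup>2)) * (u n \<tau>)\<^sup>2)
     - h1 \<tau> * (u n \<tau> * ud n \<tau>) / k n + h2 \<tau> * (u n \<tau>)\<^sup>2 / (2 * (k n)\<^sup>2)"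

lemma k_pos: "k n > 0"
  using k_ge_1[of n] by linarith

lemma inverse_k_lim: "(\<lambda>n. C / k n) \<longlonglongrightarrow> 0"
  by (rule real_tendsto_divide_at_top[OF tendsto_const k_lim])

lemma eventually_le_k: "eventually (\<lambda>n. C \<le> k n) sequentially"
  using k_lim unfolding filterlim_at_top by blast

text \<open>The term with \<open>h1\<close> converts (ud)^2 into the potential times u^2, and the
  term with \<open>h2\<close> cancels the mixed product u ud that this creates. What remains at
  leading order is 2 h' (1 / \<tau> - 1 / 4) - h / \<tau>^2 times u^2, and h is chosen to make this
  simple.\<close>

lemma invariant_deriv:
  assumes "0 < \<tau>"
    and h: "(h has_real_derivative h1 \<tau>) (at \<tau>)" "(h1 has_real_derivative h2 \<tau>) (at \<tau>)"
      "(h2 has_real_derivative h3) (at \<tau>)"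
  shows "(invariant h h1 h2 n has_real_derivative
     (2 * h1 \<tau> * (1 / \<tau> - 1 / 4) - h \<tau> / \<tau>\<^sup>2) * (u n \<tau>)\<^sup>2
     + (c * (2 * h1 \<tau> / \<tau>\<^sup>2 - 2 * h \<tau> / \<tau> ^ 3) + h3 / 2) * (u n \<tau>)\<^sup>2 / (k n)\<^sup>2) (at \<tau>)"
proof -
  let ?k = "k n" and ?u = "u n \<tau>" and ?v = "ud n \<tau>"
  let ?V = "\<lambda>\<tau>. 1 / \<tau> - 1 / 4 + c / (?k\<^sup>2 * \<tau>\<^sup>2)"
  let ?V' = "- 1 / \<tau>\<^sup>2 - 2 * c / (?k\<^sup>2 * \<tau> ^ 3)"
  have k: "?k \<noteq> 0" using k_pos[of n] by simp
  have V: "(?V has_real_derivative ?V') (at \<tau>)"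
  proof (rule DERIV_cong)
    show "(?V has_real_derivative
       (0 * \<tau> - 1 * 1) / (\<tau> * \<tau>) - 0 + (0 * (?k\<^sup>2 * \<tau>\<^sup>2) - c * (?k\<^sup>2 * (2 * \<tau>))) / (?k\<^sup>2 * \<tau>\<^sup>2 * (?k\<^sup>2 * \<tau>\<^sup>2))) (at \<tau>)"
      using assms(1) k by (auto intro!: derivative_eq_intros)
  qed (use assms(1) k in \<open>simp add: field_simps eval_nat_numeral\<close>)
  note u = u_deriv[OF assms(1), of n] and v = ud_deriv[OF assms(1), of n]
  let ?W = "?V \<tau>"
  have 1: "((\<lambda>\<tau>. h \<tau> * ((ud n \<tau>)\<^sup>2 + ?V \<tau> * (u n \<tau>)\<^sup>2)) has_real_derivative
     h1 \<tau> * (?v\<^sup>2 + ?W * ?u\<^sup>2) + h \<tau> * (2 * ?v * (- ?k * ?W * ?u) + (?V' * ?u\<^sup>2 + ?W * (2 * ?u * (?k * ?v))))) (at \<tau>)"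
    by (rule DERIV_cong[OF DERIV_mult[OF h(1) DERIV_add[OF DERIV_power[OF v, of 2]
        DERIV_mult[OF V DERIV_power[OF u, of 2]]]]]) (simp add: algebra_simps)
  have 2: "((\<lambda>\<tau>. h1 \<tau> * (u n \<tau> * ud n \<tau>) / ?k) has_real_derivative
     (h2 \<tau> * (?u * ?v) + h1 \<tau> * (?k * ?v * ?v + ?u * (- ?k * ?W * ?u))) / ?k) (at \<tau>)"
    by (rule DERIV_cong[OF DERIV_cdivide[OF DERIV_mult[OF h(2) DERIV_mult[OF u v]]]]) (simp add: algebra_simps)
  have 3: "((\<lambda>\<tau>. h2 \<tau> * (u n \<tau>)\<^sup>2 / (2 * ?k\<^sup>2)) has_real_derivative
     (h3 * ?u\<^sup>2 + h2 \<tau> * (2 * ?u * (?k * ?v))) / (2 * ?k\<^sup>2)) (at \<tau>)"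
    by (rule DERIV_cong[OF DERIV_cdivide[OF DERIV_mult[OF h(3) DERIV_power[OF u, of 2]]]]) (simp add: algebra_simps)
  have W: "?W = 1 / \<tau> - 1 / 4 + c / (?k\<^sup>2 * \<tau>\<^sup>2)" ..
  show ?thesis
    unfolding invariant_def[abs_def]
  proof (rule DERIV_cong[OF DERIV_add[OF DERIV_diff[OF 1 2] 3]])
    define W where "W = ?W"
    define V' where "V' = ?V'"
    have "h1 \<tau> * (?v\<^sup>2 + W * ?u\<^sup>2) + h \<tau> * (2 * ?v * (- ?k * W * ?u) + (V' * ?u\<^sup>2 + W * (2 * ?u * (?k * ?v))))
      - (h2 \<tau> * (?u * ?v) + h1 \<tau> * (?k * ?v * ?v + ?u * (- ?k * W * ?u))) / ?k
      + (h3 * ?u\<^sup>2 + h2 \<tau> * (2 * ?u * (?k * ?v))) / (2 * ?k\<^sup>2)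
      = (2 * h1 \<tau> * W + h \<tau> * V') * ?u\<^sup>2 + h3 * ?u\<^sup>2 / (2 * ?k\<^sup>2)"
      using k by (simp add: field_simps power2_eq_square)
    also have "\<dots> = (2 * h1 \<tau> * (1 / \<tau> - 1 / 4) - h \<tau> / \<tau>\<^sup>2) * ?u\<^sup>2
     + (c * (2 * h1 \<tau> / \<tau>\<^sup>2 - 2 * h \<tau> / \<tau> ^ 3) + h3 / 2) * ?u\<^sup>2 / ?k\<^sup>2"
    proof -
      have "2 * h1 \<tau> * W + h \<tau> * V' = (2 * h1 \<tau> * (1 / \<tau> - 1 / 4) - h \<tau> / \<tau>\<^sup>2)
         + c * (2 * h1 \<tau> / \<tau>\<^sup>2 - 2 * h \<tau> / \<tau> ^ 3) / ?k\<^sup>2"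
        unfolding W_def V'_def by (simp add: algebra_simps add_divide_distrib diff_divide_distrib)
      moreover have "(P + R / K) * U + h3 * U / (2 * K) = P * U + (R + h3 / 2) * U / K" if "K \<noteq> 0" for P R U K
        using that by (simp add: field_simps)
      ultimately show ?thesis using k by simp
    qed
    finally show "h1 \<tau> * (?v\<^sup>2 + ?W * ?u\<^sup>2) + h \<tau> * (2 * ?v * (- ?k * ?W * ?u) + (?V' * ?u\<^sup>2 + ?W * (2 * ?u * (?k * ?v))))
      - (h2 \<tau> * (?u * ?v) + h1 \<tau> * (?k * ?v * ?v + ?u * (- ?k * ?W * ?u))) / ?k
      + (h3 * ?u\<^sup>2 + h2 \<tau> * (2 * ?u * (?k * ?v))) / (2 * ?k\<^sup>2)
      = (2 * h1 \<tau> * (1 / \<tau> - 1 / 4) - h \<tau> / \<tau>\<^sup>2) * ?u\<^sup>2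
     + (c * (2 * h1 \<tau> / \<tau>\<^sup>2 - 2 * h \<tau> / \<tau> ^ 3) + h3 / 2) * ?u\<^sup>2 / ?k\<^sup>2"
      unfolding W_def V'_def .
  qed
qed

lemma M_mono: "0 \<le> x \<Longrightarrow> x \<le> y \<Longrightarrow> M n x \<le> M n y"
  by (rule DERIV_nonneg_imp_increasing_open[of x y "M n"])
     (auto intro!: exI M_deriv continuous_on_subset[OF M_cont])

lemma M_nonneg: "0 \<le> x \<Longrightarrow> 0 \<le> M n x"
  using M_mono[of 0 x n] by (simp add: M_0)

lemma M_le_1:
  assumes "0 \<le> x"
  shows "M n x \<le> 1"
proof (rule tendsto_lowerbound[OF M_lim])
  show "\<forall>\<^sub>F y in at_top. M n x \<le> M n y"
    using eventually_ge_at_top[of x] by eventually_elim (use M_mono assms in auto)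
qed simp

lemma b_deriv:
  assumes "0 < \<tau>"
  shows "(b n has_real_derivative (1 - \<tau> / 2) * ((u n \<tau>)\<^sup>2 / \<tau>)) (at \<tau>)"
proof -
  have "(invariant (\<lambda>\<tau>. \<tau>) (\<lambda>_. 1) (\<lambda>_. 0) n has_real_derivative (1 - \<tau> / 2) * ((u n \<tau>)\<^sup>2 / \<tau>)) (at \<tau>)"
    by (rule DERIV_cong[OF invariant_deriv[OF assms]])
       (use assms in \<open>auto intro!: derivative_eq_intros simp: field_simps eval_nat_numeral\<close>)
  moreover have "eventually (\<lambda>x. x > 0) (nhds \<tau>)"
    using assms by (rule order_tendstoD(1)[OF filterlim_ident])
  then have "eventually (\<lambda>x. invariant (\<lambda>\<tau>. \<tau>) (\<lambda>_. 1) (\<lambda>_. 0) n x = b n x) (nhds \<tau>)"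
    by eventually_elim (simp add: invariant_def b_eq)
  ultimately show ?thesis
    using DERIV_cong_ev[OF refl _ refl] by blast
qed

text \<open>On (0,\<delta>) the virial grows at least 1 - \<delta> / 2 times as fast as the mass,
  and both start at 0. At the end point only continuity is used, so the singularity of the equation
  at 0 is never met.\<close>

lemma mass_near_0:
  assumes "0 < \<delta>"
  shows "(1 - \<delta> / 2) * M n \<delta> \<le> b n \<delta>"
proof -
  have "b n 0 - (1 - \<delta> / 2) * M n 0 \<le> b n \<delta> - (1 - \<delta> / 2) * M n \<delta>"
  proof (rule DERIV_nonneg_imp_increasing_open[where f="\<lambda>x. b n x - (1 - \<delta> / 2) * M n x"])
    fix x assume x: "0 < x" "x < \<delta>"
    have "((\<lambda>x. b n x - (1 - \<delta> / 2) * M n x) has_real_derivative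
      (1 - x / 2) * ((u n x)\<^sup>2 / x) - (1 - \<delta> / 2) * ((u n x)\<^sup>2 / x)) (at x)"
      by (intro DERIV_diff DERIV_cmult b_deriv M_deriv x)
    moreover have "(1 - x / 2) * ((u n x)\<^sup>2 / x) - (1 - \<delta> / 2) * ((u n x)\<^sup>2 / x) = (\<delta> - x) / 2 * ((u n x)\<^sup>2 / x)"
      by (simp add: algebra_simps diff_divide_distrib)
    ultimately show "\<exists>y. ((\<lambda>x. b n x - (1 - \<delta> / 2) * M n x) has_real_derivative y) (at x) \<and> 0 \<le> y"
      using x by (intro exI conjI) auto
  qed (use assms in \<open>auto intro!: continuous_intros continuous_on_subset[OF M_cont] continuous_on_subset[OF b_cont]\<close>)
  then show ?thesis by (simp add: M_0 b_0)
qed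

text \<open>To the right of x the function b + (x / 2 - 1) M decreases, and its limit at infinity is
  x / 2 - 1. Nothing about the turning point enters.\<close>

lemma mass_near_4:
  assumes "0 < x"
  shows "(x / 2 - 1) * (1 - M n x) \<le> b n x"
proof -
  have "((\<lambda>y. b n y + (x / 2 - 1) * M n y) \<longlongrightarrow> 0 + (x / 2 - 1) * 1) at_top"
    by (intro tendsto_intros M_lim b_lim)
  moreover have "\<forall>\<^sub>F y in at_top. b n y + (x / 2 - 1) * M n y \<le> b n x + (x / 2 - 1) * M n x"
    using eventually_ge_at_top[of x]
  proof eventually_elim
    case (elim y)
    show ?case
    proof (rule DERIV_nonpos_imp_nonincreasing[OF elim])
      fix z assume z: "x \<le> z" "z \<le> y"
      have "((\<lambda>z. b n z + (x / 2 - 1) * M n z) has_real_derivative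
        (1 - z / 2) * ((u n z)\<^sup>2 / z) + (x / 2 - 1) * ((u n z)\<^sup>2 / z)) (at z)"
        using z assms by (intro DERIV_add DERIV_cmult b_deriv M_deriv) auto
      moreover have "(1 - z / 2) * ((u n z)\<^sup>2 / z) + (x / 2 - 1) * ((u n z)\<^sup>2 / z) = (x - z) / 2 * ((u n z)\<^sup>2 / z)"
        by (simp add: algebra_simps diff_divide_distrib)
      moreover have "(x - z) / 2 * ((u n z)\<^sup>2 / z) \<le> 0"
        using z assms by (intro mult_nonpos_nonneg) auto
      ultimately show "\<exists>w. ((\<lambda>z. b n z + (x / 2 - 1) * M n z) has_real_derivative w) (at z) \<and> w \<le> 0"
        by auto
    qed
  qed
  ultimately have "0 + (x / 2 - 1) * 1 \<le> b n x + (x / 2 - 1) * M n x"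
    by (rule tendsto_upperbound) simp
  then show ?thesis by (simp add: field_simps)
qed


lemma energy_bounds:
  assumes "0 < \<delta>" "\<delta> \<le> \<tau>" "\<tau> \<le> 4 - \<delta>"
  shows "0 \<le> energy n \<tau>" "(ud n \<tau>)\<^sup>2 \<le> energy n \<tau>" "(u n \<tau>)\<^sup>2 \<le> 16 / \<delta> * energy n \<tau>"
    "\<bar>u n \<tau> * ud n \<tau>\<bar> \<le> (16 / \<delta> + 1) * energy n \<tau>"
proof -
  \<comment> \<open>The left side bounds (4 - \<tau>) / (4 \<tau>), whose numerator is at least
    \<delta> and whose denominator is at most 16.\<close>
  have U: "\<delta> / 16 \<le> 1 / \<tau> - 1 / 4"
  proof -
    have "\<delta> * \<tau> \<le> \<delta> * 4" using assms by (intro mult_left_mono) auto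
    then have "\<delta> * \<tau> \<le> 16 - 4 * \<tau>" using assms by linarith
    then show ?thesis using assms by (simp add: field_simps)
  qed
  have "\<delta> / 16 * (u n \<tau>)\<^sup>2 \<le> (1 / \<tau> - 1 / 4) * (u n \<tau>)\<^sup>2"
    by (intro mult_right_mono U) simp
  moreover have "0 \<le> \<delta> / 16 * (u n \<tau>)\<^sup>2" using assms by simp
  ultimately have e: "\<delta> / 16 * (u n \<tau>)\<^sup>2 \<le> energy n \<tau>" "(ud n \<tau>)\<^sup>2 \<le> energy n \<tau>"
    unfolding energy_def using zero_le_power2[of "ud n \<tau>"] by linarith+
  show "(ud n \<tau>)\<^sup>2 \<le> energy n \<tau>" by (fact e)
  show u: "(u n \<tau>)\<^sup>2 \<le> 16 / \<delta> * energy n \<tau>" using e(1) assms by (simp add: field_simps)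
  show "0 \<le> energy n \<tau>" using e(2) zero_le_power2[of "ud n \<tau>"] by linarith
  have "2 * \<bar>u n \<tau> * ud n \<tau>\<bar> \<le> (u n \<tau>)\<^sup>2 + (ud n \<tau>)\<^sup>2"
    using sum_squares_bound[of "\<bar>u n \<tau>\<bar>" "\<bar>ud n \<tau>\<bar>"] by (simp add: abs_mult)
  then show "\<bar>u n \<tau> * ud n \<tau>\<bar> \<le> (16 / \<delta> + 1) * energy n \<tau>"
    using u e(2) abs_ge_zero[of "u n \<tau> * ud n \<tau>"] by (simp add: ring_distribs)
qed

lemma invariant_near_energy:
  assumes \<delta>: "0 < \<delta>" and h: "continuous_on {0<..<4} h" "continuous_on {0<..<4} h1" "continuous_on {0<..<4} h2"
  obtains C where "C \<ge> 0" "\<And>n \<tau>. \<delta> \<le> \<tau> \<Longrightarrow> \<tau> \<le> 4 - \<delta> \<Longrightarrow>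
    \<bar>invariant h h1 h2 n \<tau> - h \<tau> * energy n \<tau>\<bar> \<le> C / k n * energy n \<tau>"
proof -
  obtain a where a: "a \<ge> 0" "\<And>\<tau>. \<delta> \<le> \<tau> \<Longrightarrow> \<tau> \<le> 4 - \<delta> \<Longrightarrow> \<bar>h \<tau> * (c / \<tau>\<^sup>2) + h2 \<tau> / 2\<bar> \<le> a"
    by (rule bounded_on_inner_interval[OF _ \<delta>, of "\<lambda>\<tau>. h \<tau> * (c / \<tau>\<^sup>2) + h2 \<tau> / 2"])
       (auto intro!: continuous_intros h)
  obtain a1 where a1: "a1 \<ge> 0" "\<And>\<tau>. \<delta> \<le> \<tau> \<Longrightarrow> \<tau> \<le> 4 - \<delta> \<Longrightarrow> \<bar>h1 \<tau>\<bar> \<le> a1"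
    using bounded_on_inner_interval[OF h(2) \<delta>] by blast
  let ?C = "a * (16 / \<delta>) + a1 * (16 / \<delta> + 1)"
  show ?thesis
  proof (rule that[of ?C])
    show "?C \<ge> 0" using a a1 \<delta> by simp
    fix n \<tau> assume \<tau>: "\<delta> \<le> \<tau>" "\<tau> \<le> 4 - \<delta>"
    note e = energy_bounds[OF \<delta> \<tau>, of n] and k = k_ge_1[of n]
    have "invariant h h1 h2 n \<tau> - h \<tau> * energy n \<tau>
      = (h \<tau> * (c / \<tau>\<^sup>2) + h2 \<tau> / 2) * (u n \<tau>)\<^sup>2 / (k n)\<^sup>2 - h1 \<tau> * (u n \<tau> * ud n \<tau>) / k n"
      unfolding invariant_def energy_def by (simp add: algebra_simps add_divide_distrib)
    also have "\<bar>\<dots>\<bar> \<le> \<bar>h \<tau> * (c / \<tau>\<^sup>2) + h2 \<tau> / 2\<bar> * (u n \<tau>)\<^sup>2 / (k n)\<^sup>2 + \<bar>h1 \<tau>\<bar> * \<bar>u n \<tau> * ud n \<tau>\<bar> / k n"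
      using k by (intro order_trans[OF abs_triangle_ineq4]) (simp add: abs_mult)
    also have "\<dots> \<le> a * (16 / \<delta> * energy n \<tau>) / k n + a1 * ((16 / \<delta> + 1) * energy n \<tau>) / k n"
      using k a a1 e \<tau> \<delta> self_le_power[OF k, of 2]
      by (intro add_mono frac_le mult_mono) auto
    also have "\<dots> = ?C / k n * energy n \<tau>"
      by (simp add: algebra_simps add_divide_distrib)
    finally show "\<bar>invariant h h1 h2 n \<tau> - h \<tau> * energy n \<tau>\<bar> \<le> ?C / k n * energy n \<tau>" .
  qed
qed

text \<open>The error density is a bounded function times u^2 / (\<tau> k^2), that is, it is
  integrated against the mass, whose total is at most 1. Hence no a priori bound on the solution is
  needed. The factor \<tau> in \<open>?d\<close> comes from the density u^2 / \<tau> of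
  \<open>M\<close>.\<close>

lemma invariant_increment:
  assumes \<delta>: "0 < \<delta>"
    and h: "\<And>\<tau>. 0 < \<tau> \<Longrightarrow> \<tau> < 4 \<Longrightarrow> (h has_real_derivative h1 \<tau>) (at \<tau>)"
      "\<And>\<tau>. 0 < \<tau> \<Longrightarrow> \<tau> < 4 \<Longrightarrow> (h1 has_real_derivative h2 \<tau>) (at \<tau>)"
      "\<And>\<tau>. 0 < \<tau> \<Longrightarrow> \<tau> < 4 \<Longrightarrow> (h2 has_real_derivative h3 \<tau>) (at \<tau>)"
    and cont: "continuous_on {0<..<4} h" "continuous_on {0<..<4} h1" "continuous_on {0<..<4} h3"
    and r: "\<And>\<tau>. 0 < \<tau> \<Longrightarrow> \<tau> < 4 \<Longrightarrow> 2 * h1 \<tau> * (1 / \<tau> - 1 / 4) - h \<tau> / \<tau>\<^sup>2 = r / \<tau>"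
  obtains C where "C \<ge> 0" "\<And>n \<sigma> \<tau>. \<delta> \<le> \<sigma> \<Longrightarrow> \<sigma> \<le> 4 - \<delta> \<Longrightarrow> \<delta> \<le> \<tau> \<Longrightarrow> \<tau> \<le> 4 - \<delta> \<Longrightarrow>
    \<bar>invariant h h1 h2 n \<tau> - invariant h h1 h2 n \<sigma> - r * (M n \<tau> - M n \<sigma>)\<bar> \<le> C / k n"
proof -
  let ?d = "\<lambda>\<tau>. \<tau> * (c * (2 * h1 \<tau> / \<tau>\<^sup>2 - 2 * h \<tau> / \<tau> ^ 3) + h3 \<tau> / 2)"
  obtain C where C: "C \<ge> 0" "\<And>\<tau>. \<delta> \<le> \<tau> \<Longrightarrow> \<tau> \<le> 4 - \<delta> \<Longrightarrow> \<bar>?d \<tau>\<bar> \<le> C"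
    by (rule bounded_on_inner_interval[OF _ \<delta>, of ?d]) (auto intro!: continuous_intros cont)
  have main: "\<bar>invariant h h1 h2 n \<tau> - invariant h h1 h2 n \<sigma> - r * (M n \<tau> - M n \<sigma>)\<bar> \<le> C / k n"
    if "\<sigma> \<le> \<tau>" "\<delta> \<le> \<sigma>" "\<tau> \<le> 4 - \<delta>" for n \<sigma> \<tau>
  proof -
    let ?F = "\<lambda>\<tau>. invariant h h1 h2 n \<tau> - r * M n \<tau>"
    have "\<bar>?F \<tau> - ?F \<sigma>\<bar> \<le> C / k n * M n \<tau> - C / k n * M n \<sigma>"
    proof (rule DERIV_abs_le_imp_diff_le[OF that(1)])
      fix x assume "\<sigma> \<le> x" "x \<le> \<tau>"
      then have x: "\<delta> \<le> x" "x \<le> 4 - \<delta>" and x': "0 < x" "x < 4" using that \<delta> by auto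
      show "((\<lambda>x. C / k n * M n x) has_real_derivative C / k n * ((u n x)\<^sup>2 / x)) (at x)"
        by (intro DERIV_cmult M_deriv x')
      show "(?F has_real_derivative ?d x / (k n)\<^sup>2 * ((u n x)\<^sup>2 / x)) (at x)"
        by (rule DERIV_cong[OF DERIV_diff[OF invariant_deriv[OF x'(1) h[OF x']] DERIV_cmult[OF M_deriv[OF x'(1)]]]])
           (unfold r[OF x'], use x'(1) in simp)
      have "\<bar>?d x\<bar> / (k n)\<^sup>2 \<le> C / k n"
        using C(2)[OF x] C(1) k_ge_1[of n] self_le_power[OF k_ge_1[of n], of 2] by (intro frac_le) auto
      then show "\<bar>?d x / (k n)\<^sup>2 * ((u n x)\<^sup>2 / x)\<bar> \<le> C / k n * ((u n x)\<^sup>2 / x)"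
        using mult_right_mono[of "\<bar>?d x\<bar> / (k n)\<^sup>2" "C / k n" "(u n x)\<^sup>2 / x"] x'
        by (simp add: abs_mult)
    qed
    also have "\<dots> = C / k n * (M n \<tau> - M n \<sigma>)" by (simp add: algebra_simps)
    also have "\<dots> \<le> C / k n * 1"
      using that \<delta> M_le_1[of \<tau> n] M_nonneg[of \<sigma> n] C(1) k_pos[of n] by (intro mult_left_mono) auto
    finally show ?thesis by (simp add: algebra_simps)
  qed
  show ?thesis
  proof (rule that[OF C(1)])
    fix n \<sigma> \<tau> assume "\<delta> \<le> \<sigma>" "\<sigma> \<le> 4 - \<delta>" "\<delta> \<le> \<tau>" "\<tau> \<le> 4 - \<delta>"
    then show "\<bar>invariant h h1 h2 n \<tau> - invariant h h1 h2 n \<sigma> - r * (M n \<tau> - M n \<sigma>)\<bar> \<le> C / k n"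
      using main[of \<sigma> \<tau> n] main[of \<tau> \<sigma> n] by (cases "\<sigma> \<le> \<tau>") (auto simp: abs_minus_commute algebra_simps)
  qed
qed

text \<open>The base point 2 lies in every interval [\<delta>, 4 - \<delta>] with \<delta> \<le> 1;
  another interior point would change the value by O(1/k) only.\<close>

definition amplitude :: "nat \<Rightarrow> real" where
  "amplitude n = invariant wkb_g wkb_h1 wkb_h2 n 2"

definition wkb_estimate :: "real \<Rightarrow> nat \<Rightarrow> real \<Rightarrow> bool" where
  "wkb_estimate C n \<tau> \<longleftrightarrow> energy n \<tau> \<le> C \<and> \<bar>wkb_g \<tau> * energy n \<tau> - amplitude n\<bar> \<le> C / k n \<and>
     \<bar>M n \<tau> - M n 2 - (wkb_\<theta> \<tau> - wkb_\<theta> 2) * amplitude n\<bar> \<le> C / k n \<and>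
     \<bar>b n \<tau> - \<tau> * energy n \<tau>\<bar> \<le> C / k n"

text \<open>At this stage the amplitude is not known to be bounded, so all errors are measured
  relative to its modulus plus 1.\<close>

lemma wkb_uniform:
  assumes \<delta>: "0 < \<delta>" "\<delta> \<le> 1"
  obtains C where "C \<ge> 0" "\<forall>\<^sub>F n in sequentially. \<forall>\<tau>\<in>{\<delta>..4 - \<delta>}.
    wkb_estimate (C * (\<bar>amplitude n\<bar> + 1)) n \<tau>"
proof -
  have cg: "continuous_on {0<..<4} wkb_h1" "continuous_on {0<..<4} wkb_h2"
     "continuous_on {0<..<4} wkb_H" "continuous_on {0<..<4} wkb_H1" "continuous_on {0<..<4} wkb_H2"
    by (intro continuous_at_imp_continuous_on;
        auto intro!: DERIV_isCont[OF wkb_h1_deriv] DERIV_isCont[OF wkb_h2_deriv]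
          DERIV_isCont[OF wkb_H_deriv] DERIV_isCont[OF wkb_H1_deriv] DERIV_isCont[OF wkb_H2_deriv])+
  obtain C1 where C1: "C1 \<ge> 0" "\<And>n \<tau>. \<delta> \<le> \<tau> \<Longrightarrow> \<tau> \<le> 4 - \<delta> \<Longrightarrow>
    \<bar>invariant wkb_g wkb_h1 wkb_h2 n \<tau> - wkb_g \<tau> * energy n \<tau>\<bar> \<le> C1 / k n * energy n \<tau>"
    using invariant_near_energy[OF \<delta>(1) continuous_on_wkb_g cg(1,2)] by blast
  obtain C2 where C2: "C2 \<ge> 0" "\<And>n \<tau>. \<delta> \<le> \<tau> \<Longrightarrow> \<tau> \<le> 4 - \<delta> \<Longrightarrow>
    \<bar>invariant wkb_H wkb_H1 wkb_H2 n \<tau> - wkb_H \<tau> * energy n \<tau>\<bar> \<le> C2 / k n * energy n \<tau>"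
    using invariant_near_energy[OF \<delta>(1) cg(3-5)] by blast
  obtain C5 where C5: "C5 \<ge> 0" "\<And>n \<tau>. \<delta> \<le> \<tau> \<Longrightarrow> \<tau> \<le> 4 - \<delta> \<Longrightarrow>
    \<bar>invariant (\<lambda>\<tau>. \<tau>) (\<lambda>_. 1) (\<lambda>_. 0) n \<tau> - \<tau> * energy n \<tau>\<bar> \<le> C5 / k n * energy n \<tau>"
    using invariant_near_energy[OF \<delta>(1), of "\<lambda>\<tau>. \<tau>" "\<lambda>_. 1" "\<lambda>_. 0"] by (auto intro!: continuous_intros)
  have r0: "2 * wkb_h1 \<tau> * (1 / \<tau> - 1 / 4) - wkb_g \<tau> / \<tau>\<^sup>2 = 0 / \<tau>" if "0 < \<tau>" "\<tau> < 4" for \<tau>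
  proof -
    have "2 * wkb_h1 \<tau> * (1 / \<tau> - 1 / 4) = (1 / \<tau> - 1 / 4) * (wkb_g \<tau>)\<^sup>2 * wkb_g \<tau> / \<tau>\<^sup>2"
      by (simp add: wkb_h1_def wkb_mono_def eval_nat_numeral)
    then show ?thesis using wkb_g_square[OF that] by simp
  qed
  \<comment> \<open>By the product rule the derivative of \<open>wkb_\<theta>\<close> contributes U
    g^2 / \<tau> = 1 / \<tau>, where U = 1 / \<tau> - 1 / 4; the remainder is
    \<open>wkb_\<theta>\<close> times the expression that vanishes by \<open>r0\<close>.\<close>
  have r1: "2 * wkb_H1 \<tau> * (1 / \<tau> - 1 / 4) - wkb_H \<tau> / \<tau>\<^sup>2 = 1 / \<tau>" if "0 < \<tau>" "\<tau> < 4" for \<tau>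
  proof -
    have "2 * wkb_H1 \<tau> * U - wkb_H \<tau> / \<tau>\<^sup>2
      = U * (wkb_g \<tau>)\<^sup>2 / \<tau> + wkb_\<theta> \<tau> * (2 * wkb_h1 \<tau> * U - wkb_g \<tau> / \<tau>\<^sup>2)" for U
      by (simp add: wkb_H1_def wkb_H_def wkb_mono_def algebra_simps)
    then show ?thesis using wkb_g_square[OF that] r0[OF that] by simp
  qed
  obtain C3 where C3: "C3 \<ge> 0" "\<And>n \<sigma> \<tau>. \<delta> \<le> \<sigma> \<Longrightarrow> \<sigma> \<le> 4 - \<delta> \<Longrightarrow> \<delta> \<le> \<tau> \<Longrightarrow> \<tau> \<le> 4 - \<delta> \<Longrightarrow>
    \<bar>invariant wkb_g wkb_h1 wkb_h2 n \<tau> - invariant wkb_g wkb_h1 wkb_h2 n \<sigma> - 0 * (M n \<tau> - M n \<sigma>)\<bar> \<le> C3 / k n"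
    using invariant_increment[OF \<delta>(1) wkb_h_deriv wkb_h1_deriv wkb_h2_deriv continuous_on_wkb_g cg(1)
      continuous_on_wkb_h3 r0] by blast
  obtain C4 where C4: "C4 \<ge> 0" "\<And>n \<sigma> \<tau>. \<delta> \<le> \<sigma> \<Longrightarrow> \<sigma> \<le> 4 - \<delta> \<Longrightarrow> \<delta> \<le> \<tau> \<Longrightarrow> \<tau> \<le> 4 - \<delta> \<Longrightarrow>
    \<bar>invariant wkb_H wkb_H1 wkb_H2 n \<tau> - invariant wkb_H wkb_H1 wkb_H2 n \<sigma> - 1 * (M n \<tau> - M n \<sigma>)\<bar> \<le> C4 / k n"
    using invariant_increment[OF \<delta>(1) wkb_H_deriv wkb_H1_deriv wkb_H2_deriv cg(3,4)
      continuous_on_wkb_H3 r1] by blast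
  obtain G where G: "G \<ge> 0" "\<And>\<tau>. \<delta> \<le> \<tau> \<Longrightarrow> \<tau> \<le> 4 - \<delta> \<Longrightarrow> \<bar>1 / wkb_g \<tau>\<bar> \<le> G"
    by (rule bounded_on_inner_interval[OF _ \<delta>(1), of "\<lambda>\<tau>. 1 / wkb_g \<tau>"])
       (auto intro!: continuous_intros continuous_on_wkb_g simp: less_imp_neq[OF wkb_g_pos, symmetric])
  obtain T where T: "T \<ge> 0" "\<And>\<tau>. \<delta> \<le> \<tau> \<Longrightarrow> \<tau> \<le> 4 - \<delta> \<Longrightarrow> \<bar>wkb_\<theta> \<tau>\<bar> \<le> T"
    using bounded_on_inner_interval[OF continuous_on_wkb_\<theta> \<delta>(1)] by blast
  define E where "E = 2 * G * (1 + C3)"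
  define D where "D = C1 * E + C3"
  define D' where "D' = C2 * E + T * D"
  define C where "C = E + D + (C4 + 2 * D') + C5 * E"
  have nn: "E \<ge> 0" "D \<ge> 0" "D' \<ge> 0" "C \<ge> 0" "C5 * E \<ge> 0"
    using C1(1) C2(1) C3(1) C4(1) C5(1) G(1) T(1) by (auto simp: E_def D_def D'_def C_def)
  have le: "E \<le> C" "D \<le> C" "C4 + 2 * D' \<le> C" "C5 * E \<le> C"
    using nn C4(1) unfolding C_def by linarith+
  show ?thesis
  proof (rule that[OF nn(4)])
    show "\<forall>\<^sub>F n in sequentially. \<forall>\<tau>\<in>{\<delta>..4 - \<delta>}.
      wkb_estimate (C * (\<bar>amplitude n\<bar> + 1)) n \<tau>"
      using eventually_le_k[of "2 * G * C1"]
    proof eventually_elim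
      case (elim n)
      define A where "A = \<bar>amplitude n\<bar> + 1"
      have A: "A \<ge> 1" by (simp add: A_def)
      have k: "k n > 0" by (rule k_pos)
      have energy: "energy n \<tau> \<le> E * A" if \<tau>: "\<delta> \<le> \<tau>" "\<tau> \<le> 4 - \<delta>" for \<tau>
      proof -
        have e0: "0 \<le> energy n \<tau>" by (rule energy_bounds[OF \<delta>(1) \<tau>])
        have g: "wkb_g \<tau> > 0" using \<delta> \<tau> by (intro wkb_g_pos) auto
        have C3k: "C3 / k n \<le> C3" using k_ge_1[of n] C3(1) by (simp add: field_simps mult_le_cancel_left1)
        have "\<bar>invariant wkb_g wkb_h1 wkb_h2 n \<tau> - amplitude n\<bar> \<le> C3 / k n"
          using C3(2)[of 2 \<tau> n] \<tau> \<delta> by (simp add: amplitude_def)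
        then have "wkb_g \<tau> * energy n \<tau> \<le> \<bar>amplitude n\<bar> + C3 + C1 / k n * energy n \<tau>"
          using C1(2)[OF \<tau>, of n] C3k by linarith
        then have "1 / wkb_g \<tau> * (wkb_g \<tau> * energy n \<tau>) \<le> 1 / wkb_g \<tau> * (\<bar>amplitude n\<bar> + C3 + C1 / k n * energy n \<tau>)"
          using g by (intro mult_left_mono) auto
        also have "1 / wkb_g \<tau> \<le> G"
          using G(2)[OF \<tau>] by linarith
        then have "1 / wkb_g \<tau> * (\<bar>amplitude n\<bar> + C3 + C1 / k n * energy n \<tau>)
            \<le> G * (\<bar>amplitude n\<bar> + C3 + C1 / k n * energy n \<tau>)"
          using e0 C3(1) C1(1) k by (intro mult_right_mono) auto
        also have "\<dots> = G * (\<bar>amplitude n\<bar> + C3) + G * C1 / k n * energy n \<tau>"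
          by (simp add: algebra_simps)
        \<comment> \<open>Since k n \<ge> 2 * G * C1, the error proportional to the energy is
          absorbed by half of the left-hand side.\<close>
        also have "\<dots> \<le> G * (\<bar>amplitude n\<bar> + C3) + 1 / 2 * energy n \<tau>"
          using elim k e0 by (intro add_left_mono mult_right_mono) (simp_all add: field_simps)
        finally have "energy n \<tau> \<le> 2 * G * (\<bar>amplitude n\<bar> + C3)" using g by simp
        also have "\<dots> \<le> 2 * G * ((1 + C3) * A)"
        proof (intro mult_left_mono)
          have "0 \<le> C3 * \<bar>amplitude n\<bar>" using C3(1) by simp
          then show "\<bar>amplitude n\<bar> + C3 \<le> (1 + C3) * A" unfolding A_def by (simp add: algebra_simps)
        qed (use G(1) in auto)
        finally show ?thesis by (simp add: E_def)
      qed
      have ge: "\<bar>wkb_g \<tau> * energy n \<tau> - amplitude n\<bar> \<le> D * A / k n" if \<tau>: "\<delta> \<le> \<tau>" "\<tau> \<le> 4 - \<delta>" for \<tau>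
      proof -
        have "\<bar>invariant wkb_g wkb_h1 wkb_h2 n \<tau> - amplitude n\<bar> \<le> C3 / k n"
          using C3(2)[of 2 \<tau> n] \<tau> \<delta> by (simp add: amplitude_def)
        also have "\<dots> \<le> C3 * A / k n" using A C3(1) k by (simp add: divide_right_mono mult_le_cancel_left1)
        finally have 1: "\<bar>invariant wkb_g wkb_h1 wkb_h2 n \<tau> - amplitude n\<bar> \<le> C3 * A / k n" .
        have "C1 / k n * energy n \<tau> \<le> C1 / k n * (E * A)"
          using C1(1) k energy[OF \<tau>] by (intro mult_left_mono) auto
        then show ?thesis
          using 1 C1(2)[OF \<tau>, of n] by (simp add: D_def algebra_simps add_divide_distrib)
      qed
      have He: "\<bar>invariant wkb_H wkb_H1 wkb_H2 n \<tau> - wkb_\<theta> \<tau> * amplitude n\<bar> \<le> D' * A / k n"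
        if \<tau>: "\<delta> \<le> \<tau>" "\<tau> \<le> 4 - \<delta>" for \<tau>
      proof -
        have "C2 / k n * energy n \<tau> \<le> C2 / k n * (E * A)"
          using C2(1) k energy[OF \<tau>] by (intro mult_left_mono) auto
        then have "\<bar>invariant wkb_H wkb_H1 wkb_H2 n \<tau> - wkb_\<theta> \<tau> * (wkb_g \<tau> * energy n \<tau>)\<bar> \<le> C2 * E * A / k n"
          using C2(2)[OF \<tau>, of n] by (simp add: wkb_H_def mult.assoc)
        moreover have "\<bar>wkb_\<theta> \<tau> * (wkb_g \<tau> * energy n \<tau>) - wkb_\<theta> \<tau> * amplitude n\<bar> \<le> T * (D * A / k n)"
          unfolding right_diff_distrib[symmetric] abs_mult
          using T(2)[OF \<tau>] T(1) ge[OF \<tau>] by (intro mult_mono) auto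
        ultimately show ?thesis
          by (simp add: D'_def algebra_simps add_divide_distrib)
      qed
      have combine: "\<bar>m - (t1 - t2)\<bar> \<le> z + x + x"
        if "\<bar>i1 - t1\<bar> \<le> x" "\<bar>i2 - t2\<bar> \<le> x" "\<bar>i1 - i2 - 1 * m\<bar> \<le> y" "y \<le> z"
        for m t1 t2 x y z i1 i2 :: real
        using that by linarith
      have mono: "x * A / k n \<le> C * A / k n" if "x \<le> C" for x
        using that A k by (intro divide_right_mono mult_right_mono) auto
      show ?case
        unfolding A_def[symmetric] wkb_estimate_def
      proof (intro ballI conjI)
        fix \<tau> assume "\<tau> \<in> {\<delta>..4 - \<delta>}"
        then have \<tau>: "\<delta> \<le> \<tau>" "\<tau> \<le> 4 - \<delta>" by auto
        have 2: "\<delta> \<le> 2" "2 \<le> 4 - \<delta>" using \<delta> by auto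
        show "energy n \<tau> \<le> C * A"
          using energy[OF \<tau>] mult_right_mono[OF le(1), of A] A by linarith
        show "\<bar>wkb_g \<tau> * energy n \<tau> - amplitude n\<bar> \<le> C * A / k n"
          using ge[OF \<tau>] mono[OF le(2)] by linarith
        have "C4 / k n \<le> C4 * A / k n" using A C4(1) k by (simp add: divide_right_mono mult_le_cancel_left1)
        then have "\<bar>M n \<tau> - M n 2 - (wkb_\<theta> \<tau> - wkb_\<theta> 2) * amplitude n\<bar> \<le> C4 * A / k n + D' * A / k n + D' * A / k n"
          using combine[OF He[OF \<tau>] He[OF 2] C4(2)[OF 2 \<tau>, of n]] unfolding left_diff_distrib by blast
        also have "\<dots> = (C4 + 2 * D') * A / k n" by (simp add: algebra_simps add_divide_distrib)
        finally show "\<bar>M n \<tau> - M n 2 - (wkb_\<theta> \<tau> - wkb_\<theta> 2) * amplitude n\<bar> \<le> C * A / k n"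
          using mono[OF le(3)] by linarith
        have "b n \<tau> = invariant (\<lambda>\<tau>. \<tau>) (\<lambda>_. 1) (\<lambda>_. 0) n \<tau>"
          using \<delta> \<tau> by (simp add: b_eq invariant_def)
        moreover have "C5 / k n * energy n \<tau> \<le> C5 / k n * (E * A)"
          using C5(1) k energy[OF \<tau>] by (intro mult_left_mono) auto
        ultimately show "\<bar>b n \<tau> - \<tau> * energy n \<tau>\<bar> \<le> C * A / k n"
          using C5(2)[OF \<tau>, of n] mono[OF le(4)] by (simp add: mult.assoc)
      qed
    qed
  qed
qed


section \<open>Boundedness and limit of the amplitude\<close>

lemma wkb_\<theta>_2_less_3: "wkb_\<theta> 2 < wkb_\<theta> 3"
  unfolding wkb_\<theta>_def by (rule arccos_less_arccos) auto

text \<open>The mass between 2 and 3 is at most 1, yet it is the amplitude times the positive number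
  \<open>d\<close> up to a small relative error. Once k \<ge> 2 C / d, the error costs at most half
  of the coefficient \<open>d\<close>.\<close>

lemma amplitude_bounded:
  obtains K where "K \<ge> 0" "\<forall>\<^sub>F n in sequentially. \<bar>amplitude n\<bar> \<le> K"
proof -
  obtain C where C: "C \<ge> 0" "\<forall>\<^sub>F n in sequentially. \<forall>\<tau>\<in>{1..4 - 1}.
    wkb_estimate (C * (\<bar>amplitude n\<bar> + 1)) n \<tau>"
    using wkb_uniform[of 1] by auto
  define d where "d = wkb_\<theta> 3 - wkb_\<theta> 2"
  have d: "d > 0" using wkb_\<theta>_2_less_3 by (simp add: d_def)
  have "\<forall>\<^sub>F n in sequentially. \<bar>amplitude n\<bar> \<le> 2 / d + 1"
    using C(2) eventually_le_k[of "2 * C / d"]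
  proof eventually_elim
    case (elim n)
    have "\<bar>M n 3 - M n 2 - d * amplitude n\<bar> \<le> C * (\<bar>amplitude n\<bar> + 1) / k n"
      using elim(1) by (auto simp: d_def wkb_estimate_def dest: bspec[of _ _ 3])
    moreover have "M n 3 - M n 2 \<le> 1" "M n 3 - M n 2 \<ge> 0"
      using M_le_1[of 3 n] M_nonneg[of 2 n] M_mono[of 2 3 n] by auto
    moreover have "C * (\<bar>amplitude n\<bar> + 1) / k n \<le> d / 2 * (\<bar>amplitude n\<bar> + 1)"
    proof -
      have "C / k n \<le> d / 2" using elim(2) d k_pos[of n] by (simp add: field_simps)
      then show ?thesis using mult_right_mono[of "C / k n" "d / 2" "\<bar>amplitude n\<bar> + 1"] by simp
    qed
    ultimately have "\<bar>d * amplitude n\<bar> \<le> 1 + d / 2 * (\<bar>amplitude n\<bar> + 1)"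
      by linarith
    then have "d * \<bar>amplitude n\<bar> \<le> 2 + d"
      using d by (simp add: abs_mult field_simps)
    then show ?case using d by (simp add: field_simps)
  qed
  then show ?thesis using d by (intro that[of "2 / d + 1"]) auto
qed

lemma wkb_uniform_bounded:
  assumes \<delta>: "0 < \<delta>" "\<delta> \<le> 1"
  obtains C where "C \<ge> 0" "\<forall>\<^sub>F n in sequentially. \<forall>\<tau>\<in>{\<delta>..4 - \<delta>}. wkb_estimate C n \<tau>"
proof -
  obtain K where K: "K \<ge> 0" "\<forall>\<^sub>F n in sequentially. \<bar>amplitude n\<bar> \<le> K"
    by (rule amplitude_bounded)
  obtain C where C: "C \<ge> 0" "\<forall>\<^sub>F n in sequentially. \<forall>\<tau>\<in>{\<delta>..4 - \<delta>}.
    wkb_estimate (C * (\<bar>amplitude n\<bar> + 1)) n \<tau>"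
    by (rule wkb_uniform[OF \<delta>])
  show ?thesis
  proof (rule that[of "C * (K + 1)"])
    show "\<forall>\<^sub>F n in sequentially. \<forall>\<tau>\<in>{\<delta>..4 - \<delta>}. wkb_estimate (C * (K + 1)) n \<tau>"
      using C(2) K(2)
    proof eventually_elim
      case (elim n)
      have 1: "C * (\<bar>amplitude n\<bar> + 1) \<le> C * (K + 1)"
        using elim(2) C(1) by (intro mult_left_mono) auto
      moreover from 1 have "C * (\<bar>amplitude n\<bar> + 1) / k n \<le> C * (K + 1) / k n"
        using k_pos[of n] by (intro divide_right_mono) auto
      ultimately show ?case using elim(1) unfolding wkb_estimate_def by (meson order_trans)
    qed
  qed (use C(1) K(1) in auto)
qed

text \<open>One minus the mass in [\<delta>, 4 - \<delta>] is the mass of the two tails, which the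
  virial at \<delta> and 4 - \<delta> bounds. There it is nearly \<tau> times the energy, that is
  \<tau> / g times the amplitude, and \<tau> / g is at most sqrt \<delta>.\<close>

lemma amplitude_error:
  assumes \<delta>: "0 < \<delta>" "\<delta> \<le> 1" and K: "\<forall>\<^sub>F n in sequentially. \<bar>amplitude n\<bar> \<le> K" and e: "e > 0"
  shows "\<forall>\<^sub>F n in sequentially. \<bar>1 - pi * amplitude n\<bar>
    \<le> \<bar>pi - (wkb_\<theta> (4 - \<delta>) - wkb_\<theta> \<delta>)\<bar> * K + 4 * (sqrt \<delta> * K) + e"
proof -
  obtain C where C: "C \<ge> 0" "\<forall>\<^sub>F n in sequentially. \<forall>\<tau>\<in>{\<delta>..4 - \<delta>}. wkb_estimate C n \<tau>"
    by (rule wkb_uniform_bounded[OF \<delta>])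
  \<comment> \<open>Ten units of size C / k n are spent below: four in each tail and two in the
    middle.\<close>
  have "\<forall>\<^sub>F n in sequentially. C / k n < e / 10"
    by (rule order_tendstoD(2)[OF inverse_k_lim]) (use e in simp)
  then show ?thesis
    using C(2) K
  proof eventually_elim
    case (elim n)
    define r where "r = C / k n"
    have "10 * r \<le> e" using elim(1) unfolding r_def by linarith
    moreover have "0 \<le> r" using C(1) k_pos[of n] by (simp add: r_def)
    ultimately have r: "0 \<le> r" "10 * r \<le> e" by auto
    have in_range: "\<delta> \<in> {\<delta>..4 - \<delta>}" "4 - \<delta> \<in> {\<delta>..4 - \<delta>}" using \<delta> by auto
    have b_le: "b n \<tau> \<le> sqrt \<delta> * K + 2 * r" if "\<tau> = \<delta> \<or> \<tau> = 4 - \<delta>" for \<tau>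
    proof -
      have \<tau>: "\<tau> \<in> {\<delta>..4 - \<delta>}" "0 < \<tau>" "\<tau> < 4" using that \<delta> by auto
      have "\<tau> / wkb_g \<tau> = sqrt (\<tau>\<^sup>2 * (1 / \<tau> - 1 / 4))"
        using \<tau> by (simp add: wkb_g_def real_sqrt_mult)
      also have "\<tau>\<^sup>2 * (1 / \<tau> - 1 / 4) = \<tau> * (1 - \<tau> / 4)"
        using \<tau> by (simp add: power2_eq_square field_simps)
      \<comment> \<open>The expression \<tau> (1 - \<tau> / 4) is symmetric under \<tau> to 4 -
        \<tau>, so both ends give the same bound.\<close>
      also have "\<dots> = \<delta> * (1 - \<delta> / 4)"
        using that by (elim disjE; hypsubst; simp add: field_simps)
      also have "sqrt (\<delta> * (1 - \<delta> / 4)) \<le> sqrt \<delta>"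
        using \<delta> by (intro real_sqrt_le_mono) (simp add: mult_le_cancel_left1)
      finally have le: "\<tau> / wkb_g \<tau> \<le> sqrt \<delta>" .
      have nn: "0 \<le> \<tau> / wkb_g \<tau>" using \<tau> wkb_g_pos[of \<tau>] by simp
      have "\<tau> * energy n \<tau> = \<tau> / wkb_g \<tau> * (wkb_g \<tau> * energy n \<tau>)"
        using \<tau> wkb_g_pos[of \<tau>] by simp
      also have "\<dots> \<le> \<tau> / wkb_g \<tau> * (K + r)"
      proof (intro mult_left_mono nn)
        have "\<bar>wkb_g \<tau> * energy n \<tau> - amplitude n\<bar> \<le> r"
          using elim(2) \<tau>(1) by (auto simp: r_def wkb_estimate_def)
        then show "wkb_g \<tau> * energy n \<tau> \<le> K + r" using elim(3) by linarith
      qed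
      also have "\<dots> \<le> sqrt \<delta> * (K + r)"
        using le r elim(3) by (intro mult_right_mono) auto
      also have "\<dots> \<le> sqrt \<delta> * K + r"
        using \<delta> r mult_right_mono[of "sqrt \<delta>" 1 r] by (simp add: ring_distribs)
      finally have "\<tau> * energy n \<tau> \<le> sqrt \<delta> * K + r" .
      moreover have "\<bar>b n \<tau> - \<tau> * energy n \<tau>\<bar> \<le> r"
        using elim(2) \<tau>(1) by (auto simp: r_def wkb_estimate_def)
      ultimately show ?thesis by linarith
    qed
    have low: "M n \<delta> \<le> 2 * (sqrt \<delta> * K) + 4 * r"
    proof -
      have "1 / 2 * M n \<delta> \<le> (1 - \<delta> / 2) * M n \<delta>"
        using \<delta> M_nonneg[of \<delta> n] by (intro mult_right_mono) auto
      then show ?thesis using mass_near_0[OF \<delta>(1), of n] b_le[of \<delta>] by simp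
    qed
    have high: "1 - M n (4 - \<delta>) \<le> 2 * (sqrt \<delta> * K) + 4 * r"
    proof -
      have "1 / 2 * (1 - M n (4 - \<delta>)) \<le> ((4 - \<delta>) / 2 - 1) * (1 - M n (4 - \<delta>))"
        using \<delta> M_le_1[of "4 - \<delta>" n] by (intro mult_right_mono) auto
      then show ?thesis using mass_near_4[of "4 - \<delta>" n] b_le[of "4 - \<delta>"] \<delta> by simp
    qed
    have ends: "0 \<le> M n \<delta>" "M n (4 - \<delta>) \<le> 1" using \<delta> by (auto intro: M_nonneg M_le_1)
    have "\<bar>M n \<tau> - M n 2 - (wkb_\<theta> \<tau> - wkb_\<theta> 2) * amplitude n\<bar> \<le> r" if "\<tau> \<in> {\<delta>..4 - \<delta>}" for \<tau>
      using elim(2) that by (auto simp: r_def wkb_estimate_def)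
    from this[OF in_range(1)] this[OF in_range(2)]
    have mid: "\<bar>(M n (4 - \<delta>) - M n \<delta>) - (wkb_\<theta> (4 - \<delta>) - wkb_\<theta> \<delta>) * amplitude n\<bar> \<le> 2 * r"
      by (simp add: algebra_simps abs_le_iff)
    define P where "P = (pi - (wkb_\<theta> (4 - \<delta>) - wkb_\<theta> \<delta>)) * amplitude n"
    define Q where "Q = (M n (4 - \<delta>) - M n \<delta>) - (wkb_\<theta> (4 - \<delta>) - wkb_\<theta> \<delta>) * amplitude n"
    have "\<bar>P\<bar> \<le> \<bar>pi - (wkb_\<theta> (4 - \<delta>) - wkb_\<theta> \<delta>)\<bar> * K"
      unfolding P_def abs_mult using elim(3) by (intro mult_left_mono) auto
    moreover have "1 - pi * amplitude n = M n \<delta> + (1 - M n (4 - \<delta>)) + Q - P"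
      by (simp add: P_def Q_def algebra_simps)
    moreover have "\<bar>Q\<bar> \<le> 2 * r" using mid by (simp add: Q_def)
    moreover have "\<bar>1 - x\<bar> \<le> PK + 4 * S + e"
      if "\<bar>P\<bar> \<le> PK" "1 - x = m1 + (1 - m2) + Q - P" "\<bar>Q\<bar> \<le> 2 * r" "m1 \<le> 2 * S + 4 * r"
        "1 - m2 \<le> 2 * S + 4 * r" "0 \<le> m1" "m2 \<le> 1" for P PK x m1 m2 Q S :: real
      using that(2,4-7) r abs_le_D1[OF that(1)] abs_le_D2[OF that(1)] abs_le_D1[OF that(3)] abs_le_D2[OF that(3)]
      by (intro abs_leI) linarith+
    ultimately show ?case using low high ends by blast
  qed
qed

text \<open>First k tends to infinity for fixed \<delta>, then \<delta> tends to 0. The error bound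
  vanishes at \<delta> = 0 because \<open>wkb_\<theta>\<close> is 0 at 0 and pi at 4.\<close>

lemma amplitude_lim: "amplitude \<longlonglongrightarrow> 1 / pi"
proof -
  obtain K where K: "K \<ge> 0" "\<forall>\<^sub>F n in sequentially. \<bar>amplitude n\<bar> \<le> K"
    by (rule amplitude_bounded)
  let ?\<eta> = "\<lambda>\<delta>. \<bar>pi - (wkb_\<theta> (4 - \<delta>) - wkb_\<theta> \<delta>)\<bar> * K + 4 * (sqrt \<delta> * K)"
  have "continuous_on {0..1} ?\<eta>"
    unfolding wkb_\<theta>_def by (auto intro!: continuous_intros)
  then have "(?\<eta> \<longlongrightarrow> ?\<eta> 0) (at 0 within {0..1})"
    unfolding continuous_on_def by (rule bspec) simp
  then have lim: "(?\<eta> \<longlongrightarrow> 0) (at_right 0)"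
    by (simp add: wkb_\<theta>_def at_within_Icc_at_right)
  have "(\<lambda>n. 1 - pi * amplitude n) \<longlonglongrightarrow> 0"
  proof (rule tendstoI)
    fix e :: real assume e: "e > 0"
    have "\<forall>\<^sub>F \<delta> in at_right 0. ?\<eta> \<delta> < e / 2 \<and> \<delta> \<in> {0<..<1}"
      using order_tendstoD(2)[OF lim, of "e / 2"] e
      by (intro eventually_conj eventually_at_right_real) auto
    then obtain \<delta> where \<delta>: "?\<eta> \<delta> < e / 2" "0 < \<delta>" "\<delta> < 1"
      using eventually_happens'[of "at_right (0::real)"] by fastforce
    have "\<forall>\<^sub>F n in sequentially. \<bar>1 - pi * amplitude n\<bar> \<le> ?\<eta> \<delta> + e / 2"
      using amplitude_error[OF \<delta>(2) less_imp_le[OF \<delta>(3)] K(2), of "e / 2"] e by simp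
    then show "\<forall>\<^sub>F n in sequentially. dist (1 - pi * amplitude n) 0 < e"
      by eventually_elim (use \<delta>(1) in simp)
  qed
  then have "(\<lambda>n. (1 - (1 - pi * amplitude n)) / pi) \<longlonglongrightarrow> (1 - 0) / pi"
    by (intro tendsto_intros) auto
  then show ?thesis by simp
qed

lemma energy_lim:
  assumes \<xi>: "0 < \<xi>" "\<xi> < 4" and \<tau>: "\<tau> \<longlonglongrightarrow> \<xi>"
  shows "(\<lambda>n. energy n (\<tau> n)) \<longlonglongrightarrow> 1 / (pi * wkb_g \<xi>)"
proof -
  define \<delta> where "\<delta> = min 1 (min (\<xi> / 2) ((4 - \<xi>) / 2))"
  have \<delta>: "0 < \<delta>" "\<delta> \<le> 1" "\<delta> < \<xi>" "\<xi> < 4 - \<delta>" using \<xi> by (auto simp: \<delta>_def min_def field_simps)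
  obtain C where C: "C \<ge> 0" "\<forall>\<^sub>F n in sequentially. \<forall>\<tau>\<in>{\<delta>..4 - \<delta>}. wkb_estimate C n \<tau>"
    by (rule wkb_uniform_bounded[OF \<delta>(1,2)])
  have ev: "\<forall>\<^sub>F n in sequentially. \<delta> < \<tau> n" "\<forall>\<^sub>F n in sequentially. \<tau> n < 4 - \<delta>"
    using order_tendstoD[OF \<tau>] \<delta> by auto
  have "(\<lambda>n. wkb_g (\<tau> n) * energy n (\<tau> n) - amplitude n) \<longlonglongrightarrow> 0"
  proof (rule Lim_null_comparison[OF _ inverse_k_lim[of C]])
    show "\<forall>\<^sub>F n in sequentially. norm (wkb_g (\<tau> n) * energy n (\<tau> n) - amplitude n) \<le> C / k n"
      using C(2) ev by eventually_elim (auto simp: wkb_estimate_def)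
  qed
  from tendsto_add[OF this amplitude_lim]
  have 1: "(\<lambda>n. wkb_g (\<tau> n) * energy n (\<tau> n)) \<longlonglongrightarrow> 1 / pi" by simp
  have 2: "(\<lambda>n. wkb_g (\<tau> n)) \<longlonglongrightarrow> wkb_g \<xi>"
    using DERIV_isCont[OF wkb_g_deriv[OF \<xi>]] \<tau> by (rule isCont_tendsto_compose)
  have "(\<lambda>n. wkb_g (\<tau> n) * energy n (\<tau> n) / wkb_g (\<tau> n)) \<longlonglongrightarrow> 1 / pi / wkb_g \<xi>"
    using wkb_g_pos[OF \<xi>] by (intro tendsto_divide 1 2) auto
  moreover have "\<forall>\<^sub>F n in sequentially. wkb_g (\<tau> n) * energy n (\<tau> n) / wkb_g (\<tau> n) = energy n (\<tau> n)"
    using ev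
  proof eventually_elim
    case (elim n)
    then show ?case using wkb_g_pos[of "\<tau> n"] \<delta> by simp
  qed
  ultimately show ?thesis by (simp add: tendsto_cong)
qed

lemma energy_bounded:
  assumes "0 < \<delta>" "\<delta> \<le> 1"
  obtains C where "C \<ge> 0" "\<forall>\<^sub>F n in sequentially. \<forall>\<tau>\<in>{\<delta>..4 - \<delta>}. energy n \<tau> \<le> C"
proof -
  obtain C where C: "C \<ge> 0" "\<forall>\<^sub>F n in sequentially. \<forall>\<tau>\<in>{\<delta>..4 - \<delta>}. wkb_estimate C n \<tau>"
    by (rule wkb_uniform_bounded[OF assms])
  show ?thesis
    by (rule that[OF C(1) eventually_mono[OF C(2)]]) (auto simp: wkb_estimate_def)
qed


section \<open>Local sine waves at a bulk point\<close>

lemma near_bulk_point: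
  assumes \<xi>: "0 < \<xi>" "\<xi> < 4" and x: "(\<lambda>n. x n / k n) \<longlonglongrightarrow> \<xi>" and "\<epsilon> > 0" "R \<ge> 0"
  shows "\<forall>\<^sub>F n in sequentially. \<forall>t. \<bar>t\<bar> \<le> R \<longrightarrow> \<bar>(x n + t) / k n - \<xi>\<bar> < \<epsilon>"
proof -
  have "\<forall>\<^sub>F n in sequentially. \<bar>x n / k n - \<xi>\<bar> < \<epsilon> / 2"
    using tendstoD[OF x, of "\<epsilon> / 2"] assms(4) by (simp add: dist_real_def)
  moreover have "\<forall>\<^sub>F n in sequentially. R / k n < \<epsilon> / 2"
    by (rule order_tendstoD(2)[OF inverse_k_lim]) (use assms(4) in simp)
  ultimately show ?thesis
  proof eventually_elim
    case (elim n)
    show ?case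
    proof (intro allI impI)
      fix t assume "\<bar>t\<bar> \<le> R"
      then have "\<bar>t / k n\<bar> \<le> R / k n"
        using k_pos[of n] by (simp add: divide_right_mono)
      then show "\<bar>(x n + t) / k n - \<xi>\<bar> < \<epsilon>"
        using elim unfolding add_divide_distrib by linarith
    qed
  qed
qed

lemma local_bounds:
  assumes \<xi>: "0 < \<xi>" "\<xi> < 4" and x: "(\<lambda>n. x n / k n) \<longlonglongrightarrow> \<xi>" and "R \<ge> 0"
  obtains L where "L \<ge> 0" "\<forall>\<^sub>F n in sequentially. \<forall>t. \<bar>t\<bar> \<le> R \<longrightarrow>
     \<bar>u n ((x n + t) / k n)\<bar> \<le> L \<and> \<bar>ud n ((x n + t) / k n)\<bar> \<le> L"
proof -
  define \<delta> where "\<delta> = min 1 (min (\<xi> / 2) ((4 - \<xi>) / 2))"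
  have \<delta>: "0 < \<delta>" "\<delta> \<le> 1" "2 * \<delta> \<le> \<xi>" "\<xi> \<le> 4 - 2 * \<delta>" using \<xi> by (auto simp: \<delta>_def min_def field_simps)
  obtain C where C: "C \<ge> 0" "\<forall>\<^sub>F n in sequentially. \<forall>\<tau>\<in>{\<delta>..4 - \<delta>}. energy n \<tau> \<le> C"
    by (rule energy_bounded[OF \<delta>(1,2)])
  let ?L = "sqrt ((16 / \<delta> + 1) * C)"
  show ?thesis
  proof (rule that[of ?L])
    show "\<forall>\<^sub>F n in sequentially. \<forall>t. \<bar>t\<bar> \<le> R \<longrightarrow>
       \<bar>u n ((x n + t) / k n)\<bar> \<le> ?L \<and> \<bar>ud n ((x n + t) / k n)\<bar> \<le> ?L"
      using C(2) near_bulk_point[OF \<xi> x \<delta>(1) assms(4)]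
    proof eventually_elim
      case (elim n)
      show ?case
      proof (intro allI impI)
        fix t assume "\<bar>t\<bar> \<le> R"
        then have "\<bar>(x n + t) / k n - \<xi>\<bar> < \<delta>" using elim(2) by blast
        then have \<tau>: "\<delta> \<le> (x n + t) / k n" "(x n + t) / k n \<le> 4 - \<delta>"
          using \<delta> by (auto simp: abs_less_iff)
        define \<tau> where "\<tau> = (x n + t) / k n"
        note e = energy_bounds[OF \<delta>(1) \<tau>, of n, folded \<tau>_def]
        have eC: "energy n \<tau> \<le> C" using elim(1) \<tau> by (simp add: \<tau>_def)
        have "(u n \<tau>)\<^sup>2 \<le> (16 / \<delta> + 1) * C"
          using e(1,3) eC mult_left_mono[OF eC, of "16 / \<delta>"] C(1) \<delta>(1) by (simp add: ring_distribs)
        moreover have "(ud n \<tau>)\<^sup>2 \<le> (16 / \<delta> + 1) * C"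
        proof -
          have "0 \<le> 16 / \<delta> * C" using C(1) \<delta>(1) by simp
          then show ?thesis using e(2) eC by (simp add: ring_distribs)
        qed
        ultimately show "\<bar>u n ((x n + t) / k n)\<bar> \<le> ?L \<and> \<bar>ud n ((x n + t) / k n)\<bar> \<le> ?L"
          unfolding \<tau>_def[symmetric] by (auto intro!: real_le_rsqrt)
      qed
    qed
  qed (use C(1) \<delta>(1) in simp)
qed

lemma potential_lim:
  assumes \<xi>: "0 < \<xi>" "\<xi> < 4" and x: "(\<lambda>n. x n / k n) \<longlonglongrightarrow> \<xi>" and "R \<ge> 0" "\<epsilon> > 0"
  shows "\<forall>\<^sub>F n in sequentially. \<forall>t. \<bar>t\<bar> \<le> R \<longrightarrow>
    \<bar>(1 / ((x n + t) / k n) - 1 / 4 + c / ((k n)\<^sup>2 * ((x n + t) / k n)\<^sup>2)) - (1 / \<xi> - 1 / 4)\<bar> < \<epsilon>"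
proof -
  have "(\<lambda>y. 1 / y) \<midarrow>\<xi>\<rightarrow> 1 / \<xi>" using \<xi> by (intro tendsto_intros) auto
  then obtain s where s: "s > 0" "\<And>y. y \<noteq> \<xi> \<Longrightarrow> \<bar>y - \<xi>\<bar> < s \<Longrightarrow> \<bar>1 / y - 1 / \<xi>\<bar> < \<epsilon> / 2"
    using LIM_D[of "\<lambda>y. 1 / y" "1 / \<xi>" \<xi> "\<epsilon> / 2"] assms(5) by auto
  have s': "\<bar>1 / y - 1 / \<xi>\<bar> < \<epsilon> / 2" if "\<bar>y - \<xi>\<bar> < s" for y
    using s(2)[OF _ that] assms(5) by (cases "y = \<xi>") auto
  have "\<forall>\<^sub>F n in sequentially. \<bar>c\<bar> / (\<xi> / 2)\<^sup>2 / k n < \<epsilon> / 2"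
    by (rule order_tendstoD(2)[OF inverse_k_lim]) (use assms(5) in simp)
  moreover have "min s (\<xi> / 2) > 0" using s(1) \<xi> by simp
  note near_bulk_point[OF \<xi> x this assms(4)]
  ultimately show ?thesis
  proof eventually_elim
    case (elim n)
    show ?case
    proof (intro allI impI)
      fix t assume "\<bar>t\<bar> \<le> R"
      define \<tau> where "\<tau> = (x n + t) / k n"
      have \<tau>: "\<bar>\<tau> - \<xi>\<bar> < s" "\<bar>\<tau> - \<xi>\<bar> < \<xi> / 2"
        using elim(2) \<open>\<bar>t\<bar> \<le> R\<close> s(1) \<xi> by (auto simp: \<tau>_def)
      from this(2) have "\<xi> / 2 \<le> \<tau>" by linarith
      then have "(\<xi> / 2)\<^sup>2 * k n \<le> \<tau>\<^sup>2 * (k n)\<^sup>2"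
        using \<xi> k_ge_1[of n] self_le_power[OF k_ge_1[of n], of 2] by (intro mult_mono power_mono) auto
      then have "\<bar>c / ((k n)\<^sup>2 * \<tau>\<^sup>2)\<bar> \<le> \<bar>c\<bar> / ((\<xi> / 2)\<^sup>2 * k n)"
        unfolding abs_divide using \<xi> k_pos[of n] \<open>\<xi> / 2 \<le> \<tau>\<close> by (intro divide_left_mono) (auto simp: mult.commute)
      also have "\<dots> < \<epsilon> / 2" using elim(1) by simp
      finally show "\<bar>(1 / ((x n + t) / k n) - 1 / 4 + c / ((k n)\<^sup>2 * ((x n + t) / k n)\<^sup>2)) - (1 / \<xi> - 1 / 4)\<bar> < \<epsilon>"
        using s'[OF \<tau>(1)] unfolding \<tau>_def[symmetric] by linarith
    qed
  qed
qed

context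
  fixes \<xi> \<omega> :: real and x :: "nat \<Rightarrow> real"
  assumes \<xi>: "0 < \<xi>" "\<xi> < 4" and x: "(\<lambda>n. x n / k n) \<longlonglongrightarrow> \<xi>" and \<omega>: "\<omega> = sqrt (1 / \<xi> - 1 / 4)"
begin

lemma \<omega>_pos: "\<omega> > 0" and \<omega>_square: "\<omega>\<^sup>2 = 1 / \<xi> - 1 / 4"
  using wkb_U_pos[OF \<xi>] by (auto simp: \<omega>)

text \<open>Here t is an unscaled local variable around x n, in which the frequency stays of order 1
  and the potential \<open>W\<close> becomes constant in the limit.\<close>

definition "v n t = u n ((x n + t) / k n)"
definition "vd n t = ud n ((x n + t) / k n)"
definition "W n t = 1 / ((x n + t) / k n) - 1 / 4 + c / ((k n)\<^sup>2 * ((x n + t) / k n)\<^sup>2)"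

lemma v_deriv:
  assumes "0 < (x n + t) / k n"
  shows "(v n has_real_derivative vd n t) (at t)" "(vd n has_real_derivative - W n t * v n t) (at t)"
proof -
  have k: "k n > 0" by (rule k_pos)
  have 1: "((\<lambda>t. (x n + t) / k n) has_real_derivative 1 / k n) (at t)"
    using k by (auto intro!: derivative_eq_intros)
  show "(v n has_real_derivative vd n t) (at t)"
    unfolding v_def[abs_def] vd_def
    by (rule DERIV_cong[OF DERIV_chain2[OF u_deriv[OF assms] 1]]) (use k in simp)
  show "(vd n has_real_derivative - W n t * v n t) (at t)"
    unfolding v_def vd_def[abs_def] W_def
    by (rule DERIV_cong[OF DERIV_chain2[OF ud_deriv[OF assms] 1]]) (use k in \<open>simp add: algebra_simps\<close>)
qed

text \<open>The coefficients of \<open>cos (\<omega> * t)\<close> and \<open>sin (\<omega> * t) / \<omega>\<close>: constant for the equation with frozen potential \<open>\<omega>\<^sup>2\<close>.\<close>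

definition "ca n t = v n t * cos (\<omega> * t) - vd n t * sin (\<omega> * t) / \<omega>"
definition "cb n t = v n t * \<omega> * sin (\<omega> * t) + vd n t * cos (\<omega> * t)"

lemma v_eq: "v n t = ca n t * cos (\<omega> * t) + cb n t * sin (\<omega> * t) / \<omega>"
proof -
  have "(x * C - y * S / \<omega>) * C + (x * \<omega> * S + y * C) * S / \<omega> = x * (C * C + S * S)" for x y C S :: real
    using \<omega>_pos by (simp add: field_simps)
  then show ?thesis by (simp add: ca_def cb_def)
qed

lemma vd_eq: "vd n t = - ca n t * \<omega> * sin (\<omega> * t) + cb n t * cos (\<omega> * t)"
proof -
  have "- (x * C - y * S / \<omega>) * \<omega> * S + (x * \<omega> * S + y * C) * C = y * (C * C + S * S)" for x y C S :: real
    using \<omega>_pos by (simp add: field_simps)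
  then show ?thesis by (simp only: ca_def cb_def sin_cos_squared_add3 mult_1_right)
qed

text \<open>Variation of constants: only the deviation of the potential from its frozen value drives
  the coefficients.\<close>

lemma ca_deriv:
  assumes "0 < (x n + t) / k n"
  shows "(ca n has_real_derivative (W n t - \<omega>\<^sup>2) * v n t * sin (\<omega> * t) / \<omega>) (at t)"
    "(cb n has_real_derivative (\<omega>\<^sup>2 - W n t) * v n t * cos (\<omega> * t)) (at t)"
  unfolding ca_def[abs_def] cb_def[abs_def]
proof -
  have s: "((\<lambda>t. sin (\<omega> * t)) has_real_derivative \<omega> * cos (\<omega> * t)) (at t)"
    and c: "((\<lambda>t. cos (\<omega> * t)) has_real_derivative - \<omega> * sin (\<omega> * t)) (at t)"
    by (auto intro!: derivative_eq_intros)
  show "((\<lambda>t. v n t * cos (\<omega> * t) - vd n t * sin (\<omega> * t) / \<omega>) has_real_derivative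
      (W n t - \<omega>\<^sup>2) * v n t * sin (\<omega> * t) / \<omega>) (at t)"
    by (rule DERIV_cong[OF DERIV_diff[OF DERIV_mult[OF v_deriv(1)[OF assms] c]
          DERIV_cdivide[OF DERIV_mult[OF v_deriv(2)[OF assms] s]]]])
       (use \<omega>_pos in \<open>simp add: field_simps power2_eq_square\<close>)
  have "((\<lambda>t. v n t * (\<omega> * sin (\<omega> * t)) + vd n t * cos (\<omega> * t)) has_real_derivative
      (\<omega>\<^sup>2 - W n t) * v n t * cos (\<omega> * t)) (at t)"
    by (rule DERIV_cong[OF DERIV_add[OF DERIV_mult[OF v_deriv(1)[OF assms] DERIV_cmult[OF s]]
          DERIV_mult[OF v_deriv(2)[OF assms] c]]])
       (simp add: algebra_simps power2_eq_square)
  then show "((\<lambda>t. v n t * \<omega> * sin (\<omega> * t) + vd n t * cos (\<omega> * t)) has_real_derivative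
      (\<omega>\<^sup>2 - W n t) * v n t * cos (\<omega> * t)) (at t)"
    by (simp add: mult.assoc)
qed

text \<open>On a window of fixed length \<open>v\<close> is bounded and the deviation of the
  potential tends to 0 uniformly, so the coefficients change by o(1). The mean value inequality
  turns this into the stated limits.\<close>

lemma slowly_varying:
  "(\<lambda>n. ca n t - ca n 0) \<longlonglongrightarrow> 0" "(\<lambda>n. cb n t - cb n 0) \<longlonglongrightarrow> 0"
proof -
  define R where "R = \<bar>t\<bar>"
  have R: "R \<ge> 0" by (simp add: R_def)
  obtain L where L: "L \<ge> 0" "\<forall>\<^sub>F n in sequentially. \<forall>t. \<bar>t\<bar> \<le> R \<longrightarrow>
     \<bar>u n ((x n + t) / k n)\<bar> \<le> L \<and> \<bar>ud n ((x n + t) / k n)\<bar> \<le> L"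
    by (rule local_bounds[OF \<xi> x R])
  have key: "\<forall>\<^sub>F n in sequentially. \<bar>ca n t - ca n 0\<bar> \<le> e * L * (1 / \<omega> + 1) * R \<and> \<bar>cb n t - cb n 0\<bar> \<le> e * L * (1 / \<omega> + 1) * R"
    if e: "e > 0" for e
    using L(2) potential_lim[OF \<xi> x R e] near_bulk_point[OF \<xi> x \<xi>(1) R]
  proof eventually_elim
    case (elim n)
    let ?B = "e * L * (1 / \<omega> + 1)"
    have pos: "0 < (x n + s) / k n" if "\<bar>s\<bar> \<le> R" for s
      using elim(3) that by (auto simp: abs_less_iff)
    have Wv: "\<bar>(W n s - \<omega>\<^sup>2) * v n s\<bar> \<le> e * L" if "\<bar>s\<bar> \<le> R" for s
    proof -
      have "\<bar>W n s - \<omega>\<^sup>2\<bar> \<le> e" using elim(2) that by (simp add: W_def \<omega>_square less_imp_le)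
      moreover have "\<bar>v n s\<bar> \<le> L" using elim(1) that by (simp add: v_def)
      ultimately show ?thesis unfolding abs_mult using e by (intro mult_mono) auto
    qed
    have B: "e * L \<le> ?B" "e * L * (1 / \<omega>) \<le> ?B"
      using e L(1) \<omega>_pos by (simp_all add: ring_distribs)
    have da: "\<bar>(W n s - \<omega>\<^sup>2) * v n s * sin (\<omega> * s) / \<omega>\<bar> \<le> ?B" if "\<bar>s\<bar> \<le> R" for s
    proof -
      have "\<bar>(W n s - \<omega>\<^sup>2) * v n s * sin (\<omega> * s) / \<omega>\<bar> = \<bar>(W n s - \<omega>\<^sup>2) * v n s\<bar> * (1 / \<omega>) * \<bar>sin (\<omega> * s)\<bar>"
        using \<omega>_pos by (simp add: abs_mult)
      also have "\<dots> \<le> e * L * (1 / \<omega>) * 1"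
        using Wv[OF that] e L(1) \<omega>_pos by (intro mult_mono) auto
      finally show ?thesis using B(2) by linarith
    qed
    have db: "\<bar>(\<omega>\<^sup>2 - W n s) * v n s * cos (\<omega> * s)\<bar> \<le> ?B" if "\<bar>s\<bar> \<le> R" for s
    proof -
      have "\<bar>(\<omega>\<^sup>2 - W n s) * v n s * cos (\<omega> * s)\<bar> = \<bar>(W n s - \<omega>\<^sup>2) * v n s\<bar> * \<bar>cos (\<omega> * s)\<bar>"
        by (simp add: abs_mult abs_minus_commute)
      also have "\<dots> \<le> e * L * 1"
        using Wv[OF that] e L(1) by (intro mult_mono) auto
      finally show ?thesis using B(1) by linarith
    qed
    have "norm (ca n t - ca n 0) \<le> ?B * norm (t - 0)"
    proof (rule field_differentiable_bound[OF convex_real_interval(5)[of "-R" R],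
            where f' = "\<lambda>s. (W n s - \<omega>\<^sup>2) * v n s * sin (\<omega> * s) / \<omega>"])
      fix z assume "z \<in> {-R..R}"
      then have z: "\<bar>z\<bar> \<le> R" by auto
      show "(ca n has_real_derivative (W n z - \<omega>\<^sup>2) * v n z * sin (\<omega> * z) / \<omega>) (at z within {-R..R})"
        by (rule has_field_derivative_at_within[OF ca_deriv(1)[OF pos[OF z]]])
      show "norm ((W n z - \<omega>\<^sup>2) * v n z * sin (\<omega> * z) / \<omega>) \<le> ?B"
        using da[OF z] by (simp only: real_norm_def)
    qed (auto simp: R_def)
    moreover have "norm (cb n t - cb n 0) \<le> ?B * norm (t - 0)"
    proof (rule field_differentiable_bound[OF convex_real_interval(5)[of "-R" R],
            where f' = "\<lambda>s. (\<omega>\<^sup>2 - W n s) * v n s * cos (\<omega> * s)"])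
      fix z assume "z \<in> {-R..R}"
      then have z: "\<bar>z\<bar> \<le> R" by auto
      show "(cb n has_real_derivative (\<omega>\<^sup>2 - W n z) * v n z * cos (\<omega> * z)) (at z within {-R..R})"
        by (rule has_field_derivative_at_within[OF ca_deriv(2)[OF pos[OF z]]])
      show "norm ((\<omega>\<^sup>2 - W n z) * v n z * cos (\<omega> * z)) \<le> ?B"
        using db[OF z] by (simp only: real_norm_def)
    qed (auto simp: R_def)
    ultimately show ?case by (simp add: R_def)
  qed
  have small: "\<forall>\<^sub>F n in sequentially. \<bar>ca n t - ca n 0\<bar> < \<epsilon> \<and> \<bar>cb n t - cb n 0\<bar> < \<epsilon>" if "\<epsilon> > 0" for \<epsilon>
  proof -
    define P where "P = L * (1 / \<omega> + 1) * R"
    define e where "e = \<epsilon> / 2 / (P + 1)"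
    have p: "P \<ge> 0" using L(1) R \<omega>_pos by (simp add: P_def)
    then have "P + 1 \<noteq> 0" by linarith
    then have "e * (P + 1) = \<epsilon> / 2" by (metis e_def nonzero_eq_divide_eq)
    have "e > 0" using that p by (simp add: e_def)
    have "e * P < \<epsilon>"
      using \<open>e > 0\<close> \<open>e * (P + 1) = \<epsilon> / 2\<close> that by (simp add: distrib_left)
    then have "e * L * (1 / \<omega> + 1) * R < \<epsilon>" by (simp add: P_def mult.assoc)
    then show ?thesis using key[OF \<open>e > 0\<close>] by (auto elim!: eventually_mono)
  qed
  show "(\<lambda>n. ca n t - ca n 0) \<longlonglongrightarrow> 0"
    by (rule tendstoI, rule eventually_mono[OF small]) (auto simp: dist_real_def)
  show "(\<lambda>n. cb n t - cb n 0) \<longlonglongrightarrow> 0"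
    by (rule tendstoI, rule eventually_mono[OF small]) (auto simp: dist_real_def)
qed

lemma v_Bfun: "Bfun (\<lambda>n. v n t) sequentially" "Bfun (\<lambda>n. vd n t) sequentially"
proof -
  obtain L where L: "L \<ge> 0" "\<forall>\<^sub>F n in sequentially. \<forall>s. \<bar>s\<bar> \<le> \<bar>t\<bar> \<longrightarrow>
     \<bar>u n ((x n + s) / k n)\<bar> \<le> L \<and> \<bar>ud n ((x n + s) / k n)\<bar> \<le> L"
    by (rule local_bounds[OF \<xi> x abs_ge_zero])
  show "Bfun (\<lambda>n. v n t) sequentially" "Bfun (\<lambda>n. vd n t) sequentially"
    by (rule BfunI[of _ L], use L(2) in \<open>auto elim!: eventually_mono simp: v_def vd_def\<close>)+
qed

lemma local_energy:
  "(\<lambda>n. (vd n t)\<^sup>2 + W n t * (v n t)\<^sup>2) \<longlonglongrightarrow> \<omega> / pi"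
proof -
  have "(\<lambda>n. (x n + t) / k n) \<longlonglongrightarrow> \<xi>"
    using tendsto_add[OF x inverse_k_lim[of t]] by (simp add: add_divide_distrib)
  from energy_lim[OF \<xi> this]
  have "(\<lambda>n. energy n ((x n + t) / k n)) \<longlonglongrightarrow> \<omega> / pi"
    using \<omega>_pos by (simp add: wkb_g_def \<omega>)
  moreover have eq: "c / (a\<^sup>2 * b\<^sup>2) = c / b\<^sup>2 * (1 / a) * (1 / a)" for a b :: real
    by (simp add: power2_eq_square)
  have "(\<lambda>n. c / ((x n + t) / k n)\<^sup>2 * (1 / k n) * (1 / k n)) \<longlonglongrightarrow> c / \<xi>\<^sup>2 * 0 * 0"
    using \<xi> by (intro tendsto_intros inverse_k_lim \<open>(\<lambda>n. (x n + t) / k n) \<longlonglongrightarrow> \<xi>\<close>) auto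
  then have "Zfun (\<lambda>n. c / ((k n)\<^sup>2 * ((x n + t) / k n)\<^sup>2)) sequentially"
    unfolding eq by (simp add: tendsto_Zfun_iff)
  then have "Zfun (\<lambda>n. c / ((k n)\<^sup>2 * ((x n + t) / k n)\<^sup>2) * v n t * v n t) sequentially"
    by (intro bounded_bilinear.Zfun_prod_Bfun[OF bounded_bilinear_mult] v_Bfun)
  then have "(\<lambda>n. c / ((k n)\<^sup>2 * ((x n + t) / k n)\<^sup>2) * v n t * v n t) \<longlonglongrightarrow> 0"
    by (simp add: tendsto_Zfun_iff)
  ultimately have "(\<lambda>n. energy n ((x n + t) / k n) + c / ((k n)\<^sup>2 * ((x n + t) / k n)\<^sup>2) * v n t * v n t) \<longlonglongrightarrow> \<omega> / pi + 0"
    by (rule tendsto_add)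
  then show ?thesis
    by (simp add: energy_def v_def vd_def W_def algebra_simps power2_eq_square)
qed

text \<open>The pair \<open>p\<close>, \<open>q\<close> is the exact sine wave with the same data at
  t = 0. Its Wronskian at two points is (vd^2 + \<omega>^2 v^2) / \<omega> times sin (\<omega> (s -
  t)): the data enter only through the energy, whose limit is known, and not through the
  phase.\<close>

lemma local_wronskian:
  "(\<lambda>n. v n s * vd n t - vd n s * v n t) \<longlonglongrightarrow> sin (\<omega> * (s - t)) / pi"
proof -
  have Zmul: "Zfun (\<lambda>n. f n * g n) sequentially" if "Zfun f sequentially" "Bfun g sequentially" for f g :: "nat \<Rightarrow> real"
    using bounded_bilinear.Zfun_prod_Bfun[OF bounded_bilinear_mult] that by blast
  have Za: "Zfun (\<lambda>n. ca n t - ca n 0) sequentially" "Zfun (\<lambda>n. cb n t - cb n 0) sequentially" for t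
    using slowly_varying[of t] by (simp_all add: tendsto_Zfun_iff)
  have v0: "ca n 0 = v n 0" "cb n 0 = vd n 0" for n by (simp_all add: ca_def cb_def)
  define p q where "p n t = v n 0 * cos (\<omega> * t) + vd n 0 * sin (\<omega> * t) / \<omega>"
    and "q n t = - v n 0 * \<omega> * sin (\<omega> * t) + vd n 0 * cos (\<omega> * t)" for n t
  have Zp: "Zfun (\<lambda>n. v n t - p n t) sequentially" for t
  proof -
    have "v n t - p n t = (ca n t - ca n 0) * cos (\<omega> * t) + (cb n t - cb n 0) * (sin (\<omega> * t) / \<omega>)" for n
      by (simp add: v_eq[of n t] p_def v0 algebra_simps diff_divide_distrib)
    then show ?thesis by (simp only:) (intro Zfun_add Zmul Za Bfun_const)
  qed
  have Zq: "Zfun (\<lambda>n. vd n t - q n t) sequentially" for t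
  proof -
    have "vd n t - q n t = (ca n t - ca n 0) * (- \<omega> * sin (\<omega> * t)) + (cb n t - cb n 0) * cos (\<omega> * t)" for n
      by (simp add: vd_eq[of n t] q_def v0 algebra_simps)
    then show ?thesis by (simp only:) (intro Zfun_add Zmul Za Bfun_const)
  qed
  have Bp: "Bfun (\<lambda>n. p n t) sequentially" "Bfun (\<lambda>n. q n t) sequentially" for t
  proof -
    obtain L where L: "L \<ge> 0" "\<forall>\<^sub>F n in sequentially. \<forall>s. \<bar>s\<bar> \<le> \<bar>0\<bar> \<longrightarrow>
       \<bar>u n ((x n + s) / k n)\<bar> \<le> L \<and> \<bar>ud n ((x n + s) / k n)\<bar> \<le> L"
      by (rule local_bounds[OF \<xi> x abs_ge_zero])
    then have ev: "\<forall>\<^sub>F n in sequentially. \<bar>v n 0\<bar> \<le> L \<and> \<bar>vd n 0\<bar> \<le> L"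
      by (auto elim!: eventually_mono simp: v_def vd_def)
    show "Bfun (\<lambda>n. p n t) sequentially"
    proof (rule BfunI)
      show "\<forall>\<^sub>F n in sequentially. norm (p n t) \<le> L * \<bar>cos (\<omega> * t)\<bar> + L * \<bar>sin (\<omega> * t) / \<omega>\<bar>"
        using ev
      proof eventually_elim
        case (elim n)
        have "\<bar>p n t\<bar> \<le> \<bar>v n 0\<bar> * \<bar>cos (\<omega> * t)\<bar> + \<bar>vd n 0\<bar> * \<bar>sin (\<omega> * t) / \<omega>\<bar>"
          unfolding p_def by (rule order_trans[OF abs_triangle_ineq]) (simp add: abs_mult)
        also have "\<dots> \<le> L * \<bar>cos (\<omega> * t)\<bar> + L * \<bar>sin (\<omega> * t) / \<omega>\<bar>"
          using elim by (intro add_mono mult_right_mono) auto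
        finally show ?case by simp
      qed
    qed
    show "Bfun (\<lambda>n. q n t) sequentially"
    proof (rule BfunI)
      show "\<forall>\<^sub>F n in sequentially. norm (q n t) \<le> L * \<bar>\<omega> * sin (\<omega> * t)\<bar> + L * \<bar>cos (\<omega> * t)\<bar>"
        using ev
      proof eventually_elim
        case (elim n)
        have "\<bar>q n t\<bar> \<le> \<bar>v n 0\<bar> * \<bar>\<omega> * sin (\<omega> * t)\<bar> + \<bar>vd n 0\<bar> * \<bar>cos (\<omega> * t)\<bar>"
          unfolding q_def by (rule order_trans[OF abs_triangle_ineq]) (simp add: abs_mult)
        also have "\<dots> \<le> L * \<bar>\<omega> * sin (\<omega> * t)\<bar> + L * \<bar>cos (\<omega> * t)\<bar>"
          using elim by (intro add_mono mult_right_mono) auto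
        finally show ?case by simp
      qed
    qed
  qed
  have Z1: "Zfun (\<lambda>n. v n s * vd n t - vd n s * v n t - (p n s * q n t - q n s * p n t)) sequentially"
  proof -
    have eq: "v n s * vd n t - vd n s * v n t - (p n s * q n t - q n s * p n t)
      = (v n s - p n s) * vd n t + (vd n t - q n t) * p n s
        - ((vd n s - q n s) * v n t + (v n t - p n t) * q n s)" for n
      by (simp add: algebra_simps)
    show ?thesis unfolding eq by (intro Zfun_diff Zfun_add Zmul Zp Zq Bp v_Bfun)
  qed
  have pq: "p n s * q n t - q n s * p n t = ((vd n 0)\<^sup>2 + \<omega>\<^sup>2 * (v n 0)\<^sup>2) / \<omega> * sin (\<omega> * (s - t))" for n
    using \<omega>_pos by (simp add: p_def q_def right_diff_distrib sin_diff power2_eq_square field_simps)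
  have "(\<lambda>n. (vd n 0)\<^sup>2 + W n 0 * (v n 0)\<^sup>2) \<longlonglongrightarrow> \<omega> / pi" by (rule local_energy)
  moreover have "(\<lambda>n. \<omega>\<^sup>2 - W n 0) \<longlonglongrightarrow> 0"
  proof (rule tendstoI)
    fix e :: real assume "e > 0"
    from potential_lim[OF \<xi> x order_refl this]
    show "\<forall>\<^sub>F n in sequentially. dist (\<omega>\<^sup>2 - W n 0) 0 < e"
      by (auto elim!: eventually_mono simp: dist_real_def W_def \<omega>_square abs_minus_commute)
  qed
  then have "Zfun (\<lambda>n. \<omega>\<^sup>2 - W n 0) sequentially" by (simp add: tendsto_Zfun_iff)
  then have "Zfun (\<lambda>n. (\<omega>\<^sup>2 - W n 0) * v n 0 * v n 0) sequentially"
    by (intro Zmul v_Bfun)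
  then have "(\<lambda>n. (\<omega>\<^sup>2 - W n 0) * v n 0 * v n 0) \<longlonglongrightarrow> 0"
    by (simp add: tendsto_Zfun_iff)
  ultimately have "(\<lambda>n. (vd n 0)\<^sup>2 + W n 0 * (v n 0)\<^sup>2 + (\<omega>\<^sup>2 - W n 0) * v n 0 * v n 0) \<longlonglongrightarrow> \<omega> / pi + 0"
    by (rule tendsto_add)
  then have "(\<lambda>n. (vd n 0)\<^sup>2 + \<omega>\<^sup>2 * (v n 0)\<^sup>2) \<longlonglongrightarrow> \<omega> / pi"
    by (simp add: algebra_simps power2_eq_square)
  then have "(\<lambda>n. p n s * q n t - q n s * p n t) \<longlonglongrightarrow> \<omega> / pi / \<omega> * sin (\<omega> * (s - t))"
    unfolding pq using \<omega>_pos by (intro tendsto_intros) auto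
  then have "(\<lambda>n. (v n s * vd n t - vd n s * v n t - (p n s * q n t - q n s * p n t)) + (p n s * q n t - q n s * p n t))
      \<longlonglongrightarrow> 0 + \<omega> / pi / \<omega> * sin (\<omega> * (s - t))"
    using Z1 by (intro tendsto_add) (simp_all add: tendsto_Zfun_iff)
  then show ?thesis using \<omega>_pos by simp
qed

end

end

section \<open>The Laguerre kernel in the bulk\<close>

lemma exp_mult_poly_at_top: "((\<lambda>x. exp (- x) * poly p x) \<longlongrightarrow> (0::real)) at_top"
proof -
  have "((\<lambda>x. exp (- x) * poly p x) \<longlongrightarrow> (\<Sum>i\<le>degree p. coeff p i * 0)) at_top"
  proof -
    have "exp (- x) * poly p x = (\<Sum>i\<le>degree p. coeff p i * (x ^ i / exp x))" for x
      by (simp add: poly_altdef sum_distrib_left exp_minus field_simps)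
    then show ?thesis
      by (simp only:) (intro tendsto_intros tendsto_power_div_exp_0)
  qed
  then show ?thesis by simp
qed

context
  fixes \<alpha> :: nat
begin

text \<open>The parameter of this polynomial is \<alpha> - 1, one less than that of the kernel. Its
  equation x y'' + (\<alpha> - x) y' + (m + 1) y = 0 has the integrating factor x^\<alpha> exp (-
  x), whose square root \<open>lag_weight\<close> removes the first-order term. The numbers
  \<open>lagk\<close> and \<open>lagc\<close> are the coefficients of 1 / x and 1 / x^2 in the
  resulting potential.\<close>

definition lagY :: "nat \<Rightarrow> real poly" where "lagY m = lag (m + \<alpha>) (Suc m)"
definition lagT :: "nat \<Rightarrow> real" where "lagT m = fact (m + \<alpha>) * fact (Suc m)"
definition lagk :: "nat \<Rightarrow> real" where "lagk m = real m + 1 + \<alpha> / 2"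
definition lagc :: real where "lagc = real \<alpha> * (2 - real \<alpha>) / 4"
definition lag_weight :: "real \<Rightarrow> real" where "lag_weight x = exp (\<alpha> / 2 * ln x - x / 2)"
definition lag_a :: "real \<Rightarrow> real" where "lag_a x = \<alpha> / (2 * x) - 1 / 2"
definition lagv :: "nat \<Rightarrow> real \<Rightarrow> real" where
  "lagv m x = lag_weight x * poly (lagY m) x / sqrt (lagT m)"
definition lagvd :: "nat \<Rightarrow> real \<Rightarrow> real" where
  "lagvd m x = lag_weight x * (lag_a x * poly (lagY m) x + poly (pderiv (lagY m)) x) / sqrt (lagT m)"

text \<open>By \<open>lag_symmetry\<close> this is x^(\<alpha> - 1) times the square of
  \<open>lagY\<close>, in a form that is a polynomial also for \<alpha> = 0. Multiplied by exp (- x)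
  it is the density of the mass before normalisation.\<close>

definition lagP :: "nat \<Rightarrow> real poly" where "lagP m = lag (Suc m) (m + \<alpha>) * lagY m"

text \<open>The virial without its factor exp (- x): as a polynomial times an exponential it has
  evident values at 0 and at infinity.\<close>

definition lagB :: "nat \<Rightarrow> real poly" where
  "lagB m = monom 1 \<alpha> * ([:real m + 3 / 2:] * lagY m * lagY m
     + [:real \<alpha> - 1, - 1:] * lagY m * pderiv (lagY m) + [:0, 1:] * pderiv (lagY m) * pderiv (lagY m))"

lemma lagT_pos: "lagT m > 0" by (simp add: lagT_def)

lemma lagk_ge_1: "lagk m \<ge> 1" by (simp add: lagk_def)

lemma lag_weight_square:
  assumes "x > 0"
  shows "(lag_weight x)\<^sup>2 = x ^ \<alpha> * exp (- x)"
proof -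
  have "(lag_weight x)\<^sup>2 = exp (\<alpha> * ln x - x)"
    by (simp add: lag_weight_def power2_eq_square mult_exp_exp)
  then show ?thesis using assms
    by (simp add: exp_diff exp_minus divide_inverse ln_realpow[symmetric])
qed

lemma lagY_ode:
  "x * poly (pderiv (pderiv (lagY m))) x = - (real \<alpha> - x) * poly (pderiv (lagY m)) x - (real m + 1) * poly (lagY m) x"
proof (cases "m + \<alpha> = 0")
  \<comment> \<open>Outside the scope of \<open>lag_ode\<close>, which needs a positive first
    index.\<close>
  case True
  then have "lagY m = monom 1 1" unfolding lagY_def by (simp add: lag_0)
  then show ?thesis using True by (simp add: pderiv_monom poly_monom monom_0 pderiv_pCons)
next
  case False
  have "x * poly (pderiv (pderiv (lagY m))) x
      + (real (m + \<alpha>) - real (Suc m) + 1 - x) * poly (pderiv (lagY m)) x + real (Suc m) * poly (lagY m) x = 0"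
    unfolding lagY_def using False by (intro lag_ode) auto
  then show ?thesis by (simp add: algebra_simps)
qed

lemma lag_weight_deriv: "x > 0 \<Longrightarrow> (lag_weight has_real_derivative lag_weight x * lag_a x) (at x)"
  unfolding lag_weight_def[abs_def] lag_a_def by (auto intro!: derivative_eq_intros simp: field_simps)

lemma lagv_deriv:
  assumes "x > 0"
  shows "(lagv m has_real_derivative lagvd m x) (at x)"
  unfolding lagv_def[abs_def] lagvd_def
  by (rule DERIV_cong[OF DERIV_cdivide[OF DERIV_mult[OF lag_weight_deriv[OF assms] poly_DERIV]]])
     (simp add: algebra_simps)

text \<open>The differential equation of \<open>lagY\<close> written with the weighted functions;
  besides \<open>lagvd_deriv\<close>, the diagonal of the kernel also uses it.\<close>

lemma lagvd_second:
  assumes "x > 0"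
  shows "lag_weight x * poly (pderiv (pderiv (lagY m))) x / sqrt (lagT m)
     = - (lagk m / x - 1 / 4 + lagc / x\<^sup>2) * lagv m x + ((lag_a x)\<^sup>2 + \<alpha> / (2 * x\<^sup>2)) * lagv m x - 2 * lag_a x * lagvd m x"
proof -
  define y0 y1 y2 where "y0 = poly (lagY m) x" and "y1 = poly (pderiv (lagY m)) x"
    and "y2 = poly (pderiv (pderiv (lagY m))) x"
  have ode: "y2 = (- (real \<alpha> - x) * y1 - (real m + 1) * y0) / x"
    using lagY_ode[where x = x and m = m] assms by (simp add: y0_def y1_def y2_def field_simps)
  have "y2 = - (lagk m / x - 1 / 4 + lagc / x\<^sup>2) * y0 + ((lag_a x)\<^sup>2 + \<alpha> / (2 * x\<^sup>2)) * y0 - 2 * lag_a x * (lag_a x * y0 + y1)"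
    unfolding ode lagk_def lagc_def lag_a_def using assms
    by (simp add: field_simps power2_eq_square)
  then show ?thesis
    unfolding lagv_def lagvd_def y0_def[symmetric] y1_def[symmetric] y2_def[symmetric]
    by (simp only:) (simp add: algebra_simps add_divide_distrib diff_divide_distrib)
qed

lemma lag_a_deriv: "x > 0 \<Longrightarrow> (lag_a has_real_derivative - \<alpha> / (2 * x\<^sup>2)) (at x)"
  unfolding lag_a_def[abs_def] by (auto intro!: derivative_eq_intros simp: field_simps power2_eq_square)

lemma lagvd_deriv:
  assumes "x > 0"
  shows "(lagvd m has_real_derivative - (lagk m / x - 1 / 4 + lagc / x\<^sup>2) * lagv m x) (at x)"
proof -
  let ?y1 = "poly (pderiv (lagY m)) x" and ?y0 = "poly (lagY m) x"
    and ?y2 = "poly (pderiv (pderiv (lagY m))) x"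
  have "(lagvd m has_real_derivative (lag_weight x * lag_a x * (lag_a x * ?y0 + ?y1)
    + lag_weight x * (- \<alpha> / (2 * x\<^sup>2) * ?y0 + lag_a x * ?y1 + ?y2)) / sqrt (lagT m)) (at x)"
    unfolding lagvd_def[abs_def]
    by (rule DERIV_cong[OF DERIV_cdivide[OF DERIV_mult[OF lag_weight_deriv[OF assms]
          DERIV_add[OF DERIV_mult[OF lag_a_deriv[OF assms] poly_DERIV] poly_DERIV]]]])
       (simp add: algebra_simps)
  moreover have "(lag_weight x * lag_a x * (lag_a x * ?y0 + ?y1)
    + lag_weight x * (- \<alpha> / (2 * x\<^sup>2) * ?y0 + lag_a x * ?y1 + ?y2)) / sqrt (lagT m)
    = lag_a x * lagvd m x - \<alpha> / (2 * x\<^sup>2) * lagv m x + lag_a x * (lagvd m x - lag_a x * lagv m x)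
      + lag_weight x * ?y2 / sqrt (lagT m)"
    unfolding lagvd_def lagv_def by (simp add: algebra_simps add_divide_distrib diff_divide_distrib)
  moreover have "\<dots> = - (lagk m / x - 1 / 4 + lagc / x\<^sup>2) * lagv m x"
    unfolding lagvd_second[OF assms] by (simp add: algebra_simps power2_eq_square)
  ultimately show ?thesis by simp
qed

lemma lagP_eq:
  assumes "x > 0"
  shows "x * poly (lagP m) x = x ^ \<alpha> * (poly (lagY m) x)\<^sup>2"
proof -
  have "poly (monom 1 (m + \<alpha>) * lagY m) x = poly (monom 1 (Suc m) * lag (Suc m) (m + \<alpha>)) x"
    unfolding lagY_def by (simp only: lag_symmetry[of "m + \<alpha>" "Suc m"])
  then have "x ^ m * (x ^ \<alpha> * poly (lagY m) x) = x ^ m * (x * poly (lag (Suc m) (m + \<alpha>)) x)"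
    by (simp add: poly_monom power_add mult_ac)
  then have eq: "x ^ \<alpha> * poly (lagY m) x = x * poly (lag (Suc m) (m + \<alpha>)) x"
    using assms by simp
  have "x * poly (lagP m) x = x * poly (lag (Suc m) (m + \<alpha>)) x * poly (lagY m) x"
    by (simp add: lagP_def)
  then show ?thesis unfolding eq[symmetric] by (simp add: power2_eq_square)
qed

lemma lag_resolv_0: "poly (resolv (lagP m)) 0 = lagT m"
  unfolding lagP_def lagY_def lagT_def using resolv_lag_mult_lag[of "Suc m" "m + \<alpha>"] by (simp add: mult.commute)

definition lagu :: "nat \<Rightarrow> real \<Rightarrow> real" where "lagu m \<tau> = lagv m (lagk m * \<tau>)"
definition lagud :: "nat \<Rightarrow> real \<Rightarrow> real" where "lagud m \<tau> = lagvd m (lagk m * \<tau>)"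
text \<open>One minus the tail of the mass beyond k \<tau>, since the tail is what
  \<open>resolv\<close> gives in closed form.\<close>

definition lagM :: "nat \<Rightarrow> real \<Rightarrow> real" where
  "lagM m \<tau> = 1 - exp (- (lagk m * \<tau>)) * poly (resolv (lagP m)) (lagk m * \<tau>) / lagT m"
definition lagb :: "nat \<Rightarrow> real \<Rightarrow> real" where
  "lagb m \<tau> = exp (- (lagk m * \<tau>)) * poly (lagB m) (lagk m * \<tau>) / (lagT m * lagk m)"

lemma lagB_eq:
  assumes "x > 0"
  shows "exp (- x) * poly (lagB m) x / lagT m
    = x * ((lagvd m x)\<^sup>2 + (lagk m / x - 1 / 4 + lagc / x\<^sup>2) * (lagv m x)\<^sup>2) - lagv m x * lagvd m x"
proof -
  define y0 y1 where "y0 = poly (lagY m) x" and "y1 = poly (pderiv (lagY m)) x"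
  have sq: "(lag_weight x * z / sqrt (lagT m)) * (lag_weight x * z' / sqrt (lagT m))
     = x ^ \<alpha> * exp (- x) / lagT m * (z * z')" for z z'
    using lagT_pos[of m] lag_weight_square[OF assms] by (simp add: power2_eq_square field_simps)
  have "x * (lag_a x * y0 + y1)\<^sup>2 + x * (lagk m / x - 1 / 4 + lagc / x\<^sup>2) * y0\<^sup>2 - y0 * (lag_a x * y0 + y1)
      = (real m + 3 / 2) * y0\<^sup>2 + (real \<alpha> - 1 - x) * y0 * y1 + x * y1\<^sup>2"
    unfolding lagk_def lagc_def lag_a_def using assms
    by (simp add: field_simps power2_eq_square)
  moreover have "x * ((lagvd m x)\<^sup>2 + (lagk m / x - 1 / 4 + lagc / x\<^sup>2) * (lagv m x)\<^sup>2) - lagv m x * lagvd m x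
    = x ^ \<alpha> * exp (- x) / lagT m * (x * (lag_a x * y0 + y1)\<^sup>2
       + x * (lagk m / x - 1 / 4 + lagc / x\<^sup>2) * y0\<^sup>2 - y0 * (lag_a x * y0 + y1))"
  proof -
    have "x * (q * (z * z) + V * (q * (y * y))) - q * (y * z) = q * (x * (z * z) + x * V * (y * y) - y * z)"
      for q V y z :: real
      by (simp add: algebra_simps)
    then show ?thesis
      unfolding lagv_def lagvd_def power2_eq_square sq y0_def[symmetric] y1_def[symmetric] .
  qed
  moreover have "poly (lagB m) x = x ^ \<alpha> * ((real m + 3 / 2) * y0\<^sup>2 + (real \<alpha> - 1 - x) * y0 * y1 + x * y1\<^sup>2)"
    by (simp add: lagB_def poly_monom y0_def y1_def power2_eq_square algebra_simps)
  ultimately show ?thesis by simp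
qed

lemma lagk_lim: "filterlim lagk at_top sequentially"
  unfolding lagk_def[abs_def] by real_asymp

lemma filterlim_lagk_mult: "filterlim (\<lambda>\<tau>. lagk m * \<tau>) at_top at_top"
  using lagk_ge_1[of m] by (intro filterlim_tendsto_pos_mult_at_top[OF tendsto_const _ filterlim_ident]) auto

lemma wkb_laguerre: "wkb lagk lagc lagu lagud lagM lagb"
proof
  fix m
  have k: "lagk m > 0" using lagk_ge_1[of m] by linarith
  note T = lagT_pos[of m]
  have chain: "((\<lambda>\<tau>. lagk m * \<tau>) has_real_derivative lagk m) (at \<tau>)" for \<tau>
    by (auto intro!: derivative_eq_intros)
  show "lagk m \<ge> 1" by (rule lagk_ge_1)
  fix \<tau> :: real
  {
    assume \<tau>: "0 < \<tau>"
    then have x: "0 < lagk m * \<tau>" using k by simp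
    show "(lagu m has_real_derivative lagk m * lagud m \<tau>) (at \<tau>)"
      unfolding lagu_def[abs_def] lagud_def
      by (rule DERIV_cong[OF DERIV_chain2[OF lagv_deriv[OF x] chain]]) simp
    show "(lagud m has_real_derivative
        - lagk m * (1 / \<tau> - 1 / 4 + lagc / ((lagk m)\<^sup>2 * \<tau>\<^sup>2)) * lagu m \<tau>) (at \<tau>)"
      unfolding lagu_def lagud_def[abs_def]
      by (rule DERIV_cong[OF DERIV_chain2[OF lagvd_deriv[OF x] chain]])
         (use k \<tau> in \<open>simp add: power_mult_distrib algebra_simps\<close>)
    show "(lagM m has_real_derivative (lagu m \<tau>)\<^sup>2 / \<tau>) (at \<tau>)"
    proof -
      let ?x = "lagk m * \<tau>" and ?R = "resolv (lagP m)"
      have "(lagM m has_real_derivative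
          - ((- lagk m * exp (- ?x) * poly ?R ?x + exp (- ?x) * (poly (pderiv ?R) ?x * lagk m)) / lagT m)) (at \<tau>)"
        unfolding lagM_def[abs_def] using T
        by (auto intro!: derivative_eq_intros DERIV_chain2[OF poly_DERIV chain])
      moreover have "- ((- lagk m * exp (- ?x) * poly ?R ?x + exp (- ?x) * (poly (pderiv ?R) ?x * lagk m)) / lagT m)
        = lagk m * exp (- ?x) * poly (?R - pderiv ?R) ?x / lagT m"
        by (simp add: algebra_simps diff_divide_distrib)
      moreover have "\<dots> = exp (- ?x) * (?x * poly (lagP m) ?x) / lagT m / \<tau>"
        unfolding resolv_diff_pderiv using \<tau> by simp
      moreover have "\<dots> = (lagu m \<tau>)\<^sup>2 / \<tau>"
        unfolding lagP_eq[OF x] lagu_def lagv_def power_divide power_mult_distrib lag_weight_square[OF x]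
        using T by (simp add: mult_ac)
      ultimately show ?thesis by simp
    qed
    show "lagb m \<tau> = \<tau> * ((lagud m \<tau>)\<^sup>2 + (1 / \<tau> - 1 / 4 + lagc / ((lagk m)\<^sup>2 * \<tau>\<^sup>2)) * (lagu m \<tau>)\<^sup>2)
        - lagu m \<tau> * lagud m \<tau> / lagk m"
    proof -
      have "lagb m \<tau> = (exp (- (lagk m * \<tau>)) * poly (lagB m) (lagk m * \<tau>) / lagT m) / lagk m"
        by (simp add: lagb_def)
      then show ?thesis unfolding lagB_eq[OF x] lagu_def lagud_def
        using k \<tau> by (simp add: power_mult_distrib diff_divide_distrib)
    qed
  }
  show "continuous_on {0..} (lagM m)" unfolding lagM_def[abs_def] using T
    by (auto intro!: continuous_intros)
  show "lagM m 0 = 0" using T by (simp add: lagM_def lag_resolv_0)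
  have "((\<lambda>\<tau>. 1 - exp (- (lagk m * \<tau>)) * poly (resolv (lagP m)) (lagk m * \<tau>) / lagT m) \<longlongrightarrow> 1 - 0 / lagT m) at_top"
    using T by (intro tendsto_intros filterlim_compose[OF exp_mult_poly_at_top filterlim_lagk_mult]) auto
  then show "(lagM m \<longlongrightarrow> 1) at_top" by (simp add: lagM_def[abs_def])
  show "continuous_on {0..} (lagb m)" unfolding lagb_def[abs_def] using T k
    by (auto intro!: continuous_intros)
  \<comment> \<open>For \<alpha> > 0 the virial vanishes at 0 through the factor x^\<alpha>. For
    \<alpha> = 0 every term of \<open>lagB\<close> carries a factor \<open>lagY\<close> or x
    instead.\<close>
  have "poly (lagY m) 0 = 0" if "\<alpha> = 0"
    unfolding lagY_def using that by (intro lag_at_0) auto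
  then show "lagb m 0 = 0" unfolding lagb_def lagB_def
    by (cases "\<alpha> = 0") (simp_all add: poly_monom)
  have "((\<lambda>\<tau>. exp (- (lagk m * \<tau>)) * poly (lagB m) (lagk m * \<tau>) / (lagT m * lagk m)) \<longlongrightarrow> 0 / (lagT m * lagk m)) at_top"
    using T k by (intro tendsto_intros filterlim_compose[OF exp_mult_poly_at_top filterlim_lagk_mult]) auto
  then show "(lagb m \<longlongrightarrow> 0) at_top" by (simp add: lagb_def[abs_def])
qed (rule lagk_lim)

text \<open>Passing from \<open>lagY\<close> to the weighted function changes the Wronskian by the
  difference of the logarithmic derivatives \<open>lag_a\<close> of the weight at the two points,
  which vanishes in the bulk limit.\<close>

lemma lag_kernel_off_diag_wronskian:
  assumes "x > 0" "y > 0"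
  shows "(x - y) * (lag_weight x * lag_weight y * lag_kernel \<alpha> m x y)
    = lagv m x * lagvd m y - lagvd m x * lagv m y + \<alpha> / 2 * (1 / x - 1 / y) * lagv m x * lagv m y"
proof -
  have 1: "(x - y) * lag_kernel \<alpha> m x y = (poly (lagY m) x * poly (pderiv (lagY m)) y
     - poly (pderiv (lagY m)) x * poly (lagY m) y) / lagT m"
    unfolding lagY_def lagT_def lag_kernel_off_diag[symmetric] by simp
  have 2: "(wx * p / r) * (wy * (ay * q + q') / r) - (wx * (ax * p + p') / r) * (wy * q / r)
      = wx * wy * ((p * q' - p' * q) / (r * r)) - (ax - ay) * (wx * p / r) * (wy * q / r)"
    if "r \<noteq> 0" for wx wy p q p' q' ax ay r :: real
    using that by (simp add: field_simps)
  have r: "sqrt (lagT m) \<noteq> 0" "sqrt (lagT m) * sqrt (lagT m) = lagT m"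
    using lagT_pos[of m] by (auto simp: less_imp_le)
  have "lag_weight x * lag_weight y * ((x - y) * lag_kernel \<alpha> m x y)
    = lagv m x * lagvd m y - lagvd m x * lagv m y + (lag_a x - lag_a y) * lagv m x * lagv m y"
    unfolding 1 lagv_def lagvd_def 2[OF r(1)] r(2) by simp
  moreover have "lag_a x - lag_a y = \<alpha> / 2 * (1 / x - 1 / y)"
    by (simp add: lag_a_def algebra_simps)
  ultimately show ?thesis by (simp add: mult_ac)
qed

text \<open>On the diagonal the Wronskian degenerates to the energy, up to a term of order v^2 /
  x^2.\<close>

lemma lag_kernel_diag_energy:
  assumes "x > 0"
  shows "lag_weight x * lag_weight x * lag_kernel \<alpha> m x x
    = (lagvd m x)\<^sup>2 + (lagk m / x - 1 / 4 + lagc / x\<^sup>2) * (lagv m x)\<^sup>2 - \<alpha> / 2 * (1 / x\<^sup>2) * (lagv m x)\<^sup>2"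
proof -
  have r: "sqrt (lagT m) \<noteq> 0" "sqrt (lagT m) * sqrt (lagT m) = lagT m"
    using lagT_pos[of m] by (auto simp: less_imp_le)
  have 1: "lag_kernel \<alpha> m x x = ((poly (pderiv (lagY m)) x)\<^sup>2 - poly (lagY m) x * poly (pderiv (pderiv (lagY m))) x)
      / (sqrt (lagT m) * sqrt (lagT m))"
    unfolding r(2) unfolding lagY_def lagT_def lag_kernel_diag[symmetric] by simp
  have 2: "lag_weight x * poly (pderiv (lagY m)) x / sqrt (lagT m) = lagvd m x - lag_a x * lagv m x"
    by (simp add: lagv_def lagvd_def algebra_simps add_divide_distrib)
  have 3: "w * w * ((p\<^sup>2 - q * z) / (r * r)) = (w * p / r)\<^sup>2 - w * q / r * (w * z / r)" for w p q z r :: real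
    by (simp add: power2_eq_square right_diff_distrib diff_divide_distrib mult_ac)
  have "lag_weight x * lag_weight x * lag_kernel \<alpha> m x x
    = (lag_weight x * poly (pderiv (lagY m)) x / sqrt (lagT m))\<^sup>2
      - lagv m x * (lag_weight x * poly (pderiv (pderiv (lagY m))) x / sqrt (lagT m))"
    unfolding 1 lagv_def 3 ..
  then show ?thesis
    unfolding 2 lagvd_second[OF assms] by (simp add: algebra_simps power2_eq_square)
qed

text \<open>Only the ratio X m / m has to converge, so the lemma also serves kernels of index m - i
  around a centre determined by m.\<close>

lemma lag_kernel_bulk_limit:
  assumes \<xi>: "0 < \<xi>" "\<xi> < 4" and X: "(\<lambda>m. X m / real m) \<longlonglongrightarrow> \<xi>"
  defines "\<omega> \<equiv> sqrt (1 / \<xi> - 1 / 4)"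
  shows "(\<lambda>m. lag_weight (X m + s) * lag_weight (X m + t) * lag_kernel \<alpha> m (X m + s) (X m + t))
    \<longlonglongrightarrow> (if s = t then \<omega> / pi else sin (\<omega> * (s - t)) / (pi * (s - t)))"
proof -
  interpret wkb lagk lagc lagu lagud lagM lagb by (rule wkb_laguerre)
  have k_ratio: "(\<lambda>m. lagk m / real m) \<longlonglongrightarrow> 1"
    unfolding lagk_def by real_asymp
  have Xk: "(\<lambda>m. X m / lagk m) \<longlonglongrightarrow> \<xi>"
  proof (rule Lim_transform_eventually)
    show "(\<lambda>m. (X m / real m) / (lagk m / real m)) \<longlonglongrightarrow> \<xi>"
      using tendsto_divide[OF X k_ratio] by simp
    show "\<forall>\<^sub>F m in sequentially. X m / real m / (lagk m / real m) = X m / lagk m"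
      using eventually_gt_at_top[of 0] by eventually_elim auto
  qed
  have at_top: "filterlim (\<lambda>m. X m + z) at_top sequentially" for z
  proof -
    have "filterlim (\<lambda>m. X m / lagk m * lagk m) at_top sequentially"
      by (rule filterlim_tendsto_pos_mult_at_top[OF Xk \<xi>(1) lagk_lim])
    moreover have "X m / lagk m * lagk m = X m" for m using lagk_ge_1[of m] by simp
    ultimately have "filterlim X at_top sequentially" by simp
    then have "filterlim (\<lambda>m. z + X m) at_top sequentially"
      by (rule filterlim_tendsto_add_at_top[OF tendsto_const])
    then show ?thesis by (simp add: add.commute)
  qed
  have pos: "\<forall>\<^sub>F m in sequentially. X m + z > 0" for z
    using at_top[of z] by (simp add: filterlim_at_top_dense)
  have inv: "(\<lambda>m. 1 / (X m + z)) \<longlonglongrightarrow> 0" for z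
    by (rule real_tendsto_divide_at_top[OF tendsto_const at_top])
  have k0: "lagk m \<noteq> 0" for m using lagk_ge_1[of m] by linarith
  note context_facts = \<xi> Xk \<omega>_def[THEN meta_eq_to_obj_eq]
  have v_eq': "v X m z = lagv m (X m + z)" and vd_eq': "vd X m z = lagvd m (X m + z)" for m z
    using k0[of m] by (simp_all add: v_def[OF context_facts] vd_def[OF context_facts] lagu_def lagud_def)
  have Bv: "Bfun (\<lambda>m. lagv m (X m + z)) sequentially" for z
    using v_Bfun(1)[OF context_facts, of z] by (simp add: v_eq')
  have Zmul: "Zfun (\<lambda>n. f n * g n) sequentially" if "Zfun f sequentially" "Bfun g sequentially" for f g :: "nat \<Rightarrow> real"
    using bounded_bilinear.Zfun_prod_Bfun[OF bounded_bilinear_mult] that by blast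
  show ?thesis
  proof (cases "s = t")
    case False
    have "(\<lambda>m. \<alpha> / 2 * (1 / (X m + s) - 1 / (X m + t))) \<longlonglongrightarrow> \<alpha> / 2 * (0 - 0)"
      by (intro tendsto_intros inv)
    then have "Zfun (\<lambda>m. \<alpha> / 2 * (1 / (X m + s) - 1 / (X m + t))) sequentially"
      by (simp add: tendsto_Zfun_iff)
    from Zmul[OF Zmul[OF this Bv] Bv]
    have "Zfun (\<lambda>m. \<alpha> / 2 * (1 / (X m + s) - 1 / (X m + t)) * lagv m (X m + s) * lagv m (X m + t)) sequentially" .
    then have "(\<lambda>m. \<alpha> / 2 * (1 / (X m + s) - 1 / (X m + t)) * lagv m (X m + s) * lagv m (X m + t)) \<longlonglongrightarrow> 0"
      by (simp add: tendsto_Zfun_iff)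
    from tendsto_add[OF local_wronskian[OF context_facts, of s t] this]
    have "(\<lambda>m. (lagv m (X m + s) * lagvd m (X m + t) - lagvd m (X m + s) * lagv m (X m + t)
       + \<alpha> / 2 * (1 / (X m + s) - 1 / (X m + t)) * lagv m (X m + s) * lagv m (X m + t)) / (s - t))
       \<longlonglongrightarrow> sin (\<omega> * (s - t)) / pi / (s - t)"
      using False by (intro tendsto_divide) (simp_all add: v_eq' vd_eq')
    moreover have "\<forall>\<^sub>F m in sequentially. (lagv m (X m + s) * lagvd m (X m + t) - lagvd m (X m + s) * lagv m (X m + t)
       + \<alpha> / 2 * (1 / (X m + s) - 1 / (X m + t)) * lagv m (X m + s) * lagv m (X m + t)) / (s - t)
       = lag_weight (X m + s) * lag_weight (X m + t) * lag_kernel \<alpha> m (X m + s) (X m + t)"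
      using pos[of s] pos[of t]
    proof eventually_elim
      case (elim m)
      show ?case
        unfolding lag_kernel_off_diag_wronskian[OF elim, symmetric] using False by simp
    qed
    ultimately show ?thesis using False by (auto dest: Lim_transform_eventually)
  next
    case True
    have "(\<lambda>m. \<alpha> / 2 * (1 / (X m + t) * (1 / (X m + t)))) \<longlonglongrightarrow> \<alpha> / 2 * (0 * 0)"
      by (intro tendsto_intros inv)
    then have "Zfun (\<lambda>m. \<alpha> / 2 * (1 / (X m + t)\<^sup>2)) sequentially"
      by (simp add: tendsto_Zfun_iff power2_eq_square)
    then have "Zfun (\<lambda>m. \<alpha> / 2 * (1 / (X m + t)\<^sup>2) * lagv m (X m + t) * lagv m (X m + t)) sequentially"
      by (rule Zmul[OF Zmul[OF _ Bv] Bv])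
    then have "(\<lambda>m. \<alpha> / 2 * (1 / (X m + t)\<^sup>2) * (lagv m (X m + t))\<^sup>2) \<longlonglongrightarrow> 0"
      by (simp add: tendsto_Zfun_iff power2_eq_square mult.assoc)
    from tendsto_diff[OF local_energy[OF context_facts, of t] this]
    have "(\<lambda>m. (lagvd m (X m + t))\<^sup>2 + (lagk m / (X m + t) - 1 / 4 + lagc / (X m + t)\<^sup>2) * (lagv m (X m + t))\<^sup>2
       - \<alpha> / 2 * (1 / (X m + t)\<^sup>2) * (lagv m (X m + t))\<^sup>2) \<longlonglongrightarrow> \<omega> / pi"
      using k0 by (simp add: v_eq' vd_eq' W_def[OF context_facts] power_divide)
    moreover have "\<forall>\<^sub>F m in sequentially. (lagvd m (X m + t))\<^sup>2
       + (lagk m / (X m + t) - 1 / 4 + lagc / (X m + t)\<^sup>2) * (lagv m (X m + t))\<^sup>2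
       - \<alpha> / 2 * (1 / (X m + t)\<^sup>2) * (lagv m (X m + t))\<^sup>2
       = lag_weight (X m + t) * lag_weight (X m + t) * lag_kernel \<alpha> m (X m + t) (X m + t)"
      using pos[of t] by eventually_elim (simp only: lag_kernel_diag_energy)
    ultimately show ?thesis using True by (auto dest: Lim_transform_eventually)
  qed
qed

end

section \<open>Summation over the index of the kernel\<close>

lemma lag_kernel_diag_mono:
  assumes "j \<le> m"
  shows "lag_kernel \<alpha> j x x \<le> lag_kernel \<alpha> m x x"
  unfolding lag_kernel_def using assms
  by (intro sum_mono2) (auto intro!: divide_nonneg_pos mult_pos_pos)

text \<open>The inequality of the arithmetic and geometric means, applied to each summand of the
  kernel.\<close>

lemma lag_kernel_le_diag:
  "2 * \<bar>v * w * lag_kernel \<alpha> m x y\<bar> \<le> v * v * lag_kernel \<alpha> m x x + w * w * lag_kernel \<alpha> m y y"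
proof -
  let ?q = "\<lambda>j. poly (lag (j + \<alpha>) j)" and ?F = "\<lambda>j. fact (j + \<alpha>) * fact j :: real"
  have term_le: "2 * \<bar>(v * ?q j x) * (w * ?q j y) / ?F j\<bar> \<le> (v * ?q j x)\<^sup>2 / ?F j + (w * ?q j y)\<^sup>2 / ?F j" for j
  proof -
    have "2 * \<bar>(v * ?q j x) * (w * ?q j y)\<bar> \<le> (v * ?q j x)\<^sup>2 + (w * ?q j y)\<^sup>2"
      using sum_squares_bound[of "\<bar>v * ?q j x\<bar>" "\<bar>w * ?q j y\<bar>"] by (simp add: abs_mult power_mult_distrib)
    then have "2 * \<bar>(v * ?q j x) * (w * ?q j y)\<bar> / ?F j \<le> ((v * ?q j x)\<^sup>2 + (w * ?q j y)\<^sup>2) / ?F j"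
      by (intro divide_right_mono) auto
    then show ?thesis by (simp add: add_divide_distrib)
  qed
  have "2 * \<bar>v * w * lag_kernel \<alpha> m x y\<bar> = 2 * \<bar>\<Sum>j\<le>m. (v * ?q j x) * (w * ?q j y) / ?F j\<bar>"
    by (simp add: lag_kernel_def sum_distrib_left mult_ac)
  also have "\<dots> \<le> (\<Sum>j\<le>m. 2 * \<bar>(v * ?q j x) * (w * ?q j y) / ?F j\<bar>)"
    unfolding sum_distrib_left[symmetric] by (intro mult_left_mono sum_abs) simp
  also have "\<dots> \<le> (\<Sum>j\<le>m. (v * ?q j x)\<^sup>2 / ?F j + (w * ?q j y)\<^sup>2 / ?F j)"
    by (intro sum_mono term_le)
  also have "\<dots> = v * v * lag_kernel \<alpha> m x x + w * w * lag_kernel \<alpha> m y y"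
    by (simp add: lag_kernel_def sum.distrib sum_distrib_left power2_eq_square mult_ac)
  finally show ?thesis .
qed

text \<open>For fixed i an offset of the index turns m - i into m and moves the centre by i \<xi>,
  which does not affect the limit of X m / m. So all kernels have the same limit, and Tannery's
  theorem leaves the exponential series.\<close>

lemma lag_kernel_exponential_sum_limit:
  fixes \<xi> s t \<kappa> :: real and \<alpha> :: nat
  assumes \<xi>: "0 < \<xi>" "\<xi> < 4"
  defines "\<omega> \<equiv> sqrt (1 / \<xi> - 1 / 4)" and "X \<equiv> \<lambda>m. real (m + \<alpha>) * \<xi>"
  shows "(\<lambda>m. lag_weight \<alpha> (X m + s) * lag_weight \<alpha> (X m + t) *
      (\<Sum>i\<le>m. \<kappa> ^ i / fact i * lag_kernel \<alpha> (m - i) (X m + s) (X m + t)))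
    \<longlonglongrightarrow> exp \<kappa> * (if s = t then \<omega> / pi else sin (\<omega> * (s - t)) / (pi * (s - t)))"
proof -
  let ?W = "\<lambda>m s. lag_weight \<alpha> (X m + s)"
  let ?S = "if s = t then \<omega> / pi else sin (\<omega> * (s - t)) / (pi * (s - t))"
  define a where "a i m = (if i \<le> m then \<kappa> ^ i / fact i *
      (?W m s * ?W m t * lag_kernel \<alpha> (m - i) (X m + s) (X m + t)) else 0)" for i m
  have shifted: "(\<lambda>m. lag_weight \<alpha> (X (m + i) + s) * lag_weight \<alpha> (X (m + i) + t) *
      lag_kernel \<alpha> m (X (m + i) + s) (X (m + i) + t)) \<longlonglongrightarrow>
      (if s = t then \<omega> / pi else sin (\<omega> * (s - t)) / (pi * (s - t)))" for i s t
    unfolding \<omega>_def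
  proof (rule lag_kernel_bulk_limit[OF \<xi>])
    show "(\<lambda>m. X (m + i) / real m) \<longlonglongrightarrow> \<xi>"
      unfolding X_def by real_asymp
  qed
  have lim: "(\<lambda>m. a i m) \<longlonglongrightarrow> \<kappa> ^ i / fact i * ?S" for i
  proof (rule LIMSEQ_offset[where k = i])
    show "(\<lambda>m. a i (m + i)) \<longlonglongrightarrow> \<kappa> ^ i / fact i * ?S"
      using tendsto_mult_left[OF shifted[of i s t], of "\<kappa> ^ i / fact i"] by (simp add: a_def)
  qed
  have diag: "(\<lambda>m. ?W m s * ?W m s * lag_kernel \<alpha> m (X m + s) (X m + s)) \<longlonglongrightarrow> \<omega> / pi" for s
    using shifted[where i = 0 and s = s and t = s] by simp
  \<comment> \<open>Strictly above the limit of the weighted diagonal kernel, hence eventually an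
    upper bound for it at both points.\<close>
  define C where "C = \<omega> / pi + 1"
  have ev: "\<forall>\<^sub>F m in sequentially. ?W m s * ?W m s * lag_kernel \<alpha> m (X m + s) (X m + s) \<le> C" for s
    using order_tendstoD(2)[OF diag[of s], of C] by (auto simp: C_def elim!: eventually_mono)
  have bound: "\<forall>\<^sub>F m in sequentially. \<forall>i. norm (a i m) \<le> C * (\<bar>\<kappa>\<bar> ^ i / fact i)"
    using ev[of s] ev[of t]
  proof eventually_elim
    case (elim m)
    show ?case
    proof
      fix i
      have C0: "0 \<le> C"
        using wkb_U_pos[OF \<xi>] by (simp add: C_def \<omega>_def)
      show "norm (a i m) \<le> C * (\<bar>\<kappa>\<bar> ^ i / fact i)"
      proof (cases "i \<le> m")
        case True
        let ?K = "?W m s * ?W m t * lag_kernel \<alpha> (m - i) (X m + s) (X m + t)"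
        have "?W m s * ?W m s * lag_kernel \<alpha> (m - i) (X m + s) (X m + s) \<le> C"
          "?W m t * ?W m t * lag_kernel \<alpha> (m - i) (X m + t) (X m + t) \<le> C"
          by (rule order_trans[OF mult_left_mono[OF lag_kernel_diag_mono[of "m - i" m]] elim(1)]; simp)
             (rule order_trans[OF mult_left_mono[OF lag_kernel_diag_mono[of "m - i" m]] elim(2)]; simp)
        then have "\<bar>?K\<bar> \<le> C"
          using lag_kernel_le_diag[of "?W m s" "?W m t" \<alpha> "m - i" "X m + s" "X m + t"] by linarith
        then have "\<bar>\<kappa>\<bar> ^ i / fact i * \<bar>?K\<bar> \<le> \<bar>\<kappa>\<bar> ^ i / fact i * C"
          by (intro mult_left_mono) auto
        then show ?thesis using True by (simp add: a_def abs_mult power_abs mult_ac)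
      qed (use C0 in \<open>simp add: a_def\<close>)
    qed
  qed
  have summable: "summable (\<lambda>i. \<bar>\<kappa>\<bar> ^ i / fact i)"
    using summable_exp[of "\<bar>\<kappa>\<bar>"] by (simp add: divide_inverse mult.commute)
  have "(\<lambda>m. suminf (\<lambda>i. a i m)) \<longlonglongrightarrow> (\<Sum>i. \<kappa> ^ i / fact i * ?S)"
  proof (rule tannerys_theorem[THEN conjunct2, THEN conjunct2, OF lim])
    have "\<forall>\<^sub>F x in at_top \<times>\<^sub>F sequentially. True \<and> (\<forall>i. norm (a i (snd x)) \<le> C * (\<bar>\<kappa>\<bar> ^ i / fact i))"
      by (intro eventually_prodI bound) simp
    then show "\<forall>\<^sub>F (i, m) in at_top \<times>\<^sub>F sequentially. norm (a i m) \<le> C * (\<bar>\<kappa>\<bar> ^ i / fact i)"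
      by eventually_elim auto
    show "summable (\<lambda>i. C * (\<bar>\<kappa>\<bar> ^ i / fact i))"
      using summable by (rule summable_mult)
  qed simp
  also have "(\<Sum>i. \<kappa> ^ i / fact i * ?S) = exp \<kappa> * ?S"
  proof -
    have "(\<lambda>i. \<kappa> ^ i / fact i) sums exp \<kappa>"
      using exp_converges[of \<kappa>] by (simp add: divide_inverse mult.commute)
    from sums_mult2[OF this, of ?S] show ?thesis by (simp add: sums_iff)
  qed
  also have "(\<lambda>m. suminf (\<lambda>i. a i m)) = (\<lambda>m. ?W m s * ?W m t *
      (\<Sum>i\<le>m. \<kappa> ^ i / fact i * lag_kernel \<alpha> (m - i) (X m + s) (X m + t)))"
  proof
    fix m
    have "suminf (\<lambda>i. a i m) = (\<Sum>i\<le>m. a i m)"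
      by (rule suminf_finite) (auto simp: a_def)
    then show "suminf (\<lambda>i. a i m) = ?W m s * ?W m t *
      (\<Sum>i\<le>m. \<kappa> ^ i / fact i * lag_kernel \<alpha> (m - i) (X m + s) (X m + t))"
      by (simp add: a_def sum_distrib_left mult_ac)
  qed
  finally show ?thesis .
qed

text \<open>The base of the power is (N \<xi> + s) (N \<xi> + t), so the prefactor splits into one
  weight for each variable.\<close>

lemma Z_factor_eq:
  assumes "real N * \<xi> + s > 0" "real N * \<xi> + t > 0"
  shows "Z_factor \<alpha> N \<xi> s t = lag_weight \<alpha> (real N * \<xi> + s) * lag_weight \<alpha> (real N * \<xi> + t)"
proof -
  let ?x = "real N * \<xi> + s" and ?y = "real N * \<xi> + t"
  have e: "(real N)\<^sup>2 * \<xi>\<^sup>2 + real N * \<xi> * (s + t) + s * t = ?x * ?y"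
    by (simp add: power2_eq_square algebra_simps)
  have "Z_factor \<alpha> N \<xi> s t = exp (\<alpha> / 2 * ln (?x * ?y)) * exp (- real N * \<xi> - (s + t) / 2)"
    unfolding Z_factor_def e using assms by (simp add: powr_def)
  also have "ln (?x * ?y) = ln ?x + ln ?y" using assms by (simp add: ln_mult)
  finally show ?thesis
    unfolding lag_weight_def by (simp add: mult_exp_exp algebra_simps add_divide_distrib)
qed

lemma marchenko_pastur_density_eq:
  assumes "0 < \<xi>" "\<xi> < 4"
  shows "marchenko_pastur_density \<xi> = sqrt (1 / \<xi> - 1 / 4) / pi" "marchenko_pastur_density \<xi> > 0"
proof -
  have "\<xi> * (4 - \<xi>) = (2 * \<xi>)\<^sup>2 * (1 / \<xi> - 1 / 4)"
    using assms by (simp add: power2_eq_square field_simps)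
  then have "sqrt (\<xi> * (4 - \<xi>)) = 2 * \<xi> * sqrt (1 / \<xi> - 1 / 4)"
    using assms by (simp add: real_sqrt_mult)
  then show eq: "marchenko_pastur_density \<xi> = sqrt (1 / \<xi> - 1 / 4) / pi"
    using assms by (simp add: marchenko_pastur_density_def)
  show "marchenko_pastur_density \<xi> > 0"
    unfolding eq using wkb_U_pos[OF assms] by simp
qed

section \<open>Gram matrices under addition of a row\<close>

text \<open>Both sides are the determinant of \<open>A\<close> bordered by the column \<open>a\<close>, the row \<open>- c\<close> and the corner entry \<open>1\<close>.\<close>

lemma det_rank_one_update:
  fixes A :: "'a :: idom mat"
  assumes A: "A \<in> carrier_mat n n"
  shows "Determinant.det (A + mat n n (\<lambda>(i, j). a i * c j))
    = Determinant.det A + (\<Sum>k<n. \<Sum>j<n. c k * adj_mat A $$ (k, j) * a j)"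
proof (cases n)
  case 0
  then show ?thesis using A by simp
next
  case (Suc n')
  let ?N = "Suc n"
  define B where "B = mat ?N ?N (\<lambda>(i, j). if i < n then (if j < n then A $$ (i, j) else a i)
     else (if j < n then - c j else 1))"
  define L where "L = mat ?N ?N (\<lambda>(i, j). if i = j then 1 else if i = n then c j else 0)"
  have B: "B \<in> carrier_mat ?N ?N" and L: "L \<in> carrier_mat ?N ?N" by (auto simp: B_def L_def)
  have detL: "Determinant.det L = 1"
  proof -
    have "Determinant.det L = prod_list (diag_mat L)"
      by (rule det_lower_triangular[OF _ L]) (auto simp: L_def)
    also have "diag_mat L = map (\<lambda>_. 1) [0..<?N]"
      unfolding diag_mat_def by (rule map_cong) (auto simp: L_def)
    finally show ?thesis by (simp only: map_replicate_const prod_list_replicate power_one)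
  qed
  \<comment> \<open>Right multiplication by \<open>L\<close> adds c j times the last column to
    column j: this clears the last row and adds a i * c j to the block \<open>A\<close>.\<close>
  have BL: "B * L = four_block_mat (A + mat n n (\<lambda>(i, j). a i * c j)) (mat n 1 (\<lambda>(i, j). a i)) (0\<^sub>m 1 n) (1\<^sub>m 1)"
    (is "_ = ?R")
  proof (rule eq_matI)
    fix i j assume ij: "i < dim_row ?R" "j < dim_col ?R"
    then have ij: "i < ?N" "j < ?N" using A by auto
    have "(B * L) $$ (i, j) = (\<Sum>l<?N. B $$ (i, l) * L $$ (l, j))"
      using ij B L by (simp add: scalar_prod_def atLeast0LessThan)
    also have "\<dots> = (\<Sum>l<n. B $$ (i, l) * L $$ (l, j)) + B $$ (i, n) * L $$ (n, j)"
      by simp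
    also have "(\<Sum>l<n. B $$ (i, l) * L $$ (l, j)) = (\<Sum>l<n. B $$ (i, l) * (if l = j then 1 else 0))"
      by (rule sum.cong) (use ij in \<open>auto simp: L_def\<close>)
    also have "(\<Sum>l<n. B $$ (i, l) * (if l = j then 1 else 0)) = (if j < n then B $$ (i, j) else 0)"
      by (simp add: if_distrib[of "\<lambda>x. _ * x"] sum.delta' cong: if_cong)
    finally show "(B * L) $$ (i, j) = ?R $$ (i, j)"
      using ij A by (auto simp: B_def L_def)
  qed (use B L A in auto)
  have "Determinant.det B = Determinant.det (B * L)"
    using det_mult[OF B L] detL by simp
  also have "\<dots> = Determinant.det (A + mat n n (\<lambda>(i, j). a i * c j))"
    unfolding BL using A by (subst det_four_block_mat_lower_left_zero[of _ n _ 1]) auto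
  finally have 1: "Determinant.det (A + mat n n (\<lambda>(i, j). a i * c j)) = Determinant.det B" ..
  \<comment> \<open>The second evaluation expands along the bordering row and then each minor along
    the bordering column, which after the deletion is column \<open>n'\<close>.\<close>
  have "Determinant.det B = (\<Sum>k<?N. B $$ (n, k) * cofactor B n k)"
    by (rule laplace_expansion_row[OF B]) simp
  also have "\<dots> = (\<Sum>k<n. - c k * cofactor B n k) + cofactor B n n"
    by (simp add: B_def)
  also have "cofactor B n n = Determinant.det A"
  proof -
    have "mat_delete B n n = A"
      by (rule eq_matI) (use A in \<open>auto simp: mat_delete_def B_def\<close>)
    then show ?thesis by (simp add: cofactor_def power_add[symmetric] mult_2[symmetric])
  qed
  also have "(\<Sum>k<n. - c k * cofactor B n k) = (\<Sum>k<n. \<Sum>j<n. c k * adj_mat A $$ (k, j) * a j)"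
  proof (rule sum.cong[OF refl])
    fix k assume "k \<in> {..<n}"
    then have k: "k < n" by simp
    define B' where "B' = mat_delete B n k"
    have B': "B' \<in> carrier_mat n n" using mat_delete_carrier[OF B, of n k] by (simp add: B'_def)
    have "Determinant.det B' = (\<Sum>j<n. B' $$ (j, n') * cofactor B' j n')"
      by (rule laplace_expansion_column[OF B']) (simp add: Suc)
    also have "\<dots> = (\<Sum>j<n. a j * ((-1) ^ (j + n') * Determinant.det (mat_delete A j k)))"
    proof (rule sum.cong[OF refl])
      fix j assume "j \<in> {..<n}"
      then have j: "j < n" by simp
      have "mat_delete B' j n' = mat_delete A j k"
        by (rule eq_matI) (use A B' j k Suc in \<open>auto simp: mat_delete_def B'_def B_def\<close>)
      moreover have "B' $$ (j, n') = a j"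
        using j k Suc by (auto simp: B'_def mat_delete_def B_def)
      ultimately show "B' $$ (j, n') * cofactor B' j n' = a j * ((-1) ^ (j + n') * Determinant.det (mat_delete A j k))"
        by (simp add: cofactor_def)
    qed
    finally have "cofactor B n k = (\<Sum>j<n. (-1) ^ (n + k) * (a j * ((-1) ^ (j + n') * Determinant.det (mat_delete A j k))))"
      by (simp add: cofactor_def B'_def[symmetric] sum_distrib_left)
    then have "- c k * cofactor B n k = (\<Sum>j<n. - c k * ((-1) ^ (n + k) * (a j * ((-1) ^ (j + n') * Determinant.det (mat_delete A j k)))))"
      by (simp only: sum_distrib_left)
    also have "\<dots> = (\<Sum>j<n. c k * adj_mat A $$ (k, j) * a j)"
    proof (rule sum.cong[OF refl])
      fix j assume "j \<in> {..<n}"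
      then have "adj_mat A $$ (k, j) = (-1) ^ (j + k) * Determinant.det (mat_delete A j k)"
        using A k by (simp add: adj_mat_def cofactor_def)
      moreover have "(-1::'a) ^ (n + k) * (-1) ^ (j + n') = - ((-1) ^ (j + k))"
      proof -
        have "(-1::'a) ^ (n + k) * (-1) ^ (j + n') = - ((-1) ^ n' * (-1) ^ n' * (-1) ^ (j + k))"
          unfolding Suc power_add power_Suc by (simp only: mult_ac mult_minus_left mult_minus_right mult_1_left)
        then show ?thesis by (simp only: minus_one_mult_self mult_1_left)
      qed
      moreover have "- c k * (s * (a j * (s' * d))) = - (s * s') * (c k * d * a j)" for s s' d
        by (simp add: mult_ac)
      ultimately show "- c k * ((-1) ^ (n + k) * (a j * ((-1) ^ (j + n') * Determinant.det (mat_delete A j k))))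
         = c k * adj_mat A $$ (k, j) * a j"
        by (simp only: minus_minus) (simp only: mult_ac)
    qed
    finally show "- c k * cofactor B n k = (\<Sum>j<n. c k * adj_mat A $$ (k, j) * a j)" .
  qed
  finally show ?thesis using 1 by simp
qed

text \<open>The matrix is given by its entries as a function on index pairs: forgetting the last row
  changes only \<open>n\<close>, and deleting a column is a reindexing.\<close>

definition gram :: "nat \<Rightarrow> nat \<Rightarrow> (nat \<times> nat \<Rightarrow> complex) \<Rightarrow> complex mat" where
  "gram n m z = mat m m (\<lambda>(j, k). \<Sum>l<n. cnj (z (l, j)) * z (l, k))"

definition shifted_gram :: "nat \<Rightarrow> nat \<Rightarrow> complex \<Rightarrow> (nat \<times> nat \<Rightarrow> complex) \<Rightarrow> complex mat" where
  "shifted_gram n m \<mu> z = gram n m z - \<mu> \<cdot>\<^sub>m 1\<^sub>m m"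

definition delete_column :: "nat \<Rightarrow> (nat \<times> nat \<Rightarrow> 'b) \<Rightarrow> nat \<times> nat \<Rightarrow> 'b" where
  "delete_column j z = (\<lambda>(l, k). z (l, if k < j then k else Suc k))"

definition gram_det :: "nat \<Rightarrow> nat \<Rightarrow> complex \<Rightarrow> (nat \<times> nat \<Rightarrow> complex) \<Rightarrow> complex" where
  "gram_det n m \<mu> z = Determinant.det (shifted_gram n m \<mu> z)"

definition gram_adj :: "nat \<Rightarrow> nat \<Rightarrow> complex \<Rightarrow> nat \<Rightarrow> nat \<Rightarrow> (nat \<times> nat \<Rightarrow> complex) \<Rightarrow> complex" where
  "gram_adj n m \<mu> k j z = adj_mat (shifted_gram n m \<mu> z) $$ (k, j)"

lemma gram_carrier: "gram n m z \<in> carrier_mat m m"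
  and shifted_gram_carrier: "shifted_gram n m \<mu> z \<in> carrier_mat m m"
  by (auto simp: gram_def shifted_gram_def)

lemma gram_det_Suc:
  "gram_det (Suc n) m \<mu> z = gram_det n m \<mu> z
     + (\<Sum>k<m. \<Sum>j<m. gram_adj n m \<mu> k j z * (z (n, k) * cnj (z (n, j))))"
proof -
  have "shifted_gram (Suc n) m \<mu> z = shifted_gram n m \<mu> z + mat m m (\<lambda>(i, j). cnj (z (n, i)) * z (n, j))"
    by (rule eq_matI) (auto simp: shifted_gram_def gram_def)
  then show ?thesis
    using det_rank_one_update[OF shifted_gram_carrier, of n m \<mu> z "\<lambda>i. cnj (z (n, i))" "\<lambda>j. z (n, j)"]
    by (simp add: gram_det_def gram_adj_def mult_ac)
qed

text \<open>Removing row j and column j of a Gram matrix amounts to removing column j of the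
  underlying matrix.\<close>

lemma gram_adj_diag:
  assumes "j < m"
  shows "gram_adj n m \<mu> j j z = gram_det n (m - 1) \<mu> (delete_column j z)"
proof -
  have "mat_delete (shifted_gram n m \<mu> z) j j = shifted_gram n (m - 1) \<mu> (delete_column j z)"
    using assms by (intro eq_matI) (auto simp: mat_delete_def shifted_gram_def gram_def delete_column_def)
  then show ?thesis
    using assms shifted_gram_carrier[of n m \<mu> z]
    by (simp add: gram_adj_def adj_mat_def cofactor_def gram_det_def mult_2[symmetric] power_add[symmetric])
qed

definition gram_charpoly :: "nat \<Rightarrow> nat \<Rightarrow> (nat \<times> nat \<Rightarrow> complex) \<Rightarrow> complex poly" where
  "gram_charpoly n m z = char_poly (gram n m z)"

lemma gram_det_eq_charpoly: "gram_det n m \<mu> z = (- 1) ^ m * poly (gram_charpoly n m z) \<mu>"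
proof -
  have c: "- shifted_gram n m \<mu> z = - (char_matrix (gram n m z) \<mu>)"
    by (rule eq_matI) (auto simp: shifted_gram_def char_matrix_def gram_def)
  have "poly (gram_charpoly n m z) \<mu> = Determinant.det (- shifted_gram n m \<mu> z)"
    unfolding gram_charpoly_def char_poly_matrix[OF gram_carrier] c ..
  also have "- shifted_gram n m \<mu> z = (- 1) \<cdot>\<^sub>m shifted_gram n m \<mu> z"
    by (rule eq_matI) auto
  also have "Determinant.det \<dots> = (- 1) ^ m * gram_det n m \<mu> z"
    using shifted_gram_carrier[of n m \<mu> z] by (simp add: gram_det_def)
  finally show ?thesis by (simp add: mult.assoc[symmetric] power_mult_distrib[symmetric])
qed

lemma degree_gram_charpoly: "degree (gram_charpoly n m z) = m"
  using degree_monic_char_poly[OF gram_carrier] by (simp add: gram_charpoly_def)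

lemma pderiv_gram_charpoly:
  "pderiv (gram_charpoly n m z) = (\<Sum>j<m. gram_charpoly n (m - 1) (delete_column j z))"
proof -
  have "mat_delete (gram n m z) j j = gram n (m - 1) (delete_column j z)" if "j < m" for j
    using that by (intro eq_matI) (auto simp: mat_delete_def gram_def delete_column_def)
  then show ?thesis
    unfolding gram_charpoly_def pderiv_char_poly[OF gram_carrier] by (intro sum.cong) auto
qed

text \<open>Jacobi's formula: the trace of the adjugate is minus the derivative of the determinant
  in \<mu>. For m = 0 the truncated exponent is harmless, as the derivative is an empty sum.\<close>

lemma gram_adj_trace:
  "(\<Sum>j<m. gram_adj n m \<mu> j j z) = - ((- 1) ^ m * poly (pderiv (gram_charpoly n m z)) \<mu>)"
proof -
  have "(\<Sum>j<m. gram_adj n m \<mu> j j z) = (\<Sum>j<m. (- 1) ^ (m - 1) * poly (gram_charpoly n (m - 1) (delete_column j z)) \<mu>)"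
    by (intro sum.cong refl) (simp add: gram_adj_diag gram_det_eq_charpoly)
  also have "\<dots> = (- 1) ^ (m - 1) * poly (pderiv (gram_charpoly n m z)) \<mu>"
    by (simp add: pderiv_gram_charpoly poly_sum sum_distrib_left)
  also have "\<dots> = - ((- 1) ^ m * poly (pderiv (gram_charpoly n m z)) \<mu>)"
    using pderiv_gram_charpoly[of n m z] by (cases m) auto
  finally show ?thesis .
qed

text \<open>With A and B the matrices shifted by \<mu> and \<nu>, and P and R their adjugates,
  evaluate P (B - A) R in two ways and take traces. In terms of adjugates the resolvent identity
  holds also where A or B is singular.\<close>

lemma gram_adj_resolvent:
  "(\<mu> - \<nu>) * (\<Sum>k<m. \<Sum>j<m. gram_adj n m \<mu> k j z * gram_adj n m \<nu> j k z)
   = gram_det n m \<nu> z * (\<Sum>j<m. gram_adj n m \<mu> j j z) - gram_det n m \<mu> z * (\<Sum>j<m. gram_adj n m \<nu> j j z)"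
proof -
  let ?A = "shifted_gram n m \<mu> z" and ?B = "shifted_gram n m \<nu> z"
  let ?P = "adj_mat ?A" and ?R = "adj_mat ?B"
  note c = shifted_gram_carrier[of n m \<mu> z] shifted_gram_carrier[of n m \<nu> z]
    adj_mat(1)[OF shifted_gram_carrier[of n m \<mu> z]] adj_mat(1)[OF shifted_gram_carrier[of n m \<nu> z]]
  have d: "?B - ?A = (\<mu> - \<nu>) \<cdot>\<^sub>m 1\<^sub>m m"
    by (rule eq_matI) (auto simp: shifted_gram_def gram_def)
  have "(\<mu> - \<nu>) \<cdot>\<^sub>m (?P * ?R) = ?P * ((\<mu> - \<nu>) \<cdot>\<^sub>m 1\<^sub>m m) * ?R"
    by (simp only: mult_smult_distrib[OF c(3) one_carrier_mat] right_mult_one_mat[OF c(3)] mult_smult_assoc_mat[OF c(3,4)])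
  also have "\<dots> = (?P * ?B - ?P * ?A) * ?R"
    unfolding d[symmetric] by (simp only: mult_minus_distrib_mat[OF c(3,2,1)])
  also have "\<dots> = ?P * ?B * ?R - ?P * ?A * ?R"
    by (rule minus_mult_distrib_mat[OF mult_carrier_mat[OF c(3,2)] mult_carrier_mat[OF c(3,1)] c(4)])
  also have "?P * ?B * ?R = Determinant.det ?B \<cdot>\<^sub>m ?P"
    by (simp only: assoc_mult_mat[OF c(3,2,4)] adj_mat(2)[OF c(2)] mult_smult_distrib[OF c(3) one_carrier_mat]
        right_mult_one_mat[OF c(3)])
  also have "?P * ?A * ?R = Determinant.det ?A \<cdot>\<^sub>m ?R"
    by (simp only: adj_mat(3)[OF c(1)] mult_smult_assoc_mat[OF one_carrier_mat c(4)] left_mult_one_mat[OF c(4)])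
  finally have eq: "(\<mu> - \<nu>) \<cdot>\<^sub>m (?P * ?R) = Determinant.det ?B \<cdot>\<^sub>m ?P - Determinant.det ?A \<cdot>\<^sub>m ?R" .
  have "(\<mu> - \<nu>) * (\<Sum>j<m. ?P $$ (k, j) * ?R $$ (j, k))
     = Determinant.det ?B * ?P $$ (k, k) - Determinant.det ?A * ?R $$ (k, k)" if k: "k < m" for k
  proof -
    have "((\<mu> - \<nu>) \<cdot>\<^sub>m (?P * ?R)) $$ (k, k) = (Determinant.det ?B \<cdot>\<^sub>m ?P - Determinant.det ?A \<cdot>\<^sub>m ?R) $$ (k, k)"
      by (simp only: eq)
    moreover have "((\<mu> - \<nu>) \<cdot>\<^sub>m (?P * ?R)) $$ (k, k) = (\<mu> - \<nu>) * (\<Sum>j<m. ?P $$ (k, j) * ?R $$ (j, k))"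
      using c(3,4) k by (simp add: scalar_prod_def atLeast0LessThan)
    moreover have "(Determinant.det ?B \<cdot>\<^sub>m ?P - Determinant.det ?A \<cdot>\<^sub>m ?R) $$ (k, k)
        = Determinant.det ?B * ?P $$ (k, k) - Determinant.det ?A * ?R $$ (k, k)"
      using c(3,4) k by simp
    ultimately show ?thesis by simp
  qed
  then show ?thesis
    by (simp add: gram_adj_def gram_det_def sum_distrib_left sum_subtractf[symmetric])
qed

section \<open>Moments of random Gram determinants\<close>

text \<open>Random variables with independent entries and finite fourth moments allow the exponent \<open>4\<close> in each variable,
  hence \<open>2\<close> in each of the two determinants.\<close>

definition dominated :: "'i set \<Rightarrow> nat \<Rightarrow> (('i \<Rightarrow> complex) \<Rightarrow> complex) \<Rightarrow> bool" where
  "dominated J e U \<longleftrightarrow> U \<in> borel_measurable (PiM J (\<lambda>_. borel)) \<and> (\<forall>z. U (restrict z J) = U z) \<and>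
     (\<exists>C\<ge>0. \<forall>z. norm (U z) \<le> C * (\<Prod>i\<in>J. (1 + norm (z i)) ^ e))"

lemma prod_weight_ge_1: "1 \<le> (\<Prod>i\<in>J. (1 + norm (z i :: complex)) ^ e)"
  by (rule prod_ge_1) simp

lemma dominated_mono:
  assumes "dominated J e U" "e \<le> e'"
  shows "dominated J e' U"
proof -
  obtain C where C: "C \<ge> 0" "\<And>z. norm (U z) \<le> C * (\<Prod>i\<in>J. (1 + norm (z i)) ^ e)"
    using assms(1) by (auto simp: dominated_def)
  have "norm (U z) \<le> C * (\<Prod>i\<in>J. (1 + norm (z i)) ^ e')" for z
    by (rule order_trans[OF C(2)]) (intro mult_left_mono C(1) prod_mono conjI power_increasing assms(2); simp)
  then show ?thesis using assms(1) C(1) by (auto simp: dominated_def)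
qed

lemma dominated_const: "dominated J e (\<lambda>_. c)"
proof -
  have "norm c \<le> norm c * (\<Prod>i\<in>J. (1 + norm (z i :: complex)) ^ e)" for z
    using mult_left_mono[OF prod_weight_ge_1[of z e J] norm_ge_zero[of c]] by simp
  then show ?thesis by (auto simp: dominated_def intro!: exI[of _ "norm c"])
qed

lemma dominated_mult:
  assumes "dominated J a U" "dominated J b V"
  shows "dominated J (a + b) (\<lambda>z. U z * V z)"
proof -
  obtain C where C: "C \<ge> 0" "\<And>z. norm (U z) \<le> C * (\<Prod>i\<in>J. (1 + norm (z i)) ^ a)"
    using assms(1) by (auto simp: dominated_def)
  obtain D where D: "D \<ge> 0" "\<And>z. norm (V z) \<le> D * (\<Prod>i\<in>J. (1 + norm (z i)) ^ b)"
    using assms(2) by (auto simp: dominated_def)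
  have "norm (U z * V z) \<le> C * D * (\<Prod>i\<in>J. (1 + norm (z i)) ^ (a + b))" for z
  proof -
    have "norm (U z * V z) \<le> (C * (\<Prod>i\<in>J. (1 + norm (z i)) ^ a)) * (D * (\<Prod>i\<in>J. (1 + norm (z i)) ^ b))"
      unfolding norm_mult using C D prod_weight_ge_1[of z a J] by (intro mult_mono) auto
    then show ?thesis by (simp add: power_add prod.distrib mult_ac)
  qed
  then show ?thesis using assms C(1) D(1)
    unfolding dominated_def by (intro conjI exI[of _ "C * D"]) auto
qed

lemma dominated_add:
  assumes "dominated J e U" "dominated J e V"
  shows "dominated J e (\<lambda>z. U z + V z)"
proof -
  obtain C where C: "C \<ge> 0" "\<And>z. norm (U z) \<le> C * (\<Prod>i\<in>J. (1 + norm (z i)) ^ e)"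
    using assms(1) by (auto simp: dominated_def)
  obtain D where D: "D \<ge> 0" "\<And>z. norm (V z) \<le> D * (\<Prod>i\<in>J. (1 + norm (z i)) ^ e)"
    using assms(2) by (auto simp: dominated_def)
  have "norm (U z + V z) \<le> (C + D) * (\<Prod>i\<in>J. (1 + norm (z i)) ^ e)" for z
    using norm_triangle_ineq[of "U z" "V z"] C(2)[of z] D(2)[of z] by (simp add: distrib_right)
  then show ?thesis using assms C(1) D(1)
    unfolding dominated_def by (intro conjI exI[of _ "C + D"]) auto
qed

lemma dominated_cmult: "dominated J e U \<Longrightarrow> dominated J e (\<lambda>z. c * U z)"
  using dominated_mult[OF dominated_const[of J 0 c]] by simp

lemma dominated_sum: "(\<And>s. s \<in> S \<Longrightarrow> dominated J e (U s)) \<Longrightarrow> dominated J e (\<lambda>z. \<Sum>s\<in>S. U s z)"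
  by (induction S rule: infinite_finite_induct) (simp_all add: dominated_const dominated_add)

lemma dominated_component:
  assumes "finite J" "i \<in> J"
  shows "dominated J 1 (\<lambda>z. z i)" "dominated J 1 (\<lambda>z. cnj (z i))"
proof -
  have "norm (z i) \<le> 1 * (\<Prod>i\<in>J. (1 + norm (z i)) ^ 1)" for z :: "_ \<Rightarrow> complex"
  proof -
    have "(\<Prod>i\<in>{i}. (1 + norm (z i)) ^ 1) \<le> (\<Prod>i\<in>J. (1 + norm (z i)) ^ 1)"
      using assms by (intro prod_mono2) auto
    then show ?thesis by simp
  qed
  moreover have m: "(\<lambda>z. z i) \<in> borel_measurable (PiM J (\<lambda>_. borel :: complex measure))"
    by (rule measurable_component_singleton) (fact assms)
  moreover have "(\<lambda>z. cnj (z i)) \<in> borel_measurable (PiM J (\<lambda>_. borel :: complex measure))"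
    by (rule borel_measurable_continuous_onI[THEN measurable_compose[OF m]]) (intro continuous_intros)
  ultimately show "dominated J 1 (\<lambda>z. z i)" "dominated J 1 (\<lambda>z. cnj (z i))"
    using assms unfolding dominated_def by (auto intro!: exI[of _ "1::real"])
qed

text \<open>In every term of the Leibniz expansion each column index occurs once conjugated and once unconjugated,
  which is why the exponent \<open>2\<close> suffices although the entries of the matrix are sums over all rows.\<close>

lemma dominated_det:
  fixes a b :: "nat \<Rightarrow> nat" and n m :: nat
  assumes a: "inj_on a {..<d}" "a ` {..<d} \<subseteq> {..<m}" and b: "inj_on b {..<d}" "b ` {..<d} \<subseteq> {..<m}"
  shows "dominated ({..<n} \<times> {..<m}) 2
    (\<lambda>z. Determinant.det (mat d d (\<lambda>(i, j). (\<Sum>l<n. cnj (z (l, a i)) * z (l, b j)) - s i j)))"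
proof -
  let ?J = "{..<n} \<times> {..<m}"
  define B where "B z i j = (\<Sum>l<n. cnj (z (l, a i)) * z (l, b j)) - s i j" for z :: "nat \<times> nat \<Rightarrow> complex" and i j :: nat
  define D where "D z = Determinant.det (mat d d (\<lambda>(i, j). B z i j))" for z
  have D_eq: "D z = (\<Sum>p\<in>{p. p permutes {0..<d}}. signof p * (\<Prod>i = 0..<d. B z i (p i)))" for z
    unfolding D_def by (subst det_def'[of _ d]) (auto intro!: sum.cong prod.cong dest: permutes_in_image)
  have "(\<lambda>z. B z i j) \<in> borel_measurable (PiM ?J (\<lambda>_. borel))" if ij: "i < d" "j < d" for i j
  proof -
    have "(\<lambda>z. cnj (z (l, a i)) * z (l, b j)) \<in> borel_measurable (PiM ?J (\<lambda>_. borel))" if "l < n" for l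
      using dominated_component[of ?J "(l, a i)"] dominated_component[of ?J "(l, b j)"] a(2) b(2) ij that
      by (intro borel_measurable_times) (auto simp: dominated_def)
    then show ?thesis unfolding B_def by (intro borel_measurable_diff borel_measurable_sum) auto
  qed
  then have meas: "D \<in> borel_measurable (PiM ?J (\<lambda>_. borel))"
    unfolding D_eq[abs_def]
    by (intro borel_measurable_sum borel_measurable_times borel_measurable_prod borel_measurable_const)
       (auto dest: permutes_in_image)
  have "B (restrict z ?J) i j = B z i j" if "i < d" "j < d" for z i j
    using that a(2) b(2) unfolding B_def by (intro arg_cong2[where f="(-)"] sum.cong refl) auto
  then have inv: "D (restrict z ?J) = D z" for z
    unfolding D_def by (intro arg_cong[where f=Determinant.det] eq_matI) auto
  define c where "c = real n + (\<Sum>i<d. \<Sum>j<d. norm (s i j)) + 1"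
  have c: "c \<ge> 1" "norm (s i j) + real n \<le> c" if "i < d" "j < d" for i j
  proof -
    show "c \<ge> 1" unfolding c_def by (simp add: sum_nonneg)
    have "norm (s i j) \<le> (\<Sum>j<d. norm (s i j))" using that by (intro member_le_sum) auto
    also have "\<dots> \<le> (\<Sum>i<d. \<Sum>j<d. norm (s i j))"
      using that by (intro member_le_sum[of i _ "\<lambda>i. \<Sum>j<d. norm (s i j)"]) (auto intro: sum_nonneg)
    finally show "norm (s i j) + real n \<le> c" by (simp add: c_def)
  qed
  \<comment> \<open>The weight of column j is a product over all rows, so it is at least 1 and
    dominates every entry of the column.\<close>
  define w where "w z j = (\<Prod>l<n. 1 + norm (z (l, j)))" for z :: "nat \<times> nat \<Rightarrow> complex" and j :: nat
  have w1: "w z j \<ge> 1" for z j unfolding w_def by (rule prod_ge_1) simp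
  have wz: "norm (z (l, j)) \<le> w z j" if "l < n" for z l j
  proof -
    have "(\<Prod>l\<in>{l}. 1 + norm (z (l, j))) \<le> w z j"
      unfolding w_def using that by (intro prod_mono2) auto
    then show ?thesis by simp
  qed
  have B_le: "norm (B z i j) \<le> c * (w z (a i) * w z (b j))" if "i < d" "j < d" for z i j
  proof -
    have ww: "1 \<le> w z (a i) * w z (b j)" using mult_mono[OF w1[of z "a i"] w1[of z "b j"]] w1[of z "a i"] by simp
    have "norm (B z i j) \<le> (\<Sum>l<n. norm (z (l, a i)) * norm (z (l, b j))) + norm (s i j)"
      unfolding B_def by (intro order_trans[OF norm_triangle_ineq4] add_right_mono order_trans[OF norm_sum])
        (simp add: norm_mult)
    also have "\<dots> \<le> (\<Sum>l<n. w z (a i) * w z (b j)) + norm (s i j) * (w z (a i) * w z (b j))"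
      using ww mult_left_mono[OF ww norm_ge_zero[of "s i j"]] order_trans[OF zero_le_one w1]
      by (intro add_mono sum_mono mult_mono wz) auto
    also have "\<dots> = (norm (s i j) + real n) * (w z (a i) * w z (b j))"
      by (simp add: algebra_simps)
    also have "\<dots> \<le> c * (w z (a i) * w z (b j))"
      using c(2)[OF that] ww by (intro mult_right_mono) auto
    finally show ?thesis .
  qed
  \<comment> \<open>Injectivity lets each column weight occur at most once; the missing ones are at
    least 1.\<close>
  have w_image: "(\<Prod>i = 0..<d. w z (f i)) \<le> (\<Prod>j<m. w z j)" if "inj_on f {..<d}" "f ` {..<d} \<subseteq> {..<m}" for z f
  proof -
    have "(\<Prod>i = 0..<d. w z (f i)) = (\<Prod>j\<in>f ` {..<d}. w z j)"
      using that(1) by (simp add: prod.reindex atLeast0LessThan)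
    also have "\<dots> \<le> (\<Prod>j<m. w z j)"
      using that(2) w1 order_trans[OF zero_le_one w1] by (intro prod_mono2) auto
    finally show ?thesis .
  qed
  have "norm (D z) \<le> (fact d * c ^ d) * (\<Prod>x\<in>?J. (1 + norm (z x)) ^ 2)" for z
  proof -
    have summand: "norm (signof p * (\<Prod>i = 0..<d. B z i (p i))) \<le> c ^ d * ((\<Prod>j<m. w z j) * (\<Prod>j<m. w z j))"
      if p: "p permutes {0..<d}" for p
    proof -
      have pd: "p i < d" if "i < d" for i using permutes_in_image[OF p, of i] that by simp
      have inj: "inj_on (b \<circ> p) {..<d}"
      proof (rule comp_inj_on)
        show "inj_on p {..<d}" by (rule permutes_inj_on[OF p])
        show "inj_on b (p ` {..<d})" using b(1) permutes_image[OF p] by (simp add: atLeast0LessThan)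
      qed
      have "norm (signof p * (\<Prod>i = 0..<d. B z i (p i))) = (\<Prod>i = 0..<d. norm (B z i (p i)))"
        by (simp add: norm_mult prod_norm sign_def)
      also have "\<dots> \<le> (\<Prod>i = 0..<d. c * (w z (a i) * w z (b (p i))))"
        using pd by (intro prod_mono conjI B_le) auto
      also have "\<dots> = c ^ d * ((\<Prod>i = 0..<d. w z (a i)) * (\<Prod>i = 0..<d. w z ((b \<circ> p) i)))"
        by (simp add: prod.distrib)
      also have "\<dots> \<le> c ^ d * ((\<Prod>j<m. w z j) * (\<Prod>j<m. w z j))"
      proof (intro mult_left_mono mult_mono w_image a inj)
        show "(b \<circ> p) ` {..<d} \<subseteq> {..<m}" using b(2) pd by auto
        show "0 \<le> c ^ d" unfolding c_def by (intro zero_le_power add_nonneg_nonneg sum_nonneg) auto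
      qed (auto intro!: prod_nonneg order_trans[OF zero_le_one w1])
      finally show ?thesis .
    qed
    have "norm (D z) \<le> (\<Sum>p\<in>{p. p permutes {0..<d}}. c ^ d * ((\<Prod>j<m. w z j) * (\<Prod>j<m. w z j)))"
      unfolding D_eq by (intro order_trans[OF norm_sum] sum_mono summand) auto
    also have "\<dots> = fact d * c ^ d * ((\<Prod>j<m. w z j) * (\<Prod>j<m. w z j))"
      by (subst sum_constant, subst card_permutations[where n = d]) (simp_all add: mult.assoc)
    also have "(\<Prod>j<m. w z j) * (\<Prod>j<m. w z j) = (\<Prod>x\<in>?J. (1 + norm (z x)) ^ 2)"
    proof -
      have "(\<Prod>j<m. w z j) = (\<Prod>l<n. \<Prod>j<m. 1 + norm (z (l, j)))"
        unfolding w_def by (rule prod.swap)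
      also have "\<dots> = (\<Prod>x\<in>?J. 1 + norm (z x))"
        unfolding prod.cartesian_product by (rule prod.cong) auto
      finally show ?thesis by (simp only: prod.distrib[symmetric] power2_eq_square)
    qed
    finally show ?thesis .
  qed
  moreover have "fact d * c ^ d \<ge> 0"
    unfolding c_def by (intro mult_nonneg_nonneg zero_le_power add_nonneg_nonneg sum_nonneg) auto
  ultimately have "dominated ?J 2 D"
    unfolding dominated_def using meas inv by blast
  then show ?thesis unfolding D_def[abs_def] B_def .
qed

lemma dominated_gram_det: "dominated ({..<n} \<times> {..<m}) 2 (gram_det n m \<mu>)"
proof -
  have "gram_det n m \<mu> = (\<lambda>z. Determinant.det (mat m m (\<lambda>(i, j). (\<Sum>l<n. cnj (z (l, id i)) * z (l, id j)) - (if i = j then \<mu> else 0))))"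
    unfolding gram_det_def
    by (intro ext arg_cong[where f=Determinant.det] eq_matI) (auto simp: shifted_gram_def gram_def)
  then show ?thesis by (simp only:) (intro dominated_det; simp)
qed

text \<open>A cofactor deletes a row and a column with different indices; this is why
  \<open>dominated_det\<close> admits two separate injections.\<close>

lemma dominated_gram_adj:
  assumes "k < m" "j < m"
  shows "dominated ({..<n} \<times> {..<m}) 2 (gram_adj n m \<mu> k j)"
proof -
  let ?f = "\<lambda>k i. if i < k then i else Suc i"
  have f: "inj_on (?f k) {..<m - 1}" "?f k ` {..<m - 1} \<subseteq> {..<m}" for k
    by (auto simp: inj_on_def split: if_splits)
  have "gram_adj n m \<mu> k j = (\<lambda>z. (- 1) ^ (j + k) * Determinant.det (mat (m - 1) (m - 1)
      (\<lambda>(i, i'). (\<Sum>l<n. cnj (z (l, ?f j i)) * z (l, ?f k i')) - (if ?f j i = ?f k i' then \<mu> else 0))))"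
  proof
    fix z
    have "mat_delete (shifted_gram n m \<mu> z) j k = mat (m - 1) (m - 1)
      (\<lambda>(i, i'). (\<Sum>l<n. cnj (z (l, ?f j i)) * z (l, ?f k i')) - (if ?f j i = ?f k i' then \<mu> else 0))"
      using assms by (intro eq_matI) (auto simp: mat_delete_def shifted_gram_def gram_def)
    then show "gram_adj n m \<mu> k j z = (- 1) ^ (j + k) * Determinant.det (mat (m - 1) (m - 1)
      (\<lambda>(i, i'). (\<Sum>l<n. cnj (z (l, ?f j i)) * z (l, ?f k i')) - (if ?f j i = ?f k i' then \<mu> else 0)))"
      using assms shifted_gram_carrier[of n m \<mu> z]
      by (simp add: gram_adj_def adj_mat_def cofactor_def)
  qed
  then show ?thesis by (simp only:) (intro dominated_cmult dominated_det f)
qed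

text \<open>Interpolation expresses the coefficients of the characteristic polynomial by finitely many of its values;
  they are thus dominated and measurable.\<close>

lemma lagrange_basis:
  fixes d :: nat
  obtains L :: "nat \<Rightarrow> complex poly" where
    "\<And>p. degree p \<le> d \<Longrightarrow> p = (\<Sum>i\<le>d. Polynomial.smult (poly p (of_nat i)) (L i))"
proof -
  define P :: "nat \<Rightarrow> complex poly" where "P i = (\<Prod>j\<in>{..d} - {i}. [:- of_nat j, 1:])" for i
  define L where "L i = Polynomial.smult (1 / poly (P i) (of_nat i)) (P i)" for i
  have degP: "degree (P i) \<le> d" if "i \<le> d" for i
  proof -
    have "degree (P i) \<le> (\<Sum>j\<in>{..d} - {i}. (degree \<circ> (\<lambda>j. [:- of_nat j, 1:] :: complex poly)) j)"
      unfolding P_def by (rule degree_prod_sum_le) simp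
    also have "\<dots> = d" using that by simp
    finally show ?thesis .
  qed
  have P0: "poly (P i) (of_nat j) = 0 \<longleftrightarrow> i \<noteq> j" if "i \<le> d" "j \<le> d" for i j
    unfolding P_def poly_prod using that by (auto simp: prod_zero_iff)
  have Lij: "poly (L i) (of_nat j) = (if i = j then 1 else 0)" if "i \<le> d" "j \<le> d" for i j
    using P0[OF that] by (auto simp: L_def)
  show ?thesis
  proof (rule that[of L])
    fix p :: "complex poly" assume p: "degree p \<le> d"
    show "p = (\<Sum>i\<le>d. Polynomial.smult (poly p (of_nat i)) (L i))" (is "_ = ?q")
    proof (rule poly_eqI_degree[of "of_nat ` {..d}"])
      fix x :: complex assume "x \<in> of_nat ` {..d}"
      then obtain j where j: "j \<le> d" "x = of_nat j" by auto
      have "poly ?q x = (\<Sum>i\<le>d. poly p (of_nat i) * (if i = j then 1 else 0))"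
        unfolding poly_sum j(2) using j(1) by (intro sum.cong refl) (simp add: Lij)
      also have "\<dots> = poly p x" using j by (simp add: if_distrib sum.delta' cong: if_cong)
      finally show "poly p x = poly ?q x" ..
    next
      have card: "card (of_nat ` {..d} :: complex set) = Suc d"
        by (subst card_image) (auto simp: inj_on_def)
      show "degree p < card (of_nat ` {..d} :: complex set)" using p card by simp
      have "degree ?q \<le> d"
        by (intro degree_sum_le) (auto simp: L_def intro!: order_trans[OF degree_smult_le] degP)
      then show "degree ?q < card (of_nat ` {..d} :: complex set)" using card by simp
    qed
  qed
qed

lemma dominated_coeff_gram_charpoly:
  "dominated ({..<n} \<times> {..<m}) 2 (\<lambda>z. coeff (gram_charpoly n m z) k)"
proof -
  obtain L :: "nat \<Rightarrow> complex poly" where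
    L: "\<And>p. degree p \<le> m \<Longrightarrow> p = (\<Sum>i\<le>m. Polynomial.smult (poly p (of_nat i)) (L i))"
    using lagrange_basis by blast
  have "poly (gram_charpoly n m z) \<mu> = (- 1) ^ m * gram_det n m \<mu> z" for z \<mu>
    by (simp add: gram_det_eq_charpoly mult.assoc[symmetric] power_mult_distrib[symmetric])
  then have "coeff (gram_charpoly n m z) k = (\<Sum>i\<le>m. (- 1) ^ m * coeff (L i) k * gram_det n m (of_nat i) z)" for z
    by (subst L) (simp_all add: degree_gram_charpoly coeff_sum mult_ac)
  then show ?thesis
    by (simp only:) (intro dominated_sum dominated_cmult dominated_gram_det)
qed

text \<open>The number \<kappa> is the excess of the fourth absolute moment over its complex
  Gaussian value 2. Prescribing moments instead of a common law leaves just the data that the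
  recursion uses, and these pass to arrays with a row or a column removed.\<close>

locale moment_array = prob_space M
  for M :: "'a measure" and Z :: "nat \<times> nat \<Rightarrow> 'a \<Rightarrow> complex" and n m :: nat and \<kappa> :: real +
  assumes indep: "indep_vars (\<lambda>_. borel) Z ({..<n} \<times> {..<m})"
    and fourth_moment: "\<And>i. i \<in> {..<n} \<times> {..<m} \<Longrightarrow> integrable M (\<lambda>\<omega>. norm (Z i \<omega>) ^ 4)"
    and moment_1: "\<And>i. i \<in> {..<n} \<times> {..<m} \<Longrightarrow> (\<integral>\<omega>. Z i \<omega> \<partial>M) = 0"
    and moment_20: "\<And>i. i \<in> {..<n} \<times> {..<m} \<Longrightarrow> (\<integral>\<omega>. Z i \<omega> * Z i \<omega> \<partial>M) = 0"
    and moment_11: "\<And>i. i \<in> {..<n} \<times> {..<m} \<Longrightarrow> (\<integral>\<omega>. Z i \<omega> * cnj (Z i \<omega>) \<partial>M) = 1"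
    and moment_22: "\<And>i. i \<in> {..<n} \<times> {..<m} \<Longrightarrow>
      (\<integral>\<omega>. (Z i \<omega> * cnj (Z i \<omega>)) * (Z i \<omega> * cnj (Z i \<omega>)) \<partial>M) = 2 + of_real \<kappa>"
begin

abbreviation "I \<equiv> {..<n} \<times> {..<m}"

lemma Z_measurable: "i \<in> I \<Longrightarrow> Z i \<in> borel_measurable M"
  using indep unfolding indep_vars_def by blast

lemma integrable_weight:
  assumes "J \<subseteq> I"
  shows "integrable M (\<lambda>\<omega>. \<Prod>i\<in>J. (1 + norm (Z i \<omega>)) ^ 4)"
proof (rule indep_vars_integrable)
  show "finite J" using assms by (rule finite_subset) simp
  show "indep_vars (\<lambda>_. borel) (\<lambda>i \<omega>. (1 + norm (Z i \<omega>)) ^ 4) J"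
    by (rule indep_vars_compose2[OF indep_vars_subset[OF indep assms], where Y = "\<lambda>_ z. (1 + norm z) ^ 4"]) simp
  fix i assume "i \<in> J"
  then have i: "i \<in> I" using assms by auto
  have le: "(1 + x) ^ 4 \<le> 16 * (1 + x ^ 4)" if "x \<ge> 0" for x :: real
  proof (cases "x \<le> 1")
    case True
    then have "(1 + x) ^ 4 \<le> 2 ^ 4" using that by (intro power_mono) auto
    also have "\<dots> \<le> 16 * (1 + x ^ 4)" using that by simp
    finally show ?thesis .
  next
    case False
    then have "(1 + x) ^ 4 \<le> (2 * x) ^ 4" by (intro power_mono) auto
    then show ?thesis by (simp add: power_mult_distrib)
  qed
  show "integrable M (\<lambda>\<omega>. (1 + norm (Z i \<omega>)) ^ 4)"
  proof (rule Bochner_Integration.integrable_bound)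
    show "integrable M (\<lambda>\<omega>. 16 * (1 + norm (Z i \<omega>) ^ 4))"
      using fourth_moment[OF i] by simp
    show "(\<lambda>\<omega>. (1 + norm (Z i \<omega>)) ^ 4) \<in> borel_measurable M"
      using Z_measurable[OF i] by measurable
    show "AE \<omega> in M. norm ((1 + norm (Z i \<omega>)) ^ 4) \<le> norm (16 * (1 + norm (Z i \<omega>) ^ 4))"
      using le by (intro AE_I2) simp
  qed
qed

lemma restrict_measurable:
  "J \<subseteq> I \<Longrightarrow> (\<lambda>\<omega>. restrict (\<lambda>i. Z i \<omega>) J) \<in> measurable M (PiM J (\<lambda>_. borel))"
  by (rule measurable_restrict) (auto intro: Z_measurable)

lemma dominated_measurable:
  assumes "dominated J e U" "J \<subseteq> I"
  shows "(\<lambda>\<omega>. U (\<lambda>i. Z i \<omega>)) \<in> borel_measurable M"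
proof -
  have "(\<lambda>\<omega>. U (restrict (\<lambda>i. Z i \<omega>) J)) \<in> borel_measurable M"
    using assms(1) by (intro measurable_compose[OF restrict_measurable[OF assms(2)]]) (simp add: dominated_def)
  then show ?thesis using assms(1) by (simp add: dominated_def)
qed

lemma dominated_integrable:
  assumes "dominated J 4 U" "J \<subseteq> I"
  shows "integrable M (\<lambda>\<omega>. U (\<lambda>i. Z i \<omega>))"
proof -
  obtain C where C: "C \<ge> 0" "\<And>z. norm (U z) \<le> C * (\<Prod>i\<in>J. (1 + norm (z i)) ^ 4)"
    using assms(1) by (auto simp: dominated_def)
  show ?thesis
  proof (rule Bochner_Integration.integrable_bound)
    show "integrable M (\<lambda>\<omega>. C * (\<Prod>i\<in>J. (1 + norm (Z i \<omega>)) ^ 4))"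
      by (intro integrable_mult_right integrable_weight assms)
    show "(\<lambda>\<omega>. U (\<lambda>i. Z i \<omega>)) \<in> borel_measurable M"
      by (rule dominated_measurable[OF assms])
    have "norm (U (\<lambda>i. Z i \<omega>)) \<le> norm (C * (\<Prod>i\<in>J. (1 + norm (Z i \<omega>)) ^ 4))" for \<omega>
      using C(2)[of "\<lambda>i. Z i \<omega>"] by (rule order_trans) simp
    then show "AE \<omega> in M. norm (U (\<lambda>i. Z i \<omega>)) \<le> norm (C * (\<Prod>i\<in>J. (1 + norm (Z i \<omega>)) ^ 4))"
      by (intro AE_I2)
  qed
qed

text \<open>Integrability of the product comes from independence, so each factor may use the full
  exponent 4 on its own index set.\<close>

lemma dominated_indep:
  assumes U: "dominated A 4 U" "A \<subseteq> I" and V: "dominated B 4 V" "B \<subseteq> I" and AB: "A \<inter> B = {}"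
  shows "integrable M (\<lambda>\<omega>. U (\<lambda>i. Z i \<omega>) * V (\<lambda>i. Z i \<omega>))"
    and "(\<integral>\<omega>. U (\<lambda>i. Z i \<omega>) * V (\<lambda>i. Z i \<omega>) \<partial>M) = (\<integral>\<omega>. U (\<lambda>i. Z i \<omega>) \<partial>M) * (\<integral>\<omega>. V (\<lambda>i. Z i \<omega>) \<partial>M)"
proof -
  have "indep_var borel (U \<circ> (\<lambda>\<omega>. restrict (\<lambda>i. Z i \<omega>) A)) borel (V \<circ> (\<lambda>\<omega>. restrict (\<lambda>i. Z i \<omega>) B))"
    using U(1) V(1)
    by (intro indep_var_compose[OF indep_var_restrict[OF indep AB U(2) V(2)]]) (auto simp: dominated_def)
  then have ind: "indep_var borel (\<lambda>\<omega>. U (\<lambda>i. Z i \<omega>)) borel (\<lambda>\<omega>. V (\<lambda>i. Z i \<omega>))"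
    using U(1) V(1) by (simp add: dominated_def comp_def)
  note int = dominated_integrable[OF U] dominated_integrable[OF V]
  show "integrable M (\<lambda>\<omega>. U (\<lambda>i. Z i \<omega>) * V (\<lambda>i. Z i \<omega>))"
    by (rule indep_var_integrable[OF ind int])
  show "(\<integral>\<omega>. U (\<lambda>i. Z i \<omega>) * V (\<lambda>i. Z i \<omega>) \<partial>M) = (\<integral>\<omega>. U (\<lambda>i. Z i \<omega>) \<partial>M) * (\<integral>\<omega>. V (\<lambda>i. Z i \<omega>) \<partial>M)"
    by (rule indep_var_lebesgue_integral[OF ind int])
qed

lemma moment_cnj:
  assumes "i \<in> I"
  shows "(\<integral>\<omega>. cnj (Z i \<omega>) \<partial>M) = 0" "(\<integral>\<omega>. cnj (Z i \<omega>) * cnj (Z i \<omega>) \<partial>M) = 0"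
proof -
  show "(\<integral>\<omega>. cnj (Z i \<omega>) \<partial>M) = 0" using moment_1[OF assms] by simp
  show "(\<integral>\<omega>. cnj (Z i \<omega>) * cnj (Z i \<omega>) \<partial>M) = 0"
    by (simp only: complex_cnj_mult[symmetric] Bochner_Integration.integral_cnj moment_20[OF assms] complex_cnj_zero)
qed

lemma mixed_moment_2:
  assumes "a \<in> I" "b \<in> I"
  shows "(\<integral>\<omega>. Z a \<omega> * cnj (Z b \<omega>) \<partial>M) = (if a = b then 1 else 0)"
proof (cases "a = b")
  case False
  have "dominated {a} 4 (\<lambda>z. z a)" "dominated {b} 4 (\<lambda>z. cnj (z b))"
    by (rule dominated_mono[OF dominated_component(1)], auto)
       (rule dominated_mono[OF dominated_component(2)], auto)
  from dominated_indep(2)[OF this(1) _ this(2)] show ?thesis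
    using False assms by (simp add: moment_1)
qed (use assms moment_11 in simp)

text \<open>Third moments do not enter: whenever an index occurs exactly three times, the remaining factor has mean zero.\<close>

lemma mixed_moment_4:
  assumes abcd: "a \<in> I" "b \<in> I" "c \<in> I" "d \<in> I"
  shows "(\<integral>\<omega>. (Z a \<omega> * cnj (Z b \<omega>)) * (Z c \<omega> * cnj (Z d \<omega>)) \<partial>M)
    = (if a = b \<and> c = d then 1 else 0) + (if a = d \<and> c = b then 1 else 0)
      + (if a = b \<and> c = d \<and> a = c then of_real \<kappa> else 0)"
proof -
  \<comment> \<open>Collects all factors with index i, so that the expectation becomes a product
    over the indices.\<close>
  define f :: "nat \<times> nat \<Rightarrow> complex \<Rightarrow> complex" where
    "f i w = ((if a = i then w else 1) * (if b = i then cnj w else 1)) *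
       ((if c = i then w else 1) * (if d = i then cnj w else 1))" for i w
  have "(\<Prod>i\<in>I. f i (Z i \<omega>)) = (Z a \<omega> * cnj (Z b \<omega>)) * (Z c \<omega> * cnj (Z d \<omega>))" for \<omega>
    using abcd unfolding f_def prod.distrib by (simp add: prod.delta)
  moreover have "(\<integral>\<omega>. (\<Prod>i\<in>I. f i (Z i \<omega>)) \<partial>M) = (\<Prod>i\<in>I. \<integral>\<omega>. f i (Z i \<omega>) \<partial>M)"
  proof (rule indep_vars_lebesgue_integral)
    show "indep_vars (\<lambda>_. borel) (\<lambda>i \<omega>. f i (Z i \<omega>)) I"
    proof (rule indep_vars_compose2[OF indep])
      fix i assume "i \<in> I"
      show "f i \<in> borel_measurable borel"
      proof -
        have "continuous_on UNIV (\<lambda>w :: complex. if P then w else 1)"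
          "continuous_on UNIV (\<lambda>w :: complex. if P then cnj w else 1)" for P
          by (cases P; simp add: continuous_intros)+
        then show ?thesis
          unfolding f_def[abs_def] by (intro borel_measurable_continuous_onI continuous_on_mult)
      qed
    qed
    fix i assume i: "i \<in> I"
    have if_dom: "dominated {i} 1 (\<lambda>z. if a = i then z i else 1)" "dominated {i} 1 (\<lambda>z. if a = i then cnj (z i) else 1)"
      for a :: "nat \<times> nat"
      using dominated_component[of "{i}" i] by (cases "a = i"; simp add: dominated_const)+
    have "dominated {i} ((1 + 1) + (1 + 1)) (\<lambda>z. f i (z i))"
      unfolding f_def by (intro dominated_mult if_dom)
    then have "dominated {i} 4 (\<lambda>z. f i (z i))"
      by (rule dominated_mono) simp
    from dominated_integrable[OF this] show "integrable M (\<lambda>\<omega>. f i (Z i \<omega>))"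
      using i by simp
  qed simp
  ultimately have eq: "(\<integral>\<omega>. (Z a \<omega> * cnj (Z b \<omega>)) * (Z c \<omega> * cnj (Z d \<omega>)) \<partial>M) = (\<Prod>i\<in>I. \<integral>\<omega>. f i (Z i \<omega>) \<partial>M)"
    by simp
  have zero: "(\<integral>\<omega>. (Z a \<omega> * cnj (Z b \<omega>)) * (Z c \<omega> * cnj (Z d \<omega>)) \<partial>M) = 0"
    if "i \<in> I" "(\<integral>\<omega>. f i (Z i \<omega>) \<partial>M) = 0" for i
    unfolding eq using that by (intro prod_zero) auto
  note moments = moment_1 moment_20 moment_11 moment_22 moment_cnj
  \<comment> \<open>In the first four cases some index carries a factor of mean zero; the last three
    are the complete coincidence and the two pairings.\<close>
  consider "a \<noteq> b" "a \<noteq> d" | "c \<noteq> b" "c \<noteq> d" | "b \<noteq> a" "b \<noteq> c" | "d \<noteq> a" "d \<noteq> c"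
    | "a = b" "c = d" "a = c" | "a = b" "c = d" "a \<noteq> c" | "a = d" "c = b" "a \<noteq> c"
    by blast
  then show ?thesis
  proof cases
    case 1
    then have "(\<integral>\<omega>. f a (Z a \<omega>) \<partial>M) = 0" using moments[OF abcd(1)] by (cases "c = a") (auto simp: f_def)
    then show ?thesis using zero[OF abcd(1)] 1 by simp
  next
    case 2
    then have "(\<integral>\<omega>. f c (Z c \<omega>) \<partial>M) = 0" using moments[OF abcd(3)] by (cases "a = c") (auto simp: f_def)
    then show ?thesis using zero[OF abcd(3)] 2 by auto
  next
    case 3
    then have "(\<integral>\<omega>. f b (Z b \<omega>) \<partial>M) = 0" using moments[OF abcd(2)] by (cases "d = b") (auto simp: f_def)
    then show ?thesis using zero[OF abcd(2)] 3 by auto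
  next
    case 4
    then have "(\<integral>\<omega>. f d (Z d \<omega>) \<partial>M) = 0" using moments[OF abcd(4)] by (cases "b = d") (auto simp: f_def)
    then show ?thesis using zero[OF abcd(4)] 4 by auto
  next
    case 5
    then show ?thesis using moment_22[OF abcd(1)] by simp
  next
    case 6
    have "(\<Prod>i\<in>I. \<integral>\<omega>. f i (Z i \<omega>) \<partial>M) = 1"
    proof (intro prod.neutral ballI)
      fix i assume i: "i \<in> I"
      show "(\<integral>\<omega>. f i (Z i \<omega>) \<partial>M) = 1"
        using 6 moments[OF i] by (cases "i = a"; cases "i = c") (auto simp: f_def prob_space)
    qed
    then show ?thesis using 6 unfolding eq by simp
  next
    case 7
    have "(\<Prod>i\<in>I. \<integral>\<omega>. f i (Z i \<omega>) \<partial>M) = 1"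
    proof (intro prod.neutral ballI)
      fix i assume i: "i \<in> I"
      show "(\<integral>\<omega>. f i (Z i \<omega>) \<partial>M) = 1"
        using 7 moments[OF i] by (cases "i = a"; cases "i = c") (auto simp: f_def prob_space mult.commute)
    qed
    then show ?thesis using 7 unfolding eq by auto
  qed
qed

end

lemma moment_array_Suc_imp: "moment_array M Z (Suc n) m \<kappa> \<Longrightarrow> moment_array M Z n m \<kappa>"
  unfolding moment_array_def moment_array_axioms_def
  by (auto elim!: prob_space.indep_vars_subset)

lemma moment_array_delete_column:
  assumes "moment_array M Z n m \<kappa>" "j < m"
  shows "moment_array M (delete_column j Z) n (m - 1) \<kappa>"
proof -
  interpret moment_array M Z n m \<kappa> by fact
  let ?h = "\<lambda>(l, k). (l, if k < j then k else Suc k) :: nat \<times> nat"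
  have del: "delete_column j Z i = Z (?h i)" for i
    by (cases i) (simp add: delete_column_def)
  have mem: "?h i \<in> {..<n} \<times> {..<m}" if "i \<in> {..<n} \<times> {..<m - 1}" for i
    using that assms(2) by auto
  have inj: "inj_on ?h ({..<n} \<times> {..<m - 1})"
    by (auto simp: inj_on_def split: if_splits)
  show ?thesis
  proof
    \<comment> \<open>Reindexing is done through restrictions to the singletons of the image, which
      are disjoint because \<open>?h\<close> is injective.\<close>
    have "indep_vars (\<lambda>i. PiM {?h i} (\<lambda>_. borel)) (\<lambda>i \<omega>. restrict (\<lambda>i. Z i \<omega>) {?h i}) ({..<n} \<times> {..<m - 1})"
    proof (rule indep_vars_restrict[OF indep])
      show "{?h i} \<subseteq> {..<n} \<times> {..<m}" if "i \<in> {..<n} \<times> {..<m - 1}" for i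
        using mem[OF that] by blast
      show "disjoint_family_on (\<lambda>i. {?h i}) ({..<n} \<times> {..<m - 1})"
        using inj unfolding disjoint_family_on_def inj_on_def by blast
    qed
    then have "indep_vars (\<lambda>_. borel) (\<lambda>i \<omega>. restrict (\<lambda>i. Z i \<omega>) {?h i} (?h i)) ({..<n} \<times> {..<m - 1})"
      by (rule indep_vars_compose2[where Y = "\<lambda>i g. g (?h i)"]) (rule measurable_component_singleton, simp)
    then have "indep_vars (\<lambda>_. borel) (\<lambda>i. Z (?h i)) ({..<n} \<times> {..<m - 1})"
      by simp
    then show "indep_vars (\<lambda>_. borel) (delete_column j Z) ({..<n} \<times> {..<m - 1})"
      by (simp only: del[abs_def])
  qed (use mem fourth_moment moment_1 moment_20 moment_11 moment_22 in \<open>simp_all only: del\<close>)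
qed

lemma sum_diagonal:
  fixes g :: "nat \<times> nat \<Rightarrow> complex"
  shows "(\<Sum>q\<in>{..<m} \<times> {..<m}. g q * (if fst q = snd q then c else 0)) = (\<Sum>j<m. g (j, j)) * c"
proof -
  have "(\<Sum>q\<in>{..<m} \<times> {..<m}. g q * (if fst q = snd q then c else 0))
      = (\<Sum>i<m. \<Sum>j<m. if i = j then g (i, j) * c else 0)"
    unfolding sum.cartesian_product by (intro sum.cong) auto
  also have "\<dots> = (\<Sum>i<m. g (i, i) * c)" by (simp add: sum.delta)
  finally show ?thesis by (simp add: sum_distrib_right)
qed

text \<open>Both determinants are affine in the products of two entries of the new row, which is
  independent of \<open>D\<close> and \<open>P\<close>. Among the fourth moments of the row, pairing
  inside each determinant gives a product of traces, pairing across gives the trace of the product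
  of the adjugates, and a complete coincidence adds \<kappa>.\<close>

lemma gram_det_correlation_Suc:
  assumes "moment_array M Z (Suc n) m \<kappa>"
  defines "D \<equiv> \<lambda>\<mu> \<omega>. gram_det n m \<mu> (\<lambda>i. Z i \<omega>)"
    and "P \<equiv> \<lambda>\<mu> k j \<omega>. gram_adj n m \<mu> k j (\<lambda>i. Z i \<omega>)"
  shows "(\<integral>\<omega>. gram_det (Suc n) m \<mu> (\<lambda>i. Z i \<omega>) * gram_det (Suc n) m \<nu> (\<lambda>i. Z i \<omega>) \<partial>M)
    = (\<integral>\<omega>. D \<mu> \<omega> * D \<nu> \<omega> + D \<mu> \<omega> * (\<Sum>j<m. P \<nu> j j \<omega>) + D \<nu> \<omega> * (\<Sum>j<m. P \<mu> j j \<omega>)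
         + (\<Sum>j<m. P \<mu> j j \<omega>) * (\<Sum>j<m. P \<nu> j j \<omega>) + (\<Sum>k<m. \<Sum>j<m. P \<mu> k j \<omega> * P \<nu> j k \<omega>) \<partial>M)
      + of_real \<kappa> * (\<Sum>j<m. \<integral>\<omega>. P \<mu> j j \<omega> * P \<nu> j j \<omega> \<partial>M)"
proof -
  interpret moment_array M Z "Suc n" m \<kappa> by fact
  let ?S = "{..<m} \<times> {..<m}" and ?A = "{..<n} \<times> {..<m}" and ?B = "{n} \<times> {..<m}"
  \<comment> \<open>A pair of column indices is packed into one index, which turns the quadruple
    sums into double sums.\<close>
  define Q where "Q \<mu> q \<omega> = P \<mu> (fst q) (snd q) \<omega>" for \<mu> q \<omega>
  define x where "x q \<omega> = Z (n, fst q) \<omega> * cnj (Z (n, snd q) \<omega>)" for q \<omega>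
  have sub: "?A \<subseteq> I" "?B \<subseteq> I" "?A \<inter> ?B = {}" by auto
  have dD: "dominated ?A 2 (gram_det n m \<mu>)" for \<mu> by (rule dominated_gram_det)
  have dP: "dominated ?A 2 (gram_adj n m \<mu> (fst q) (snd q))" if "q \<in> ?S" for \<mu> q
    using that by (intro dominated_gram_adj) auto
  have dx: "dominated ?B 2 (\<lambda>z. z (n, fst q) * cnj (z (n, snd q)))" if "q \<in> ?S" for q
    using dominated_mult[OF dominated_component(1)[of ?B "(n, fst q)"] dominated_component(2)[of ?B "(n, snd q)"]] that
    by (auto simp: numeral_2_eq_2)
  have dx4: "dominated ?B 4 (\<lambda>z. z (n, fst q) * cnj (z (n, snd q)))" if "q \<in> ?S" for q
    by (rule dominated_mono[OF dx[OF that]]) simp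
  have d4: "dominated J 4 (\<lambda>z. U z * V z)" if "dominated J 2 U" "dominated J 2 V"
    for J :: "(nat \<times> nat) set" and U V
    using dominated_mult[OF that] by simp
  have prod_int1: "integrable M (\<lambda>\<omega>. D \<mu> \<omega> * D \<nu> \<omega>)" for \<mu> \<nu>
    unfolding D_def by (rule dominated_integrable[OF d4[OF dD dD] sub(1)])
  have prod_int2: "integrable M (\<lambda>\<omega>. D \<mu> \<omega> * Q \<nu> q \<omega>)" if "q \<in> ?S" for q \<mu> \<nu>
    unfolding D_def Q_def P_def by (rule dominated_integrable[OF d4[OF dD dP[OF that]] sub(1)])
  have prod_int3: "integrable M (\<lambda>\<omega>. Q \<mu> q \<omega> * Q \<nu> r \<omega>)" if "q \<in> ?S" "r \<in> ?S" for q r \<mu> \<nu>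
    unfolding Q_def P_def by (rule dominated_integrable[OF d4[OF dP[OF that(1)] dP[OF that(2)]] sub(1)])
  have x2: "(\<integral>\<omega>. x q \<omega> \<partial>M) = (if fst q = snd q then 1 else 0)" if "q \<in> ?S" for q
    using that mixed_moment_2[of "(n, fst q)" "(n, snd q)"] by (auto simp: x_def)
  have x4: "(\<integral>\<omega>. x q \<omega> * x r \<omega> \<partial>M)
     = (if fst q = snd q \<and> fst r = snd r then 1 else 0) + (if r = (snd q, fst q) then 1 else 0)
       + (if r = q \<and> fst q = snd q then of_real \<kappa> else 0)" if "q \<in> ?S" "r \<in> ?S" for q r
  proof -
    have "((n, fst q) = (n, snd r) \<and> (n, fst r) = (n, snd q)) = (r = (snd q, fst q))"
      "((n, fst q) = (n, snd q) \<and> (n, fst r) = (n, snd r) \<and> (n, fst q) = (n, fst r)) = (r = q \<and> fst q = snd q)"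
      "((n, fst q) = (n, snd q) \<and> (n, fst r) = (n, snd r)) = (fst q = snd q \<and> fst r = snd r)"
      by (auto simp: prod_eq_iff)
    moreover have "(n, fst q) \<in> I" "(n, snd q) \<in> I" "(n, fst r) \<in> I" "(n, snd r) \<in> I"
      using that by auto
    ultimately show ?thesis
      unfolding x_def by (simp only: mixed_moment_4)
  qed
  have DQ: "integrable M (\<lambda>\<omega>. (D \<mu> \<omega> * Q \<nu> q \<omega>) * x q \<omega>)"
    "(\<integral>\<omega>. (D \<mu> \<omega> * Q \<nu> q \<omega>) * x q \<omega> \<partial>M) = (\<integral>\<omega>. D \<mu> \<omega> * Q \<nu> q \<omega> \<partial>M) * (if fst q = snd q then 1 else 0)"
    if q: "q \<in> ?S" for q \<mu> \<nu>
    using dominated_indep[OF d4[OF dD dP[OF q]] sub(1) dx4[OF q] sub(2,3)] x2[OF q]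
    unfolding D_def Q_def P_def x_def by simp_all
  have sum_DQ: "(\<Sum>q\<in>?S. \<integral>\<omega>. (D \<mu> \<omega> * Q \<nu> q \<omega>) * x q \<omega> \<partial>M) = (\<Sum>j<m. \<integral>\<omega>. D \<mu> \<omega> * P \<nu> j j \<omega> \<partial>M)"
    for \<mu> \<nu>
  proof -
    have "(\<Sum>q\<in>?S. \<integral>\<omega>. (D \<mu> \<omega> * Q \<nu> q \<omega>) * x q \<omega> \<partial>M)
      = (\<Sum>q\<in>?S. (\<integral>\<omega>. D \<mu> \<omega> * Q \<nu> q \<omega> \<partial>M) * (if fst q = snd q then 1 else 0))"
      by (intro sum.cong refl DQ(2))
    also have "\<dots> = (\<Sum>j<m. \<integral>\<omega>. D \<mu> \<omega> * Q \<nu> (j, j) \<omega> \<partial>M) * 1"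
      by (rule sum_diagonal)
    finally show ?thesis by (simp add: Q_def)
  qed
  have QQ: "integrable M (\<lambda>\<omega>. (Q \<mu> q \<omega> * Q \<nu> r \<omega>) * (x q \<omega> * x r \<omega>))"
    "(\<integral>\<omega>. (Q \<mu> q \<omega> * Q \<nu> r \<omega>) * (x q \<omega> * x r \<omega>) \<partial>M) = (\<integral>\<omega>. Q \<mu> q \<omega> * Q \<nu> r \<omega> \<partial>M) * (\<integral>\<omega>. x q \<omega> * x r \<omega> \<partial>M)"
    if q: "q \<in> ?S" and r: "r \<in> ?S" for q r
    using dominated_indep[OF d4[OF dP[OF q] dP[OF r]] sub(1) d4[OF dx[OF q] dx[OF r]] sub(2,3)]
    unfolding Q_def P_def x_def by simp_all
  have expand: "gram_det (Suc n) m \<mu> (\<lambda>i. Z i \<omega>) = D \<mu> \<omega> + (\<Sum>q\<in>?S. Q \<mu> q \<omega> * x q \<omega>)" for \<mu> \<omega>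
    unfolding gram_det_Suc D_def Q_def P_def x_def sum.cartesian_product by (simp add: case_prod_unfold)
  have "gram_det (Suc n) m \<mu> (\<lambda>i. Z i \<omega>) * gram_det (Suc n) m \<nu> (\<lambda>i. Z i \<omega>)
    = D \<mu> \<omega> * D \<nu> \<omega> + (\<Sum>q\<in>?S. (D \<mu> \<omega> * Q \<nu> q \<omega>) * x q \<omega>) + (\<Sum>q\<in>?S. (D \<nu> \<omega> * Q \<mu> q \<omega>) * x q \<omega>)
      + (\<Sum>q\<in>?S. \<Sum>r\<in>?S. (Q \<mu> q \<omega> * Q \<nu> r \<omega>) * (x q \<omega> * x r \<omega>))" for \<omega>
  proof -
    have "(d + A) * (d' + B) = d * d' + d * B + d' * A + A * B" for d d' A B :: complex
      by (simp add: algebra_simps)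
    moreover have "D \<mu>' \<omega> * (\<Sum>q\<in>?S. Q \<nu>' q \<omega> * x q \<omega>) = (\<Sum>q\<in>?S. (D \<mu>' \<omega> * Q \<nu>' q \<omega>) * x q \<omega>)" for \<mu>' \<nu>'
      by (simp only: sum_distrib_left mult.assoc)
    moreover have "(\<Sum>q\<in>?S. Q \<mu> q \<omega> * x q \<omega>) * (\<Sum>q\<in>?S. Q \<nu> q \<omega> * x q \<omega>)
        = (\<Sum>q\<in>?S. \<Sum>r\<in>?S. (Q \<mu> q \<omega> * Q \<nu> r \<omega>) * (x q \<omega> * x r \<omega>))"
      unfolding sum_product by (intro sum.cong refl) (simp only: mult_ac)
    ultimately show ?thesis unfolding expand by (simp only:)
  qed
  then have "(\<integral>\<omega>. gram_det (Suc n) m \<mu> (\<lambda>i. Z i \<omega>) * gram_det (Suc n) m \<nu> (\<lambda>i. Z i \<omega>) \<partial>M)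
    = (\<integral>\<omega>. D \<mu> \<omega> * D \<nu> \<omega> + (\<Sum>q\<in>?S. (D \<mu> \<omega> * Q \<nu> q \<omega>) * x q \<omega>) + (\<Sum>q\<in>?S. (D \<nu> \<omega> * Q \<mu> q \<omega>) * x q \<omega>)
      + (\<Sum>q\<in>?S. \<Sum>r\<in>?S. (Q \<mu> q \<omega> * Q \<nu> r \<omega>) * (x q \<omega> * x r \<omega>)) \<partial>M)"
    by simp
  also have "\<dots> = (\<integral>\<omega>. D \<mu> \<omega> * D \<nu> \<omega> \<partial>M) + (\<Sum>q\<in>?S. \<integral>\<omega>. (D \<mu> \<omega> * Q \<nu> q \<omega>) * x q \<omega> \<partial>M)
     + (\<Sum>q\<in>?S. \<integral>\<omega>. (D \<nu> \<omega> * Q \<mu> q \<omega>) * x q \<omega> \<partial>M)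
     + (\<Sum>q\<in>?S. \<Sum>r\<in>?S. \<integral>\<omega>. (Q \<mu> q \<omega> * Q \<nu> r \<omega>) * (x q \<omega> * x r \<omega>) \<partial>M)"
    using prod_int1 DQ(1) QQ(1)
    by (simp add: Bochner_Integration.integral_add Bochner_Integration.integral_sum
        Bochner_Integration.integrable_add Bochner_Integration.integrable_sum)
  also have "(\<Sum>q\<in>?S. \<integral>\<omega>. (D \<mu> \<omega> * Q \<nu> q \<omega>) * x q \<omega> \<partial>M) = (\<Sum>j<m. \<integral>\<omega>. D \<mu> \<omega> * P \<nu> j j \<omega> \<partial>M)"
    by (rule sum_DQ)
  also have "(\<Sum>q\<in>?S. \<integral>\<omega>. (D \<nu> \<omega> * Q \<mu> q \<omega>) * x q \<omega> \<partial>M) = (\<Sum>j<m. \<integral>\<omega>. D \<nu> \<omega> * P \<mu> j j \<omega> \<partial>M)"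
    by (rule sum_DQ)
  also have "(\<Sum>q\<in>?S. \<Sum>r\<in>?S. \<integral>\<omega>. (Q \<mu> q \<omega> * Q \<nu> r \<omega>) * (x q \<omega> * x r \<omega>) \<partial>M)
     = (\<Sum>i<m. \<Sum>j<m. \<integral>\<omega>. P \<mu> i i \<omega> * P \<nu> j j \<omega> \<partial>M) + (\<Sum>i<m. \<Sum>j<m. \<integral>\<omega>. P \<mu> i j \<omega> * P \<nu> j i \<omega> \<partial>M)
       + (\<Sum>j<m. \<integral>\<omega>. P \<mu> j j \<omega> * P \<nu> j j \<omega> \<partial>M) * of_real \<kappa>"
  proof -
    define g where "g q r = (\<integral>\<omega>. Q \<mu> q \<omega> * Q \<nu> r \<omega> \<partial>M)" for q r
    \<comment> \<open>The three contributions of \<open>x4\<close>. The middle one swaps the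
      components of q, because in each product only the second entry is conjugated.\<close>
    have "(\<Sum>q\<in>?S. \<Sum>r\<in>?S. \<integral>\<omega>. (Q \<mu> q \<omega> * Q \<nu> r \<omega>) * (x q \<omega> * x r \<omega>) \<partial>M)
      = (\<Sum>q\<in>?S. \<Sum>r\<in>?S. g q r * (if fst r = snd r then 1 else 0) * (if fst q = snd q then 1 else 0)
          + g q r * (if r = (snd q, fst q) then 1 else 0)
          + g q r * (if r = q then 1 else 0) * (if fst q = snd q then of_real \<kappa> else 0))"
      by (intro sum.cong refl) (auto simp: QQ(2) x4 g_def distrib_left)
    also have "\<dots> = (\<Sum>q\<in>?S. (\<Sum>r\<in>?S. g q r * (if fst r = snd r then 1 else 0)) * (if fst q = snd q then 1 else 0))
       + (\<Sum>q\<in>?S. \<Sum>r\<in>?S. g q r * (if r = (snd q, fst q) then 1 else 0))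
       + (\<Sum>q\<in>?S. (\<Sum>r\<in>?S. g q r * (if r = q then 1 else 0)) * (if fst q = snd q then of_real \<kappa> else 0))"
      by (simp only: sum.distrib sum_distrib_right)
    also have "(\<Sum>q\<in>?S. (\<Sum>r\<in>?S. g q r * (if fst r = snd r then 1 else 0)) * (if fst q = snd q then 1 else 0))
       = (\<Sum>i<m. \<Sum>j<m. g (i, i) (j, j))"
      by (simp only: sum_diagonal mult_1_right)
    also have "(\<Sum>q\<in>?S. \<Sum>r\<in>?S. g q r * (if r = (snd q, fst q) then 1 else 0)) = (\<Sum>q\<in>?S. g q (snd q, fst q))"
    proof (rule sum.cong[OF refl])
      fix q assume "q \<in> ?S"
      have "(\<Sum>r\<in>?S. g q r * (if r = (snd q, fst q) then 1 else 0)) = (\<Sum>r\<in>?S. if r = (snd q, fst q) then g q r else 0)"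
        by (intro sum.cong) auto
      also have "\<dots> = g q (snd q, fst q)" using \<open>q \<in> ?S\<close> by (subst sum.delta) auto
      finally show "(\<Sum>r\<in>?S. g q r * (if r = (snd q, fst q) then 1 else 0)) = g q (snd q, fst q)" .
    qed
    also have "(\<Sum>q\<in>?S. g q (snd q, fst q)) = (\<Sum>i<m. \<Sum>j<m. g (i, j) (j, i))"
      unfolding sum.cartesian_product by (simp add: case_prod_unfold)
    also have "(\<Sum>q\<in>?S. (\<Sum>r\<in>?S. g q r * (if r = q then 1 else 0)) * (if fst q = snd q then of_real \<kappa> else 0))
      = (\<Sum>q\<in>?S. g q q * (if fst q = snd q then of_real \<kappa> else 0))"
    proof (rule sum.cong[OF refl])
      fix q assume "q \<in> ?S"
      have "(\<Sum>r\<in>?S. g q r * (if r = q then 1 else 0)) = (\<Sum>r\<in>?S. if r = q then g q r else 0)"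
        by (intro sum.cong) auto
      also have "\<dots> = g q q" using \<open>q \<in> ?S\<close> by (subst sum.delta) auto
      finally show "(\<Sum>r\<in>?S. g q r * (if r = q then 1 else 0)) * (if fst q = snd q then of_real \<kappa> else 0)
        = g q q * (if fst q = snd q then of_real \<kappa> else 0)" by simp
    qed
    also have "\<dots> = (\<Sum>j<m. g (j, j) (j, j)) * of_real \<kappa>"
      by (rule sum_diagonal)
    finally show ?thesis by (simp add: g_def Q_def)
  qed
  finally have L: "(\<integral>\<omega>. gram_det (Suc n) m \<mu> (\<lambda>i. Z i \<omega>) * gram_det (Suc n) m \<nu> (\<lambda>i. Z i \<omega>) \<partial>M)
    = (\<integral>\<omega>. D \<mu> \<omega> * D \<nu> \<omega> \<partial>M) + (\<Sum>j<m. \<integral>\<omega>. D \<mu> \<omega> * P \<nu> j j \<omega> \<partial>M) + (\<Sum>j<m. \<integral>\<omega>. D \<nu> \<omega> * P \<mu> j j \<omega> \<partial>M)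
      + ((\<Sum>i<m. \<Sum>j<m. \<integral>\<omega>. P \<mu> i i \<omega> * P \<nu> j j \<omega> \<partial>M) + (\<Sum>i<m. \<Sum>j<m. \<integral>\<omega>. P \<mu> i j \<omega> * P \<nu> j i \<omega> \<partial>M)
       + (\<Sum>j<m. \<integral>\<omega>. P \<mu> j j \<omega> * P \<nu> j j \<omega> \<partial>M) * of_real \<kappa>)" .
  have int: "integrable M (\<lambda>\<omega>. D \<mu> \<omega> * P \<nu> k j \<omega>)" if "k < m" "j < m" for \<mu> \<nu> k j
    using prod_int2[of "(k, j)"] that by (auto simp: Q_def)
  have int': "integrable M (\<lambda>\<omega>. P \<mu> k j \<omega> * P \<nu> k' j' \<omega>)"
    if "k < m" "j < m" "k' < m" "j' < m" for \<mu> \<nu> k j k' j'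
    using prod_int3[of "(k, j)" "(k', j')"] that by (auto simp: Q_def)
  have "(\<integral>\<omega>. D \<mu> \<omega> * D \<nu> \<omega> + D \<mu> \<omega> * (\<Sum>j<m. P \<nu> j j \<omega>) + D \<nu> \<omega> * (\<Sum>j<m. P \<mu> j j \<omega>)
         + (\<Sum>j<m. P \<mu> j j \<omega>) * (\<Sum>j<m. P \<nu> j j \<omega>) + (\<Sum>k<m. \<Sum>j<m. P \<mu> k j \<omega> * P \<nu> j k \<omega>) \<partial>M)
    = (\<integral>\<omega>. D \<mu> \<omega> * D \<nu> \<omega> + (\<Sum>j<m. D \<mu> \<omega> * P \<nu> j j \<omega>) + (\<Sum>j<m. D \<nu> \<omega> * P \<mu> j j \<omega>)
         + (\<Sum>i<m. \<Sum>j<m. P \<mu> i i \<omega> * P \<nu> j j \<omega>) + (\<Sum>k<m. \<Sum>j<m. P \<mu> k j \<omega> * P \<nu> j k \<omega>) \<partial>M)"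
    by (simp only: sum_distrib_left[symmetric] sum_distrib_right[symmetric])
  also have "\<dots> = (\<integral>\<omega>. D \<mu> \<omega> * D \<nu> \<omega> \<partial>M) + (\<Sum>j<m. \<integral>\<omega>. D \<mu> \<omega> * P \<nu> j j \<omega> \<partial>M) + (\<Sum>j<m. \<integral>\<omega>. D \<nu> \<omega> * P \<mu> j j \<omega> \<partial>M)
      + (\<Sum>i<m. \<Sum>j<m. \<integral>\<omega>. P \<mu> i i \<omega> * P \<nu> j j \<omega> \<partial>M) + (\<Sum>i<m. \<Sum>j<m. \<integral>\<omega>. P \<mu> i j \<omega> * P \<nu> j i \<omega> \<partial>M)"
  proof -
    note int_sum = Bochner_Integration.integrable_sum and sum_int = Bochner_Integration.integral_sum
    have 1: "integrable M (\<lambda>\<omega>. \<Sum>j<m. D \<mu> \<omega> * P \<nu> j j \<omega>)"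
      "(\<integral>\<omega>. (\<Sum>j<m. D \<mu> \<omega> * P \<nu> j j \<omega>) \<partial>M) = (\<Sum>j<m. \<integral>\<omega>. D \<mu> \<omega> * P \<nu> j j \<omega> \<partial>M)" for \<mu> \<nu>
      by (rule int_sum sum_int; rule int; simp)+
    have 2: "integrable M (\<lambda>\<omega>. \<Sum>j<m. P \<mu> i i \<omega> * P \<nu> j j \<omega>)"
      "(\<integral>\<omega>. (\<Sum>j<m. P \<mu> i i \<omega> * P \<nu> j j \<omega>) \<partial>M) = (\<Sum>j<m. \<integral>\<omega>. P \<mu> i i \<omega> * P \<nu> j j \<omega> \<partial>M)"
      "integrable M (\<lambda>\<omega>. \<Sum>j<m. P \<mu> i j \<omega> * P \<nu> j i \<omega>)"
      "(\<integral>\<omega>. (\<Sum>j<m. P \<mu> i j \<omega> * P \<nu> j i \<omega>) \<partial>M) = (\<Sum>j<m. \<integral>\<omega>. P \<mu> i j \<omega> * P \<nu> j i \<omega> \<partial>M)"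
      if "i < m" for i
      by (rule int_sum sum_int; rule int'; use that in simp)+
    have 3: "integrable M (\<lambda>\<omega>. \<Sum>i<m. \<Sum>j<m. P \<mu> i i \<omega> * P \<nu> j j \<omega>)"
      "integrable M (\<lambda>\<omega>. \<Sum>i<m. \<Sum>j<m. P \<mu> i j \<omega> * P \<nu> j i \<omega>)"
      by (rule int_sum; simp add: 2)+
    have 4: "(\<integral>\<omega>. (\<Sum>i<m. \<Sum>j<m. P \<mu> i i \<omega> * P \<nu> j j \<omega>) \<partial>M) = (\<Sum>i<m. \<Sum>j<m. \<integral>\<omega>. P \<mu> i i \<omega> * P \<nu> j j \<omega> \<partial>M)"
      "(\<integral>\<omega>. (\<Sum>i<m. \<Sum>j<m. P \<mu> i j \<omega> * P \<nu> j i \<omega>) \<partial>M) = (\<Sum>i<m. \<Sum>j<m. \<integral>\<omega>. P \<mu> i j \<omega> * P \<nu> j i \<omega> \<partial>M)"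
      by (subst sum_int; simp add: 2)+
    show ?thesis
      by (simp only: Bochner_Integration.integral_add Bochner_Integration.integrable_add prod_int1 1 3 4)
  qed
  finally show ?thesis unfolding L by (simp add: mult.commute)
qed

section \<open>The correlation function in closed form\<close>

text \<open>Coefficient array of the antisymmetric polynomial p(\<mu>) q(\<nu>) - q(\<mu>) p(\<nu>).
  An operator acting alike on both variables acts on it through \<open>p\<close> and
  \<open>q\<close> separately.\<close>

definition wedge :: "'b::comm_ring_1 poly \<Rightarrow> 'b poly \<Rightarrow> nat \<Rightarrow> nat \<Rightarrow> 'b" where
  "wedge p q k l = coeff p k * coeff q l - coeff q k * coeff p l"

text \<open>\<open>(1 - D\<^sub>\<mu>) (1 - D\<^sub>\<nu>)\<close> acting on the coefficient arrays of polynomials in \<open>\<mu>\<close> and \<open>\<nu>\<close>.\<close>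

definition one_minus_D2 :: "(nat \<Rightarrow> nat \<Rightarrow> 'b::comm_ring_1) \<Rightarrow> nat \<Rightarrow> nat \<Rightarrow> 'b" where
  "one_minus_D2 h k l = h k l - of_nat (Suc k) * h (Suc k) l - of_nat (Suc l) * h k (Suc l)
     + of_nat (Suc k) * of_nat (Suc l) * h (Suc k) (Suc l)"

definition eval2 :: "nat \<Rightarrow> (nat \<Rightarrow> nat \<Rightarrow> 'b::comm_ring_1) \<Rightarrow> 'b \<Rightarrow> 'b \<Rightarrow> 'b" where
  "eval2 N h \<mu> \<nu> = (\<Sum>k\<le>N. \<Sum>l\<le>N. h k l * (\<mu> ^ k * \<nu> ^ l))"

lemma one_minus_D2_wedge:
  fixes p q :: "'b :: idom poly"
  shows "one_minus_D2 (wedge p q) k l = wedge (p - pderiv p) (q - pderiv q) k l"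
  by (simp add: one_minus_D2_def wedge_def coeff_pderiv algebra_simps del: of_nat_Suc)

lemma poly_eq_sum_le:
  fixes p :: "'b::comm_ring_1 poly"
  assumes "degree p \<le> N"
  shows "poly p x = (\<Sum>k\<le>N. coeff p k * x ^ k)"
  using assms unfolding poly_altdef by (intro sum.mono_neutral_left) (auto simp: coeff_eq_0)

lemma eval2_wedge:
  fixes p q :: "'b::comm_ring_1 poly"
  assumes "degree p \<le> N" "degree q \<le> N"
  shows "eval2 N (wedge p q) \<mu> \<nu> = poly p \<mu> * poly q \<nu> - poly q \<mu> * poly p \<nu>"
  unfolding eval2_def wedge_def poly_eq_sum_le[OF assms(1)] poly_eq_sum_le[OF assms(2)] sum_product
  by (simp add: sum_subtractf[symmetric] algebra_simps)

lemma eval2_eqI: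
  fixes h h' :: "nat \<Rightarrow> nat \<Rightarrow> complex"
  assumes "\<And>\<mu> \<nu>. eval2 N h \<mu> \<nu> = eval2 N h' \<mu> \<nu>" "k \<le> N" "l \<le> N"
  shows "h k l = h' k l"
proof -
  have 1: "eval2 N h \<mu> \<nu> = (\<Sum>k\<le>N. (\<Sum>l\<le>N. h k l * \<nu> ^ l) * \<mu> ^ k)" for h :: "nat \<Rightarrow> nat \<Rightarrow> complex" and \<mu> \<nu>
    by (simp add: eval2_def sum_distrib_left sum_distrib_right mult_ac)
  have "(\<Sum>l\<le>N. h k l * \<nu> ^ l) = (\<Sum>l\<le>N. h' k l * \<nu> ^ l)" for \<nu>
  proof -
    have "\<forall>x. (\<Sum>k\<le>N. (\<Sum>l\<le>N. h k l * \<nu> ^ l) * x ^ k) = (\<Sum>k\<le>N. (\<Sum>l\<le>N. h' k l * \<nu> ^ l) * x ^ k)"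
      using assms(1)[of _ \<nu>] unfolding 1 by blast
    from iffD1[OF polyfun_eq_coeffs this] show ?thesis using assms(2) by blast
  qed
  then have "\<forall>x. (\<Sum>l\<le>N. h k l * x ^ l) = (\<Sum>l\<le>N. h' k l * x ^ l)" by blast
  from iffD1[OF polyfun_eq_coeffs this] show ?thesis using assms(3) by blast
qed

text \<open>As \<open>pCons 0\<close> multiplies by the variable, this is the array of \<mu> - \<nu>
  times the product of the characteristic polynomials at \<mu> and \<nu>.\<close>

definition gram_wedge :: "nat \<Rightarrow> nat \<Rightarrow> (nat \<times> nat \<Rightarrow> complex) \<Rightarrow> nat \<Rightarrow> nat \<Rightarrow> complex" where
  "gram_wedge n m z = wedge (pCons 0 (gram_charpoly n m z)) (gram_charpoly n m z)"

lemma eval2_gram_wedge: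
  assumes "m < N"
  shows "eval2 N (gram_wedge n m z) \<mu> \<nu> = (\<mu> - \<nu>) * (gram_det n m \<mu> z * gram_det n m \<nu> z)"
proof -
  have "eval2 N (gram_wedge n m z) \<mu> \<nu> = (\<mu> - \<nu>) * (poly (gram_charpoly n m z) \<mu> * poly (gram_charpoly n m z) \<nu>)"
    unfolding gram_wedge_def using assms
    by (subst eval2_wedge) (auto simp: degree_gram_charpoly degree_pCons_eq_if algebra_simps)
  moreover have "gram_det n m \<mu> z * gram_det n m \<nu> z = poly (gram_charpoly n m z) \<mu> * poly (gram_charpoly n m z) \<nu>"
  proof -
    have "(- 1 :: complex) ^ m * (- 1) ^ m = 1" by (rule minus_one_mult_self)
    then show ?thesis unfolding gram_det_eq_charpoly by (metis mult.assoc mult.left_commute mult_1)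
  qed
  ultimately show ?thesis by simp
qed

lemma gram_wedge_eq_0: "k > Suc m \<or> l > Suc m \<Longrightarrow> gram_wedge n m z k l = 0"
  by (auto simp: gram_wedge_def wedge_def coeff_eq_0 degree_gram_charpoly degree_pCons_eq_if)

text \<open>With x, y the values at \<mu>, \<nu>, the operator maps (\<mu> - \<nu>) x y to (\<mu> -
  \<nu>) (x - x') (y - y') + x y' - y x'. By \<open>gram_adj_resolvent\<close> the last two terms
  are \<mu> - \<nu> times the trace of the product of the adjugates.\<close>

lemma eval2_one_minus_D2_gram_wedge:
  assumes "m < N"
  shows "eval2 N (one_minus_D2 (gram_wedge n m z)) \<mu> \<nu>
    = (\<mu> - \<nu>) * (gram_det n m \<mu> z * gram_det n m \<nu> z
        + gram_det n m \<mu> z * (\<Sum>j<m. gram_adj n m \<nu> j j z) + gram_det n m \<nu> z * (\<Sum>j<m. gram_adj n m \<mu> j j z)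
        + (\<Sum>j<m. gram_adj n m \<mu> j j z) * (\<Sum>j<m. gram_adj n m \<nu> j j z)
        + (\<Sum>k<m. \<Sum>j<m. gram_adj n m \<mu> k j z * gram_adj n m \<nu> j k z))"
proof -
  let ?c = "gram_charpoly n m z"
  define x y x' y' s :: complex where "x = poly ?c \<mu>" and "y = poly ?c \<nu>" and "x' = poly (pderiv ?c) \<mu>"
    and "y' = poly (pderiv ?c) \<nu>" and "s = (- 1) ^ m"
  have s: "s * s = 1" unfolding s_def by (rule minus_one_mult_self)
  have deg: "degree (?c - pderiv ?c) \<le> N" "degree (pCons 0 ?c - pderiv (pCons 0 ?c)) \<le> N"
    using assms by (intro degree_diff_le; simp add: degree_gram_charpoly degree_pderiv degree_pCons_eq_if)+
  have "one_minus_D2 (gram_wedge n m z) = wedge (pCons 0 ?c - pderiv (pCons 0 ?c)) (?c - pderiv ?c)"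
    unfolding gram_wedge_def by (intro ext one_minus_D2_wedge)
  then have "eval2 N (one_minus_D2 (gram_wedge n m z)) \<mu> \<nu>
     = (\<mu> * x - (x + \<mu> * x')) * (y - y') - (x - x') * (\<nu> * y - (y + \<nu> * y'))"
    using eval2_wedge[OF deg(2,1), of \<mu> \<nu>] by (simp add: pderiv_pCons x_def y_def x'_def y'_def)
  also have "\<dots> = (\<mu> - \<nu>) * (x * y - x * y' - y * x' + x' * y') + (x * y' - y * x')"
    by (simp add: algebra_simps)
  \<comment> \<open>Inserting the square of the sign lets every value of the characteristic
    polynomial take the sign of its determinant.\<close>
  also have "\<dots> = (\<mu> - \<nu>) * ((s * s) * (x * y) - (s * s) * (x * y') - (s * s) * (y * x') + (s * s) * (x' * y'))
      + ((s * s) * (x * y') - (s * s) * (y * x'))"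
    unfolding s by simp
  also have "\<dots> = (\<mu> - \<nu>) * ((s * x) * (s * y) + (s * x) * - (s * y') + (s * y) * - (s * x') + - (s * x') * - (s * y'))
      + ((s * y) * - (s * x') - (s * x) * - (s * y'))"
    by (simp add: algebra_simps)
  finally show ?thesis
    using gram_adj_resolvent[where \<mu> = \<mu> and \<nu> = \<nu> and n = n and m = m and z = z]
    unfolding gram_det_eq_charpoly gram_adj_trace
    by (simp add: x_def y_def x'_def y'_def s_def distrib_left)
qed

text \<open>The expectation is taken coefficientwise, so the recursion is an identity between arrays
  of numbers.\<close>

definition correl :: "'a measure \<Rightarrow> (nat \<times> nat \<Rightarrow> 'a \<Rightarrow> complex) \<Rightarrow> nat \<Rightarrow> nat \<Rightarrow> nat \<Rightarrow> nat \<Rightarrow> complex" where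
  "correl M Z n m k l = (\<integral>\<omega>. gram_wedge n m (\<lambda>i. Z i \<omega>) k l \<partial>M)"

lemma gram_wedge_integrable:
  assumes "moment_array M Z n m \<kappa>"
  shows "integrable M (\<lambda>\<omega>. gram_wedge n m (\<lambda>i. Z i \<omega>) k l)"
proof -
  interpret moment_array M Z n m \<kappa> by fact
  let ?J = "{..<n} \<times> {..<m}"
  have d1: "dominated ?J 2 (\<lambda>z. coeff (gram_charpoly n m z) k)" for k
    by (rule dominated_coeff_gram_charpoly)
  have d2: "dominated ?J 2 (\<lambda>z. coeff (pCons 0 (gram_charpoly n m z)) k)" for k
    by (cases k) (simp_all add: d1 dominated_const)
  have "gram_wedge n m z k l = coeff (pCons 0 (gram_charpoly n m z)) k * coeff (gram_charpoly n m z) l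
      + (- 1) * (coeff (gram_charpoly n m z) k * coeff (pCons 0 (gram_charpoly n m z)) l)" for z
    by (simp add: gram_wedge_def wedge_def)
  then have "dominated ?J (2 + 2) (\<lambda>z. gram_wedge n m z k l)"
    by (simp only:) (intro dominated_add dominated_cmult dominated_mult d1 d2)
  then show ?thesis by (intro dominated_integrable[of "{..<n} \<times> {..<m}"]) auto
qed

lemma eval2_integral:
  assumes "\<And>k l. integrable M (\<lambda>\<omega>. h \<omega> k l)"
  shows "(\<integral>\<omega>. eval2 N (h \<omega>) \<mu> \<nu> \<partial>M) = eval2 N (\<lambda>k l. \<integral>\<omega>. h \<omega> k l \<partial>M) \<mu> (\<nu> :: complex)"
  unfolding eval2_def using assms
  by (simp add: Bochner_Integration.integral_sum Bochner_Integration.integrable_sum)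

lemma one_minus_D2_integral:
  assumes "\<And>k l. integrable M (\<lambda>\<omega>. h \<omega> k l)"
  shows "(\<integral>\<omega>. one_minus_D2 (h \<omega>) k l \<partial>M) = one_minus_D2 (\<lambda>k l. \<integral>\<omega>. h \<omega> k l \<partial>M) k (l :: nat) "
    "integrable M (\<lambda>\<omega>. one_minus_D2 (h \<omega>) k l :: complex)"
  unfolding one_minus_D2_def using assms by simp_all

lemma eval2_correl:
  assumes "moment_array M Z n m \<kappa>" "m < N"
  shows "eval2 N (correl M Z n m) \<mu> \<nu>
    = (\<mu> - \<nu>) * (\<integral>\<omega>. gram_det n m \<mu> (\<lambda>i. Z i \<omega>) * gram_det n m \<nu> (\<lambda>i. Z i \<omega>) \<partial>M)"
  using eval2_integral[of M "\<lambda>\<omega>. gram_wedge n m (\<lambda>i. Z i \<omega>)" N \<mu> \<nu>] gram_wedge_integrable[OF assms(1)]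
  unfolding eval2_gram_wedge[OF assms(2)] correl_def[abs_def] by simp

lemma eval2_add: "eval2 N (\<lambda>k l. h k l + h' k l) \<mu> \<nu> = eval2 N h \<mu> \<nu> + eval2 N h' \<mu> \<nu>"
  by (simp add: eval2_def sum.distrib distrib_right)

lemma eval2_cmult: "eval2 N (\<lambda>k l. c * h k l) \<mu> \<nu> = c * eval2 N h \<mu> \<nu>"
  by (simp add: eval2_def sum_distrib_left mult_ac)

lemma eval2_sum: "eval2 N (\<lambda>k l. \<Sum>j\<in>S. h j k l) \<mu> \<nu> = (\<Sum>j\<in>S. eval2 N (h j) \<mu> \<nu>)"
  by (induction S rule: infinite_finite_induct) (simp_all add: eval2_add, simp_all add: eval2_def)

lemma correl_Suc:
  assumes Z: "moment_array M Z (Suc n) m \<kappa>"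
  shows "correl M Z (Suc n) m k l = one_minus_D2 (correl M Z n m) k l
    + of_real \<kappa> * (\<Sum>j<m. correl M (delete_column j Z) n (m - 1) k l)"
proof (cases "k \<le> Suc m \<and> l \<le> Suc m")
  \<comment> \<open>Comparing values with \<open>N = Suc m\<close> reaches indices up to Suc m only;
    beyond them all terms vanish for reasons of degree.\<close>
  case False
  have "gram_wedge n m z k l = 0" if "k > Suc m \<or> l > Suc m" for n m z k l
    using gram_wedge_eq_0 that by blast
  moreover have "correl M Z' n' m' k' l' = 0" if "k' > Suc m' \<or> l' > Suc m'" for Z' n' m' k' l'
    unfolding correl_def using that by (simp add: gram_wedge_eq_0)
  ultimately show ?thesis using False
    by (auto simp: one_minus_D2_def intro!: sum.neutral)
next
  case True
  interpret moment_array M Z "Suc n" m \<kappa> by fact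
  have Zn: "moment_array M Z n m \<kappa>" by (rule moment_array_Suc_imp[OF Z])
  note Zj = moment_array_delete_column[OF Zn]
  let ?z = "\<lambda>\<omega> i. Z i \<omega>"
  show ?thesis
  proof (rule eval2_eqI[where N = "Suc m" and h = "correl M Z (Suc n) m"
        and h' = "\<lambda>k l. one_minus_D2 (correl M Z n m) k l
          + of_real \<kappa> * (\<Sum>j<m. correl M (delete_column j Z) n (m - 1) k l)"])
    fix \<mu> \<nu>
    have del: "(\<lambda>i. delete_column j Z i \<omega>) = delete_column j (?z \<omega>)" for j \<omega>
      by (auto simp: delete_column_def fun_eq_iff)
    have adj: "(\<mu> - \<nu>) * (\<integral>\<omega>. gram_adj n m \<mu> j j (?z \<omega>) * gram_adj n m \<nu> j j (?z \<omega>) \<partial>M)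
      = eval2 (Suc m) (correl M (delete_column j Z) n (m - 1)) \<mu> \<nu>" if "j < m" for j
      using that by (subst eval2_correl[OF Zj]) (auto simp: gram_adj_diag del)
    have linear: "s * ((\<integral>\<omega>. G \<omega> \<partial>M) + K * (\<Sum>j<m. e j)) = (\<integral>\<omega>. s * G \<omega> \<partial>M) + K * (\<Sum>j<m. s * e j)"
      for s K :: complex and G e
      by (simp add: distrib_left sum_distrib_left mult.left_commute)
    have "eval2 (Suc m) (correl M Z (Suc n) m) \<mu> \<nu>
      = (\<mu> - \<nu>) * (\<integral>\<omega>. gram_det (Suc n) m \<mu> (?z \<omega>) * gram_det (Suc n) m \<nu> (?z \<omega>) \<partial>M)"
      by (rule eval2_correl[OF Z]) simp
    also have "\<dots> = (\<integral>\<omega>. eval2 (Suc m) (one_minus_D2 (gram_wedge n m (?z \<omega>))) \<mu> \<nu> \<partial>M)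
      + of_real \<kappa> * (\<Sum>j<m. (\<mu> - \<nu>) * (\<integral>\<omega>. gram_adj n m \<mu> j j (?z \<omega>) * gram_adj n m \<nu> j j (?z \<omega>) \<partial>M))"
      unfolding gram_det_correlation_Suc[OF Z] eval2_one_minus_D2_gram_wedge[OF lessI]
      by (rule linear)
    also have "(\<integral>\<omega>. eval2 (Suc m) (one_minus_D2 (gram_wedge n m (?z \<omega>))) \<mu> \<nu> \<partial>M)
      = eval2 (Suc m) (one_minus_D2 (correl M Z n m)) \<mu> \<nu>"
      by (subst eval2_integral)
         (simp_all only: one_minus_D2_integral[OF gram_wedge_integrable[OF Zn]] correl_def[abs_def])
    also have "(\<Sum>j<m. (\<mu> - \<nu>) * (\<integral>\<omega>. gram_adj n m \<mu> j j (?z \<omega>) * gram_adj n m \<nu> j j (?z \<omega>) \<partial>M))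
      = (\<Sum>j<m. eval2 (Suc m) (correl M (delete_column j Z) n (m - 1)) \<mu> \<nu>)"
      by (intro sum.cong refl adj) simp
    finally show "eval2 (Suc m) (correl M Z (Suc n) m) \<mu> \<nu> = eval2 (Suc m) (\<lambda>k l. one_minus_D2 (correl M Z n m) k l
      + of_real \<kappa> * (\<Sum>j<m. correl M (delete_column j Z) n (m - 1) k l)) \<mu> \<nu>"
      by (simp only: eval2_add eval2_cmult eval2_sum)
  qed (use True in auto)
qed

section \<open>Solution of the recursion\<close>

definition lag_wedge :: "nat \<Rightarrow> nat \<Rightarrow> nat \<Rightarrow> nat \<Rightarrow> real" where
  "lag_wedge n m = wedge (lag n (Suc m)) (lag n m)"

text \<open>So this array solves the recursion in \<open>n\<close> when \<kappa> = 0.\<close>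

lemma one_minus_D2_lag_wedge: "one_minus_D2 (lag_wedge n m) k l = lag_wedge (Suc n) m k l"
  unfolding lag_wedge_def one_minus_D2_wedge lag_Suc_left ..

text \<open>The number of ways of placing \<open>i\<close> non-attacking rooks on an \<open>n \<times> m\<close> board.\<close>

definition rook :: "nat \<Rightarrow> nat \<Rightarrow> nat \<Rightarrow> nat" where
  "rook n m i = (n choose i) * (m choose i) * fact i"

lemma rook_0: "rook n m 0 = 1" by (simp add: rook_def)

text \<open>The additional row is either empty or holds a rook in one of the m columns, which is
  then closed to the others.\<close>

lemma rook_Suc: "rook (Suc n) m (Suc i) = rook n m (Suc i) + m * rook n (m - 1) i"
proof (cases m)
  case 0
  then show ?thesis by (simp add: rook_def)
next
  case (Suc m')
  have "(Suc m' choose Suc i) * fact (Suc i) = Suc m' * (m' choose i) * fact i"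
  proof -
    have "(Suc m' choose Suc i) * fact (Suc i) = Suc i * (Suc m' choose Suc i) * fact i"
      by (simp only: fact_Suc of_nat_id mult_ac)
    also have "\<dots> = Suc m' * (m' choose i) * fact i"
      using Suc_times_binomial_eq[of m' i] by (simp only: mult.commute[of "Suc i" "Suc m' choose Suc i"])
    finally show ?thesis .
  qed
  then have "(n choose i) * ((Suc m' choose Suc i) * fact (Suc i)) = (n choose i) * (Suc m' * (m' choose i) * fact i)"
    by simp
  then show ?thesis unfolding rook_def Suc diff_Suc_1 binomial_Suc_Suc[of n i]
    by (simp only: distrib_right mult.assoc) (simp only: mult_ac add_ac)
qed

lemma rook_eq_0: "n < i \<Longrightarrow> rook n m i = 0" by (simp add: rook_def)

text \<open>Each factor \<kappa> costs one row and one column, so its coefficients obey the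
  recursion of the rook numbers. Deleting columns changes both \<open>m\<close> and
  \<open>Z\<close>, which are therefore arbitrary in the induction. For i > m the truncated
  \<open>m - i\<close> is harmless, since the rook number is 0.\<close>

lemma correl_closed_form:
  assumes "moment_array M Z n m \<kappa>"
  shows "correl M Z n m k l =
    of_real (\<Sum>i\<le>n. real (rook n m i) * \<kappa> ^ i * lag_wedge (n - i) (m - i) k l)"
  using assms
proof (induction n arbitrary: m Z k l)
  case 0
  interpret moment_array M Z 0 m \<kappa> by fact
  \<comment> \<open>Without rows the Gram matrix is zero, and the array is that of (\<mu> - \<nu>)
    \<mu>^m \<nu>^m.\<close>
  have c: "gram_charpoly 0 m z = monom 1 m" for z
  proof -
    have g: "gram 0 m z = 0\<^sub>m m m" by (rule eq_matI) (auto simp: gram_def)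
    have "poly (gram_charpoly 0 m z) x = poly (monom 1 m) x" for x
    proof -
      have "gram_det 0 m x z = (- x) ^ m"
      proof -
        have "shifted_gram 0 m x z = (- x) \<cdot>\<^sub>m 1\<^sub>m m"
          unfolding shifted_gram_def g by (rule eq_matI) auto
        then show ?thesis by (simp add: gram_det_def)
      qed
      then have "(- 1) ^ m * poly (gram_charpoly 0 m z) x = (- 1) ^ m * x ^ m"
        by (simp only: gram_det_eq_charpoly power_mult_distrib[symmetric] mult_minus_left mult_1_left)
      then show ?thesis by (simp add: poly_monom)
    qed
    then show ?thesis by (intro poly_ext)
  qed
  have "gram_wedge 0 m z k l = of_real (lag_wedge 0 m k l)" for z
    unfolding gram_wedge_def c lag_wedge_def wedge_def lag_0 by (simp add: coeff_pCons split: nat.split)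
  then show ?case
    by (simp add: correl_def rook_0 prob_space)
next
  case (Suc n)
  note Zn = moment_array_Suc_imp[OF Suc.prems]
  let ?F = "\<lambda>n m k l. (\<Sum>i\<le>n. real (rook n m i) * \<kappa> ^ i * lag_wedge (n - i) (m - i) k l)"
  have D2_of_real: "one_minus_D2 (\<lambda>k l. of_real (h k l) :: complex) k l = of_real (one_minus_D2 h k l)" for h k l
    by (simp add: one_minus_D2_def)
  have D2_sum: "one_minus_D2 (\<lambda>k l. \<Sum>i\<in>S. a i * h i k l) k l = (\<Sum>i\<in>S. a i * one_minus_D2 (h i) k l)"
    for S and a :: "nat \<Rightarrow> real" and h k l
    by (simp add: one_minus_D2_def sum_distrib_left sum_subtractf sum.distrib algebra_simps)
  have "correl M Z (Suc n) m k l = one_minus_D2 (\<lambda>k l. of_real (?F n m k l)) k l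
      + of_real \<kappa> * (\<Sum>j<m. of_real (?F n (m - 1) k l))"
    unfolding correl_Suc[OF Suc.prems] using Suc.IH[OF Zn] Suc.IH[OF moment_array_delete_column[OF Zn]]
    by (simp add: one_minus_D2_def)
  also have "\<dots> = of_real ((\<Sum>i\<le>n. real (rook n m i) * \<kappa> ^ i * lag_wedge (Suc n - i) (m - i) k l)
      + \<kappa> * (real m * ?F n (m - 1) k l))"
    unfolding D2_of_real D2_sum one_minus_D2_lag_wedge by (simp add: Suc_diff_le)
  also have "(\<Sum>i\<le>n. real (rook n m i) * \<kappa> ^ i * lag_wedge (Suc n - i) (m - i) k l)
      + \<kappa> * (real m * ?F n (m - 1) k l) = ?F (Suc n) m k l"
  proof -
    have "?F (Suc n) m k l = lag_wedge (Suc n) m k l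
        + (\<Sum>i\<le>n. real (rook (Suc n) m (Suc i)) * \<kappa> ^ Suc i * lag_wedge (n - i) (m - Suc i) k l)"
      by (subst sum.atMost_Suc_shift) (simp add: rook_0)
    also have "(\<Sum>i\<le>n. real (rook (Suc n) m (Suc i)) * \<kappa> ^ Suc i * lag_wedge (n - i) (m - Suc i) k l)
      = (\<Sum>i\<le>n. real (rook n m (Suc i)) * \<kappa> ^ Suc i * lag_wedge (n - i) (m - Suc i) k l)
        + \<kappa> * (real m * ?F n (m - 1) k l)"
    proof -
      have "real (rook (Suc n) m (Suc i)) * \<kappa> ^ Suc i * lag_wedge (n - i) (m - Suc i) k l
        = real (rook n m (Suc i)) * \<kappa> ^ Suc i * lag_wedge (n - i) (m - Suc i) k l
          + \<kappa> * (real m * (real (rook n (m - 1) i) * \<kappa> ^ i * lag_wedge (n - i) (m - 1 - i) k l))" for i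
        by (simp add: rook_Suc algebra_simps)
      then show ?thesis by (simp only: sum.distrib sum_distrib_left)
    qed
    also have "lag_wedge (Suc n) m k l + ((\<Sum>i\<le>n. real (rook n m (Suc i)) * \<kappa> ^ Suc i * lag_wedge (n - i) (m - Suc i) k l)
        + \<kappa> * (real m * ?F n (m - 1) k l))
      = (\<Sum>i\<le>Suc n. real (rook n m i) * \<kappa> ^ i * lag_wedge (Suc n - i) (m - i) k l) + \<kappa> * (real m * ?F n (m - 1) k l)"
      by (subst sum.atMost_Suc_shift) (simp add: rook_0)
    also have "(\<Sum>i\<le>Suc n. real (rook n m i) * \<kappa> ^ i * lag_wedge (Suc n - i) (m - i) k l)
      = (\<Sum>i\<le>n. real (rook n m i) * \<kappa> ^ i * lag_wedge (Suc n - i) (m - i) k l)"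
      by (simp add: rook_eq_0)
    finally show ?thesis ..
  qed
  finally show ?case .
qed

lemma fact_binomial_real: "i \<le> n \<Longrightarrow> real (n choose i) * (fact i * fact (n - i)) = fact n"
  using binomial_fact[of i n, where ?'a = real] by (simp add: field_simps)

lemma continuous_eq_punctured:
  fixes f g :: "real \<Rightarrow> complex"
  assumes "isCont f x" "isCont g x" "\<And>y. y \<noteq> x \<Longrightarrow> f y = g y"
  shows "f x = g x"
proof -
  have "(g \<longlongrightarrow> f x) (at x)"
    using assms(1,3) unfolding isCont_def
    by (elim Lim_transform_eventually) (auto simp: eventually_at_filter)
  then show ?thesis using assms(2) unfolding isCont_def by (rule tendsto_unique[rotated]) simp
qed

text \<open>All terms share the difference \<alpha> of their indices, so Christoffel--Darboux turns
  each into a kernel with the same weight, and the factor x - y cancels. The rook number times (n -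
  i)! (m - i)! is n! m! / i!, the source of the exponential series.\<close>

lemma gram_correlation:
  assumes Z: "moment_array M Z (m + \<alpha>) m \<kappa>"
  shows "(\<integral>\<omega>. gram_det (m + \<alpha>) m (of_real x) (\<lambda>i. Z i \<omega>) * gram_det (m + \<alpha>) m (of_real y) (\<lambda>i. Z i \<omega>) \<partial>M)
    = of_real (fact (m + \<alpha>) * fact m * (\<Sum>i\<le>m. \<kappa> ^ i / fact i * lag_kernel \<alpha> (m - i) x y))"
    (is "?E y = ?K y")
proof -
  interpret moment_array M Z "m + \<alpha>" m \<kappa> by fact
  let ?n = "m + \<alpha>"
  have off: "?E y = ?K y" if "y \<noteq> x" for y
  proof -
    have "(of_real x - of_real y) * ?E y = eval2 (Suc m) (correl M Z ?n m) (of_real x) (of_real y)"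
      by (rule eval2_correl[OF Z, symmetric]) simp
    also have "\<dots> = of_real (eval2 (Suc m) (\<lambda>k l. \<Sum>i\<le>?n. real (rook ?n m i) * \<kappa> ^ i * lag_wedge (?n - i) (m - i) k l) x y)"
      unfolding correl_closed_form[OF Z] eval2_def by simp
    also have "eval2 (Suc m) (\<lambda>k l. \<Sum>i\<le>?n. real (rook ?n m i) * \<kappa> ^ i * lag_wedge (?n - i) (m - i) k l) x y
      = (\<Sum>i\<le>?n. real (rook ?n m i) * \<kappa> ^ i * wronski (?n - i) (m - i) x y)"
      unfolding eval2_sum eval2_cmult lag_wedge_def wronski_def
      by (intro sum.cong refl arg_cong2[where f = "(*)"] eval2_wedge order_trans[OF degree_lag]) auto
    also have "\<dots> = (\<Sum>i\<le>m. real (rook ?n m i) * \<kappa> ^ i * wronski (?n - i) (m - i) x y)"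
      by (rule sum.mono_neutral_right) (auto simp: rook_def)
    also have "\<dots> = (\<Sum>i\<le>m. (x - y) * (fact ?n * fact m * (\<kappa> ^ i / fact i * lag_kernel \<alpha> (m - i) x y)))"
    proof (rule sum.cong[OF refl])
      fix i assume "i \<in> {..m}"
      then have i: "i \<le> m" "?n - i = m - i + \<alpha>" by auto
      have w: "wronski (?n - i) (m - i) x y = (x - y) * lag_kernel \<alpha> (m - i) x y * (fact (?n - i) * fact (m - i))"
        unfolding i(2) christoffel_darboux by simp
      have "real (rook ?n m i) * (fact (?n - i) * fact (m - i)) * fact i
        = (real (?n choose i) * (fact i * fact (?n - i))) * (real (m choose i) * (fact i * fact (m - i)))"
        by (simp add: rook_def)
      also have "\<dots> = fact ?n * fact m"
        using i(1) fact_binomial_real[of i ?n] fact_binomial_real[of i m] by simp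
      finally have r: "real (rook ?n m i) * (fact (?n - i) * fact (m - i)) = fact ?n * fact m / fact i"
        by (simp add: nonzero_eq_divide_eq)
      have "real (rook ?n m i) * \<kappa> ^ i * wronski (?n - i) (m - i) x y
        = (real (rook ?n m i) * (fact (?n - i) * fact (m - i))) * (\<kappa> ^ i * ((x - y) * lag_kernel \<alpha> (m - i) x y))"
        unfolding w by (simp only: mult_ac)
      then show "real (rook ?n m i) * \<kappa> ^ i * wronski (?n - i) (m - i) x y
        = (x - y) * (fact ?n * fact m * (\<kappa> ^ i / fact i * lag_kernel \<alpha> (m - i) x y))"
        unfolding r by simp
    qed
    also have "\<dots> = (x - y) * (fact ?n * fact m * (\<Sum>i\<le>m. \<kappa> ^ i / fact i * lag_kernel \<alpha> (m - i) x y))"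
      by (simp only: sum_distrib_left)
    finally have "(of_real x - of_real y) * ?E y = (of_real x - of_real y) * ?K y"
      by simp
    moreover have "(of_real x - of_real y :: complex) \<noteq> 0" using that by simp
    ultimately show ?thesis
      using mult_cancel_left[of "of_real x - of_real y :: complex" "?E y" "?K y"] by blast
  qed
  have contK: "isCont ?K x"
    unfolding lag_kernel_def by (intro continuous_intros) auto
  have contE: "isCont ?E x"
  proof -
    have int: "integrable M (\<lambda>\<omega>. gram_det ?n m (of_real x) (\<lambda>i. Z i \<omega>) * coeff (gram_charpoly ?n m (\<lambda>i. Z i \<omega>)) k)" for k
    proof (rule dominated_integrable[of "{..<?n} \<times> {..<m}"])
      show "dominated ({..<?n} \<times> {..<m}) 4 (\<lambda>z. gram_det ?n m (of_real x) z * coeff (gram_charpoly ?n m z) k)"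
        using dominated_mult[OF dominated_gram_det[of ?n m "of_real x"] dominated_coeff_gram_charpoly[of ?n m k]] by simp
    qed simp
    have "gram_det ?n m (of_real x) z * gram_det ?n m (of_real y) z
      = (\<Sum>k\<le>m. (- 1) ^ m * of_real y ^ k * (gram_det ?n m (of_real x) z * coeff (gram_charpoly ?n m z) k))" for y z
    proof -
      have "gram_det ?n m (of_real y) z = (- 1) ^ m * (\<Sum>k\<le>m. coeff (gram_charpoly ?n m z) k * of_real y ^ k)"
        by (simp only: gram_det_eq_charpoly poly_eq_sum_le[OF eq_refl[OF degree_gram_charpoly]])
      moreover have "d * (e * (\<Sum>k\<le>m. c k * f k)) = (\<Sum>k\<le>m. e * f k * (d * c k))" for d e c and f :: "nat \<Rightarrow> complex"
        unfolding sum_distrib_left by (intro sum.cong refl) (simp only: mult_ac)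
      ultimately show ?thesis by (simp only:)
    qed
    then have "?E = (\<lambda>y. \<Sum>k\<le>m. (- 1) ^ m * of_real y ^ k *
        (\<integral>\<omega>. gram_det ?n m (of_real x) (\<lambda>i. Z i \<omega>) * coeff (gram_charpoly ?n m (\<lambda>i. Z i \<omega>)) k \<partial>M))"
      using int by (intro ext) (simp add: Bochner_Integration.integral_sum)
    then show ?thesis by (simp only:) (intro continuous_intros)
  qed
  show ?thesis
    using off continuous_eq_punctured[OF contE contK off] by (cases "y = x") auto
qed

section \<open>From the matrix model to the closed form\<close>

lemma sample_covariance_eq_gram:
  assumes "A \<in> carrier_mat n m"
  shows "sample_covariance A = gram n m (\<lambda>(i, j). A $$ (i, j))"
proof (rule eq_matI)
  fix i j assume "i < dim_row (gram n m (\<lambda>(i, j). A $$ (i, j)))" "j < dim_col (gram n m (\<lambda>(i, j). A $$ (i, j)))"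
  then have ij: "i < m" "j < m" by (auto simp: gram_def)
  have "row (mat_adjoint A) i = conjugate (col A i)"
    using assms ij by (simp add: mat_adjoint_def)
  then show "sample_covariance A $$ (i, j) = gram n m (\<lambda>(i, j). A $$ (i, j)) $$ (i, j)"
    using assms ij
    by (simp add: sample_covariance_def gram_def scalar_prod_def mat_adjoint_def atLeast0LessThan)
qed (use assms in \<open>auto simp: sample_covariance_def gram_def mat_adjoint_def\<close>)

context
  fixes Q :: "real measure" and b :: real
  assumes Q: "real_distribution Q" and int4: "integrable Q (\<lambda>x. x ^ 4)" and b: "b = (\<integral>x. x ^ 4 \<partial>Q)"
    and mean: "prob_space.expectation Q (\<lambda>x. x) = 0" and var: "prob_space.variance Q (\<lambda>x. x) = 1 / 2"
begin

interpretation Q: real_distribution Q by (fact Q)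

lemma Q_integrable: "integrable Q (\<lambda>x. x)" "integrable Q (\<lambda>x. x\<^sup>2)"
proof -
  have i: "integrable Q (\<lambda>x. 1 + x ^ 4)" using int4 by simp
  have le: "\<bar>x\<bar> \<le> 1 + x ^ 4" "x\<^sup>2 \<le> 1 + x ^ 4" for x :: real
  proof -
    have "0 \<le> (x\<^sup>2 - 1)\<^sup>2" "0 \<le> (\<bar>x\<bar> - 1)\<^sup>2" by simp_all
    then have "2 * x\<^sup>2 \<le> 1 + x ^ 4" "2 * \<bar>x\<bar> \<le> 1 + x\<^sup>2"
      by (simp_all add: power2_eq_square eval_nat_numeral algebra_simps)
    moreover have "0 \<le> x\<^sup>2" "0 \<le> x ^ 4" by simp_all
    ultimately show "\<bar>x\<bar> \<le> 1 + x ^ 4" "x\<^sup>2 \<le> 1 + x ^ 4" by linarith+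
  qed
  show "integrable Q (\<lambda>x. x)" "integrable Q (\<lambda>x. x\<^sup>2)"
    by (rule Bochner_Integration.integrable_bound[OF i]; use le in \<open>auto intro!: AE_I2\<close>)+
qed

lemma Q_second_moment: "(\<integral>x. x\<^sup>2 \<partial>Q) = 1 / 2"
  using var mean by simp

text \<open>The fourth absolute moment is b + 2 (1/2)^2 + b = 2 b + 1/2, that is 2 + 2 (b - 3/4).
  The mean of the squared entry vanishes because real and imaginary part have the same variance and
  are uncorrelated.\<close>

lemma iid_complex_matrix_moment_array:
  assumes X: "iid_complex_matrix M Q n m X"
  shows "moment_array M (\<lambda>(i, j) \<omega>. X \<omega> $$ (i, j)) n m (2 * (b - 3 / 4))"
proof -
  interpret iid_complex_matrix M Q n m X by fact
  let ?Z = "\<lambda>(i, j) \<omega>. X \<omega> $$ (i, j)"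
  show ?thesis
  proof
    show "indep_vars (\<lambda>_. borel) ?Z ({..<n} \<times> {..<m})" by (rule X_indep)
    fix ij assume "ij \<in> {..<n} \<times> {..<m}"
    then obtain i j where ij: "ij = (i, j)" "i < n" "j < m" by auto
    define z where "z \<omega> = X \<omega> $$ (i, j)" for \<omega>
    define R where "R \<omega> = Re (z \<omega>)" for \<omega>
    define J where "J \<omega> = Im (z \<omega>)" for \<omega>
    have Z: "?Z ij = z" by (simp add: ij z_def fun_eq_iff)
    have ind: "indep_var borel R borel J"
      unfolding R_def J_def z_def by (rule X_Re_Im_indep[OF ij(2,3)])
    have rv: "R \<in> borel_measurable M" "J \<in> borel_measurable M"
      using indep_var_rv1[OF ind] indep_var_rv2[OF ind] by auto
    have dR: "distr M borel R = Q" and dJ: "distr M borel J = Q"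
      unfolding R_def J_def z_def using X_Re_distr[OF ij(2,3)] X_Im_distr[OF ij(2,3)] by auto
    have transfer: "integrable M (\<lambda>\<omega>. f (R \<omega>))" "integrable M (\<lambda>\<omega>. f (J \<omega>))"
      "(\<integral>\<omega>. f (R \<omega>) \<partial>M) = (\<integral>x. f x \<partial>Q)" "(\<integral>\<omega>. f (J \<omega>) \<partial>M) = (\<integral>x. f x \<partial>Q)"
      if "integrable Q f" "f \<in> borel_measurable borel" for f :: "real \<Rightarrow> real"
      using that integrable_distr_eq[OF rv(1) that(2)] integrable_distr_eq[OF rv(2) that(2)]
        integral_distr[OF rv(1) that(2)] integral_distr[OF rv(2) that(2)] unfolding dR dJ by auto
    note t1 = transfer[OF Q_integrable(1)] and t2 = transfer[OF Q_integrable(2)] and t4 = transfer[OF int4]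
    have ind2: "indep_var borel (\<lambda>\<omega>. (R \<omega>)\<^sup>2) borel (\<lambda>\<omega>. (J \<omega>)\<^sup>2)"
      using indep_var_compose[OF ind, of "\<lambda>x. x\<^sup>2" borel "\<lambda>x. x\<^sup>2" borel] by (simp add: comp_def)
    have RJ: "integrable M (\<lambda>\<omega>. R \<omega> * J \<omega>)" "(\<integral>\<omega>. R \<omega> * J \<omega> \<partial>M) = 0"
      using indep_var_integrable[OF ind] indep_var_lebesgue_integral[OF ind] t1 mean by simp_all
    have RJ2: "integrable M (\<lambda>\<omega>. (R \<omega>)\<^sup>2 * (J \<omega>)\<^sup>2)" "(\<integral>\<omega>. (R \<omega>)\<^sup>2 * (J \<omega>)\<^sup>2 \<partial>M) = 1 / 4"
      using indep_var_integrable[OF ind2] indep_var_lebesgue_integral[OF ind2] t2 Q_second_moment by simp_all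
    have z: "z \<omega> = of_real (R \<omega>) + \<i> * of_real (J \<omega>)" for \<omega>
      by (simp add: R_def J_def complex_eq_iff)
    have zz: "z \<omega> * z \<omega> = of_real ((R \<omega>)\<^sup>2 - (J \<omega>)\<^sup>2) + \<i> * of_real (2 * (R \<omega> * J \<omega>))" for \<omega>
      by (simp add: z complex_eq_iff power2_eq_square)
    have zcz: "z \<omega> * cnj (z \<omega>) = of_real ((R \<omega>)\<^sup>2 + (J \<omega>)\<^sup>2)" for \<omega>
      by (simp add: z complex_eq_iff power2_eq_square)
    have fourth: "((R \<omega>)\<^sup>2 + (J \<omega>)\<^sup>2)\<^sup>2 = (R \<omega>) ^ 4 + 2 * ((R \<omega>)\<^sup>2 * (J \<omega>)\<^sup>2) + (J \<omega>) ^ 4" for \<omega>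
      by (simp add: power2_eq_square eval_nat_numeral algebra_simps)
    have "norm (z \<omega>) ^ 4 = ((R \<omega>)\<^sup>2 + (J \<omega>)\<^sup>2)\<^sup>2" for \<omega>
    proof -
      have "norm (z \<omega>) ^ 4 = ((norm (z \<omega>))\<^sup>2)\<^sup>2" by (simp add: power_mult[symmetric])
      then show ?thesis by (simp add: cmod_power2 R_def J_def)
    qed
    then show "integrable M (\<lambda>\<omega>. norm (?Z ij \<omega>) ^ 4)"
      unfolding Z using t4 RJ2 by (simp add: fourth)
    show "(\<integral>\<omega>. ?Z ij \<omega> \<partial>M) = 0"
      unfolding Z z using t1 mean by simp
    show "(\<integral>\<omega>. ?Z ij \<omega> * ?Z ij \<omega> \<partial>M) = 0"
    proof -
      have "(\<integral>\<omega>. of_real (f \<omega>) + \<i> * of_real (g \<omega>) \<partial>M) = of_real (\<integral>\<omega>. f \<omega> \<partial>M) + \<i> * of_real (\<integral>\<omega>. g \<omega> \<partial>M)"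
        if "integrable M f" "integrable M g" for f g :: "'a \<Rightarrow> real"
        using that by simp
      from this[of "\<lambda>\<omega>. (R \<omega>)\<^sup>2 - (J \<omega>)\<^sup>2" "\<lambda>\<omega>. 2 * (R \<omega> * J \<omega>)"]
      show ?thesis unfolding Z zz using t2 RJ by simp
    qed
    show "(\<integral>\<omega>. ?Z ij \<omega> * cnj (?Z ij \<omega>) \<partial>M) = 1"
    proof -
      have "(\<integral>\<omega>. (R \<omega>)\<^sup>2 + (J \<omega>)\<^sup>2 \<partial>M) = 1" using t2 Q_second_moment by simp
      then show ?thesis unfolding Z zcz integral_complex_of_real by simp
    qed
    have sq: "(z \<omega> * cnj (z \<omega>)) * (z \<omega> * cnj (z \<omega>)) = of_real (((R \<omega>)\<^sup>2 + (J \<omega>)\<^sup>2)\<^sup>2)" for \<omega>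
      unfolding zcz by (simp only: of_real_mult[symmetric]) (simp only: power2_eq_square)
    have "(\<integral>\<omega>. ((R \<omega>)\<^sup>2 + (J \<omega>)\<^sup>2)\<^sup>2 \<partial>M) = 2 * b + 1 / 2"
      unfolding fourth using t4 RJ2 b by simp
    then show "(\<integral>\<omega>. (?Z ij \<omega> * cnj (?Z ij \<omega>)) * (?Z ij \<omega> * cnj (?Z ij \<omega>)) \<partial>M) = 2 + of_real (2 * (b - 3 / 4))"
      unfolding Z sq integral_complex_of_real by simp
  qed
qed

lemma charpoly_correlation_eq:
  assumes X: "iid_complex_matrix M Q (m + \<alpha>) m X"
  shows "charpoly_correlation M X m (of_real x) (of_real y)
    = of_real (fact (m + \<alpha>) * fact m *
        (\<Sum>i\<le>m. (2 * (b - 3 / 4)) ^ i / fact i * lag_kernel \<alpha> (m - i) x y))"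
proof -
  interpret iid_complex_matrix M Q "m + \<alpha>" m X by fact
  have "charpoly_correlation M X m (of_real x) (of_real y)
    = (\<integral>\<omega>. gram_det (m + \<alpha>) m (of_real x) (\<lambda>i. (\<lambda>(i, j) \<omega>. X \<omega> $$ (i, j)) i \<omega>)
         * gram_det (m + \<alpha>) m (of_real y) (\<lambda>i. (\<lambda>(i, j) \<omega>. X \<omega> $$ (i, j)) i \<omega>) \<partial>M)"
    unfolding charpoly_correlation_def
  proof (rule Bochner_Integration.integral_cong[OF refl])
    fix \<omega> assume "\<omega> \<in> space M"
    from sample_covariance_eq_gram[OF X_carrier[OF this]]
    show "Determinant.det (sample_covariance (X \<omega>) - complex_of_real x \<cdot>\<^sub>m 1\<^sub>m m)
        * Determinant.det (sample_covariance (X \<omega>) - complex_of_real y \<cdot>\<^sub>m 1\<^sub>m m)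
      = gram_det (m + \<alpha>) m (of_real x) (\<lambda>i. (\<lambda>(i, j) \<omega>. X \<omega> $$ (i, j)) i \<omega>)
         * gram_det (m + \<alpha>) m (of_real y) (\<lambda>i. (\<lambda>(i, j) \<omega>. X \<omega> $$ (i, j)) i \<omega>)"
      by (simp add: gram_det_def shifted_gram_def case_prod_unfold)
  qed
  then show ?thesis
    using gram_correlation[OF iid_complex_matrix_moment_array[OF X]] by simp
qed

end

section \<open>The limit theorem\<close>

theorem theorem4p1:
  fixes Q :: "real measure" and b :: real
    and M :: "nat \<Rightarrow> nat \<Rightarrow> 'a measure" and X :: "nat \<Rightarrow> nat \<Rightarrow> 'a \<Rightarrow> complex mat"
    and f :: "nat \<Rightarrow> nat \<Rightarrow> complex \<Rightarrow> complex \<Rightarrow> complex"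
    and g :: "real \<Rightarrow> real"
    and bstar :: real and \<alpha> :: nat and \<xi> \<mu> \<nu> :: real
  defines "f \<equiv> \<lambda>n m. charpoly_correlation (M n m) (X n m) m"
    and "g \<equiv> marchenko_pastur_density"
    and "bstar \<equiv> 2 * (b - 3 / 4)"
  assumes Q_distribution: "real_distribution Q"
    and Q_fourth_moment: "integrable Q (\<lambda>x. x ^ 4)" "b = (\<integral>x. x ^ 4 \<partial>Q)"
    and Q_expectation: "prob_space.expectation Q (\<lambda>x. x) = 0"
    and Q_variance: "prob_space.variance Q (\<lambda>x. x) = 1 / 2"
    and X_matrix: "\<And>n m. m \<le> n \<Longrightarrow> iid_complex_matrix (M n m) Q n m (X n m)"
    and xi_bulk: "\<xi> \<in> {0<..<4}"
  shows "(\<lambda>N. complex_of_real (inverse (g \<xi>) * Z_factor \<alpha> N \<xi> (\<mu> / g \<xi>) (\<nu> / g \<xi>)) *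
             (f N (N - \<alpha>) (complex_of_real (real N * \<xi> + \<mu> / g \<xi>))
                          (complex_of_real (real N * \<xi> + \<nu> / g \<xi>)) /
              (fact N * fact (N - \<alpha>))))
         \<longlonglongrightarrow> complex_of_real (exp bstar * sine_kernel \<mu> \<nu>)"
proof (rule LIMSEQ_offset[where k = \<alpha>])
  \<comment> \<open>With N = m + \<alpha> the truncated difference \<open>N - \<alpha>\<close>
    becomes m.\<close>
  have \<xi>: "0 < \<xi>" "\<xi> < 4" using xi_bulk by auto
  define \<omega> where "\<omega> = sqrt (1 / \<xi> - 1 / 4)"
  define s t where "s = \<mu> / g \<xi>" and "t = \<nu> / g \<xi>"
  define x y where "x m = real (m + \<alpha>) * \<xi> + s" and "y m = real (m + \<alpha>) * \<xi> + t" for m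
  define S where "S m = (\<Sum>i\<le>m. bstar ^ i / fact i * lag_kernel \<alpha> (m - i) (x m) (y m))" for m
  have g: "g \<xi> = \<omega> / pi" "g \<xi> > 0"
    unfolding g_def \<omega>_def by (fact marchenko_pastur_density_eq[OF \<xi>])+
  have corr: "f (m + \<alpha>) m (of_real (x m)) (of_real (y m)) = of_real (fact (m + \<alpha>) * fact m * S m)" for m
    unfolding f_def S_def bstar_def
    by (rule charpoly_correlation_eq[OF Q_distribution Q_fourth_moment Q_expectation Q_variance X_matrix]) simp
  have pos: "\<forall>\<^sub>F m in sequentially. 0 < real (m + \<alpha>) * \<xi> + z" for z
    using \<xi> by real_asymp
  have "(\<lambda>m. lag_weight \<alpha> (x m) * lag_weight \<alpha> (y m) * S m)
      \<longlonglongrightarrow> exp bstar * (if s = t then \<omega> / pi else sin (\<omega> * (s - t)) / (pi * (s - t)))"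
    unfolding x_def y_def S_def \<omega>_def by (rule lag_kernel_exponential_sum_limit[OF \<xi>])
  then have "(\<lambda>m. inverse (g \<xi>) * (lag_weight \<alpha> (x m) * lag_weight \<alpha> (y m) * S m))
      \<longlonglongrightarrow> inverse (g \<xi>) * (exp bstar * (if s = t then \<omega> / pi else sin (\<omega> * (s - t)) / (pi * (s - t))))"
    by (rule tendsto_mult_left)
  also have "inverse (g \<xi>) * (exp bstar * (if s = t then \<omega> / pi else sin (\<omega> * (s - t)) / (pi * (s - t))))
      = exp bstar * sine_kernel \<mu> \<nu>"
  proof -
    \<comment> \<open>Since the density at \<xi> is \<omega> / pi, dividing \<mu> and \<nu> by it
      turns the frequency \<omega> into pi, and the prefactor turns the diagonal value \<omega> / pi
      into 1.\<close>
    have eqs: "\<omega> * (s - t) = pi * (\<mu> - \<nu>)" "g \<xi> * (pi * (s - t)) = pi * (\<mu> - \<nu>)" "s = t \<longleftrightarrow> \<mu> = \<nu>"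
      using g by (auto simp: s_def t_def field_simps)
    have "inverse (g \<xi>) * (e * (p / q)) = e * (p / (g \<xi> * q))" for e p q
      by (simp add: divide_inverse mult_ac)
    then show ?thesis
      using g unfolding sine_kernel_def eqs(3) eqs(1) eqs(2)[symmetric] by auto
  qed
  finally have lim: "(\<lambda>m. inverse (g \<xi>) * (lag_weight \<alpha> (x m) * lag_weight \<alpha> (y m) * S m))
      \<longlonglongrightarrow> exp bstar * sine_kernel \<mu> \<nu>" .
  have "\<forall>\<^sub>F m in sequentially.
      complex_of_real (inverse (g \<xi>) * (lag_weight \<alpha> (x m) * lag_weight \<alpha> (y m) * S m)) =
      complex_of_real (inverse (g \<xi>) * Z_factor \<alpha> (m + \<alpha>) \<xi> (\<mu> / g \<xi>) (\<nu> / g \<xi>)) *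
             (f (m + \<alpha>) (m + \<alpha> - \<alpha>) (complex_of_real (real (m + \<alpha>) * \<xi> + \<mu> / g \<xi>))
                          (complex_of_real (real (m + \<alpha>) * \<xi> + \<nu> / g \<xi>)) /
              (fact (m + \<alpha>) * fact (m + \<alpha> - \<alpha>)))"
    using pos[of s] pos[of t]
  proof eventually_elim
    case (elim m)
    have "f (m + \<alpha>) m (of_real (x m)) (of_real (y m)) / (fact (m + \<alpha>) * fact m) = of_real (S m)"
      unfolding corr by simp
    then show ?case
      unfolding s_def[symmetric] t_def[symmetric] x_def[symmetric] y_def[symmetric] diff_add_inverse2
        Z_factor_eq[OF elim, folded x_def y_def] by simp
  qed
  with tendsto_of_real[OF lim]
  show "(\<lambda>m. complex_of_real (inverse (g \<xi>) * Z_factor \<alpha> (m + \<alpha>) \<xi> (\<mu> / g \<xi>) (\<nu> / g \<xi>)) *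
             (f (m + \<alpha>) (m + \<alpha> - \<alpha>) (complex_of_real (real (m + \<alpha>) * \<xi> + \<mu> / g \<xi>))
                          (complex_of_real (real (m + \<alpha>) * \<xi> + \<nu> / g \<xi>)) /
              (fact (m + \<alpha>) * fact (m + \<alpha> - \<alpha>))))
         \<longlonglongrightarrow> complex_of_real (exp bstar * sine_kernel \<mu> \<nu>)"
    by (rule Lim_transform_eventually)
qed

end
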